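(* Let $k$ be a field of characteristic zero. For each positive integer $r$, let $e(r)$ be the largest integer $e$ such that all artinian level algebras over $k$ of codimension $r$ and socle degree $\le e$ enjoy the Weak Lefschetz Property, with $e(r)=+\infty$ if no such largest integer exists (i.e. if all artinian level algebras of codimension $r$ enjoy it). Then $$e(r)=\begin{cases} +\infty, & r\le 2;\\ 2, & r=3;\\ 1, & r\ge 4.\end{cases}$$
   Context: All algebras are standard graded $k$-algebras $A=\bigoplus_{i\ge 0}A_i$ (quotients of polynomial rings by homogeneous ideals). The codimension of an artinian $A$ is $r=\dim_k A_1$. An artinian algebra $A$ is level of type $t$ if its socle has dimension $t$ and is concentrated in one degree, namely the last degree in which $A$ is non-zero; this last degree is the socle degree. $A$ has the Weak Lefschetz Property if for a general linear form $L\in A_1$ (i.e. for all $L$ in some non-empty Zariski-open subset of $A_1$) the multiplication map $\times L:A_i\to A_{i+1}$ has maximal rank (is injective or surjective) for every $i$. *)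

theory Defs
  imports
    "HOL-Library.Poly_Mapping"
    "HOL-Library.Extended_Nat"
    "HOL-Algebra.Embedded_Algebras"
    "HOL-Algebra.QuotRing"
begin

section \<open>Polynomial rings and homogeneous ideals\<close>

text \<open>A monomial is its exponent vector, a finitely supported function on the indices of the
  variables. The product of \<^typ>\<open>(nat \<Rightarrow>\<^sub>0 nat) \<Rightarrow>\<^sub>0 'k\<close> provided by the library is the
  convolution, that is, the product of polynomials. The ring \<open>k[x_0, ..., x_{n-1}]\<close> is the
  subring of those polynomials in which only variables of index less than \<open>n\<close> occur.\<close>

type_synonym 'k mpoly = "(nat \<Rightarrow>\<^sub>0 nat) \<Rightarrow>\<^sub>0 'k"

definition mono_degree :: "(nat \<Rightarrow>\<^sub>0 nat) \<Rightarrow> nat" where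
  "mono_degree m = (\<Sum>i\<in>Poly_Mapping.keys m. Poly_Mapping.lookup m i)"

definition polys :: "nat \<Rightarrow> 'k::field mpoly set" where
  "polys n = {p. \<forall>m\<in>Poly_Mapping.keys p. Poly_Mapping.keys m \<subseteq> {..<n}}"

definition poly_ring :: "nat \<Rightarrow> 'k::field mpoly ring" where
  "poly_ring n = \<lparr>carrier = polys n, mult = (*), one = 1, zero = 0, add = (+)\<rparr>"

definition const_poly :: "'k::field \<Rightarrow> 'k mpoly" where
  "const_poly c = Poly_Mapping.single 0 c"

definition forms :: "nat \<Rightarrow> nat \<Rightarrow> 'k::field mpoly set" where
  "forms n d = {p \<in> polys n. \<forall>m\<in>Poly_Mapping.keys p. mono_degree m = d}"

definition homogeneous_component :: "nat \<Rightarrow> 'k::field mpoly \<Rightarrow> 'k mpoly" where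
  "homogeneous_component d p =
     (\<Sum>m | m \<in> Poly_Mapping.keys p \<and> mono_degree m = d.
        Poly_Mapping.single m (Poly_Mapping.lookup p m))"

definition homogeneous_ideal :: "nat \<Rightarrow> 'k::field mpoly set \<Rightarrow> bool" where
  "homogeneous_ideal n I \<longleftrightarrow>
     ideal I (poly_ring n) \<and> (\<forall>p\<in>I. \<forall>d. homogeneous_component d p \<in> I)"

lemma cring_poly_ring: "cring (poly_ring n :: 'k::field mpoly ring)"
proof (rule cringI)
  have zero: "0 \<in> polys n" and one: "1 \<in> polys n"
    by (simp_all add: polys_def)
  have add: "p + q \<in> polys n" if "p \<in> polys n" "q \<in> polys n" for p q :: "'k mpoly"
    using that Poly_Mapping.keys_add[of p q] unfolding polys_def by blast
  have mult: "p * q \<in> polys n" if "p \<in> polys n" "q \<in> polys n" for p q :: "'k mpoly"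
  proof -
    have "Poly_Mapping.keys m \<subseteq> {..<n}" if m: "m \<in> Poly_Mapping.keys (p * q)" for m
    proof -
      obtain a b where ab: "m = a + b" "a \<in> Poly_Mapping.keys p" "b \<in> Poly_Mapping.keys q"
        using Poly_Mapping.keys_mult[of p q] m by blast
      have "Poly_Mapping.keys a \<subseteq> {..<n}" "Poly_Mapping.keys b \<subseteq> {..<n}"
        using ab \<open>p \<in> polys n\<close> \<open>q \<in> polys n\<close> unfolding polys_def by blast+
      then show ?thesis
        using Poly_Mapping.keys_add[of a b] ab(1) by blast
    qed
    then show ?thesis unfolding polys_def by blast
  qed
  have uminus: "\<exists>q\<in>polys n. p + q = 0" if "p \<in> polys n" for p :: "'k mpoly"
    using that by (intro bexI[of _ "- p"]) (simp_all add: polys_def)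
  show "abelian_group (poly_ring n :: 'k mpoly ring)"
    by (rule abelian_groupI) (simp_all add: poly_ring_def zero add uminus add_ac)
  show "Group.comm_monoid (poly_ring n :: 'k mpoly ring)"
    by (rule comm_monoidI) (simp_all add: poly_ring_def one mult mult_ac)
qed (simp add: poly_ring_def distrib_right)


section \<open>Standard graded algebras\<close>

text \<open>A standard graded \<open>k\<close>-algebra \<open>A\<close> is the quotient of \<open>k[x_0, ..., x_{n-1}]\<close> by a
  homogeneous ideal \<open>I\<close>. The notions below take the presentation \<open>(n, I)\<close> as arguments; \<open>I\<close> may
  contain linear forms, so \<open>n\<close> need not be the codimension.\<close>

definition quotient_algebra :: "nat \<Rightarrow> 'k::field mpoly set \<Rightarrow> 'k mpoly set ring" where
  "quotient_algebra n I = poly_ring n Quot I"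

definition residue_class :: "nat \<Rightarrow> 'k::field mpoly set \<Rightarrow> 'k mpoly \<Rightarrow> 'k mpoly set" where
  "residue_class n I p = I +>\<^bsub>poly_ring n\<^esub> p"

definition graded_piece :: "nat \<Rightarrow> 'k::field mpoly set \<Rightarrow> nat \<Rightarrow> 'k mpoly set set" where
  "graded_piece n I i = residue_class n I ` forms n i"

definition irrelevant_ideal :: "nat \<Rightarrow> 'k::field mpoly set \<Rightarrow> 'k mpoly set set" where
  "irrelevant_ideal n I = residue_class n I ` {p \<in> polys n. Poly_Mapping.lookup p 0 = 0}"

text \<open>Dimensions over \<open>k\<close> are taken inside the ring \<open>A\<close>, with respect to the image of \<open>k\<close>.\<close>

definition scalars :: "nat \<Rightarrow> 'k::field mpoly set \<Rightarrow> 'k mpoly set set" where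
  "scalars n I = range (\<lambda>c. residue_class n I (const_poly c))"

definition has_dim :: "nat \<Rightarrow> 'k::field mpoly set \<Rightarrow> nat \<Rightarrow> 'k mpoly set set \<Rightarrow> bool" where
  "has_dim n I d V \<longleftrightarrow> ring.dimension (quotient_algebra n I) d (scalars n I) V"

definition has_codimension :: "nat \<Rightarrow> 'k::field mpoly set \<Rightarrow> nat \<Rightarrow> bool" where
  "has_codimension n I r \<longleftrightarrow> has_dim n I r (graded_piece n I 1)"

definition artinian_ring :: "('a, 'b) ring_scheme \<Rightarrow> bool" where
  "artinian_ring R \<longleftrightarrow> cring R \<and>
     (\<forall>C :: nat \<Rightarrow> 'a set. (\<forall>i. ideal (C i) R) \<and> (\<forall>i. C (Suc i) \<subseteq> C i) \<longrightarrow>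
        (\<exists>m. \<forall>i\<ge>m. C i = C m))"

definition socle :: "nat \<Rightarrow> 'k::field mpoly set \<Rightarrow> 'k mpoly set set" where
  "socle n I = {a \<in> carrier (quotient_algebra n I).
     \<forall>b\<in>irrelevant_ideal n I. b \<otimes>\<^bsub>quotient_algebra n I\<^esub> a = \<zero>\<^bsub>quotient_algebra n I\<^esub>}"

text \<open>Only meaningful for artinian \<open>A \<noteq> 0\<close>, where the last non-zero degree exists.\<close>

definition socle_degree :: "nat \<Rightarrow> 'k::field mpoly set \<Rightarrow> nat" where
  "socle_degree n I = (GREATEST i. graded_piece n I i \<noteq> {\<zero>\<^bsub>quotient_algebra n I\<^esub>})"

definition level_of_type :: "nat \<Rightarrow> 'k::field mpoly set \<Rightarrow> nat \<Rightarrow> bool" where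
  "level_of_type n I t \<longleftrightarrow>
     has_dim n I t (socle n I) \<and> socle n I \<subseteq> graded_piece n I (socle_degree n I)"


section \<open>The Weak Lefschetz Property\<close>

text \<open>The Zariski topology of the finite-dimensional space \<open>A_1\<close>, without a choice of basis:
  polynomial functions on \<open>A_1\<close> are those generated by constants and linear functionals under
  sums and products, and an open set is the complement of a common zero locus. The values of
  these functions outside \<open>A_1\<close> are irrelevant.\<close>

definition linear_functional :: "nat \<Rightarrow> 'k::field mpoly set \<Rightarrow> ('k mpoly set \<Rightarrow> 'k) \<Rightarrow> bool" where
  "linear_functional n I f \<longleftrightarrow>
     (\<forall>a\<in>graded_piece n I 1. \<forall>b\<in>graded_piece n I 1.
        f (a \<oplus>\<^bsub>quotient_algebra n I\<^esub> b) = f a + f b) \<and>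
     (\<forall>c. \<forall>a\<in>graded_piece n I 1.
        f (residue_class n I (const_poly c) \<otimes>\<^bsub>quotient_algebra n I\<^esub> a) = c * f a)"

inductive_set polynomial_functions :: "nat \<Rightarrow> 'k::field mpoly set \<Rightarrow> ('k mpoly set \<Rightarrow> 'k) set"
  for n :: nat and I :: "'k::field mpoly set" where
  const: "(\<lambda>_. c) \<in> polynomial_functions n I"
| linear: "linear_functional n I f \<Longrightarrow> f \<in> polynomial_functions n I"
| add: "f \<in> polynomial_functions n I \<Longrightarrow> g \<in> polynomial_functions n I \<Longrightarrow>
    (\<lambda>a. f a + g a) \<in> polynomial_functions n I"
| mult: "f \<in> polynomial_functions n I \<Longrightarrow> g \<in> polynomial_functions n I \<Longrightarrow>
    (\<lambda>a. f a * g a) \<in> polynomial_functions n I"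

definition zariski_open :: "nat \<Rightarrow> 'k::field mpoly set \<Rightarrow> 'k mpoly set set \<Rightarrow> bool" where
  "zariski_open n I U \<longleftrightarrow>
     (\<exists>S\<subseteq>polynomial_functions n I. U = {a \<in> graded_piece n I 1. \<exists>f\<in>S. f a \<noteq> 0})"

definition multiplication_has_maximal_rank ::
    "nat \<Rightarrow> 'k::field mpoly set \<Rightarrow> 'k mpoly set \<Rightarrow> nat \<Rightarrow> bool" where
  "multiplication_has_maximal_rank n I L i \<longleftrightarrow>
     inj_on (\<lambda>a. L \<otimes>\<^bsub>quotient_algebra n I\<^esub> a) (graded_piece n I i) \<or>
     (\<lambda>a. L \<otimes>\<^bsub>quotient_algebra n I\<^esub> a) ` graded_piece n I i = graded_piece n I (Suc i)"

definition weak_lefschetz :: "nat \<Rightarrow> 'k::field mpoly set \<Rightarrow> bool" where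
  "weak_lefschetz n I \<longleftrightarrow>
     (\<exists>U. zariski_open n I U \<and> U \<noteq> {} \<and>
        (\<forall>L\<in>U. \<forall>i. multiplication_has_maximal_rank n I L i))"


section \<open>The bound on the socle degree\<close>

definition all_level_weak_lefschetz :: "'k::field itself \<Rightarrow> nat \<Rightarrow> nat \<Rightarrow> bool" where
  "all_level_weak_lefschetz _ r e \<longleftrightarrow>
     (\<forall>n (I :: 'k mpoly set).
        homogeneous_ideal n I \<longrightarrow> artinian_ring (quotient_algebra n I) \<longrightarrow>
        has_codimension n I r \<longrightarrow> (\<exists>t. level_of_type n I t) \<longrightarrow> socle_degree n I \<le> e \<longrightarrow>
        weak_lefschetz n I)"

text \<open>An artinian algebra of positive codimension has positive socle degree, so the bound \<open>e = 0\<close>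
  always qualifies and it suffices to let \<open>e\<close> range over the natural numbers.\<close>

definition lefschetz_bound :: "'k::field itself \<Rightarrow> nat \<Rightarrow> enat" where
  "lefschetz_bound k r =
     (if \<exists>e. all_level_weak_lefschetz k r e \<and> (\<forall>e'. all_level_weak_lefschetz k r e' \<longrightarrow> e' \<le> e)
      then enat (GREATEST e. all_level_weak_lefschetz k r e) else \<infinity>)"

end

theory Submission
  imports Defs "Jordan_Normal_Form.Determinant"
begin

text \<open>Let \<open>A = R/I\<close>. In codimension at most two the property is free: if \<open>f\<close> is a relation of least degree \<open>d\<close> between
  a basis of \<open>A_1\<close>, and \<open>L\<close> does not divide \<open>f\<close>, then multiplication by \<open>L\<close> is injective below degree \<open>d\<close>
  and surjective from there on.

  In codimension three and socle degree two, multiplication \<open>A_1 \<times> A_1 \<rightarrow> A_2\<close> is a non-degenerate symmetric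
  bilinear map on a three-dimensional space. If no \<open>L\<close> had maximal rank, choose \<open>L\<close> of rank two with
  \<open>L\<^sup>2 \<noteq> 0\<close>, a non-zero \<open>a\<close> with \<open>L a = 0\<close>, and \<open>c\<close> completing a basis. That \<open>L + s a + u c\<close> is never
  injective forces \<open>a\<^sup>2 = a c = 0\<close>, so \<open>a\<close> lies in the socle. Maximal rank for one \<open>L\<close> gives it on a Zariski
  open set, cut out by a minor.

  The bounds are sharp. In codimension three take \<open>k[x,y,z]/(x\<^sup>3, y\<^sup>3, z\<^sup>3, xyz)\<close> truncated after degree three:
  \<open>L = a x + b y + c z\<close> kills \<open>a\<^sup>2x\<^sup>2 + b\<^sup>2y\<^sup>2 + c\<^sup>2z\<^sup>2 - ab xy - ac xz - bc yz\<close>, while \<open>A_2\<close> and \<open>A_3\<close> both have dimension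
  six. In codimension \<open>r \<ge> 4\<close> take the socle degree two algebra in which \<open>x_2\<close> and \<open>x_3\<close> annihilate
  everything except for \<open>x_0 x_2 = x_1 x_3 \<noteq> 0\<close>: if \<open>(c, d) \<noteq> 0\<close> is a zero of \<open>L\<close> in the variables
  \<open>x_0, x_1\<close>, then \<open>L\<close> kills \<open>c x_2 + d x_3\<close>, and evaluation at \<open>(c, d)\<close> vanishes on \<open>L A_1\<close> but not on \<open>A_2\<close>.\<close>

section \<open>Polynomials and forms\<close>

text \<open>Characteristic zero enters twice. In codimension two the field must be infinite, so that
  some \<open>L\<close> does not divide the relation \<open>f\<close>. In codimension three 2 must
  be invertible, so that products are recovered from squares, and the determinants that occur must
  be non-zero at one of the few parameters \<open>s\<close>, \<open>u\<close> that are tried. The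
  counterexamples exist over every field. The obstacle in codimension three is that nothing is known
  about A_2, not even its dimension. Failure of surjectivity makes up for it: A_2 is not contained
  in L A_1 for any \<open>L\<close>. This is how \<open>L\<close> is found: if L A_1 were the line
  of L^2 whenever L^2 \<noteq> 0, then A_1 would be the sum of the line of \<open>L\<close> and the
  kernel of \<open>L\<close>, squares of kernel elements would lie on the line of L^2, and so would
  all of A_2. It also shows that c^2 lies outside L A_1. In the counterexamples no dimension is
  computed: an explicit kernel element refutes injectivity, and linear forms on the target that
  vanish on the image refute surjectivity.\<close>

lemma mono_degree_superset:
  assumes "finite A" "Poly_Mapping.keys m \<subseteq> A"
  shows "mono_degree m = (\<Sum>i\<in>A. Poly_Mapping.lookup m i)"
  unfolding mono_degree_def using assms
  by (intro sum.mono_neutral_left) (auto simp: in_keys_iff)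

lemma mono_degree_add: "mono_degree (a + b) = mono_degree a + mono_degree b"
proof -
  let ?A = "Poly_Mapping.keys a \<union> Poly_Mapping.keys b"
  have "Poly_Mapping.keys (a + b) \<subseteq> ?A"
    by (rule Poly_Mapping.keys_add)
  then show ?thesis
    using mono_degree_superset[of ?A "a + b"] mono_degree_superset[of ?A a]
      mono_degree_superset[of ?A b]
    by (simp add: lookup_add sum.distrib)
qed

lemma mono_degree_zero [simp]: "mono_degree 0 = 0"
  by (simp add: mono_degree_def)

lemma mono_degree_eq_0_iff [simp]: "mono_degree m = 0 \<longleftrightarrow> m = 0"
proof
  assume "mono_degree m = 0"
  then show "m = 0"
    unfolding mono_degree_def by (intro poly_mapping_eqI) (auto simp: in_keys_iff)
qed simp

lemma mono_degree_single [simp]: "mono_degree (Poly_Mapping.single i e) = e"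
  by (simp add: mono_degree_def)

lemma const_poly_add: "const_poly (a + b) = const_poly a + const_poly b"
  by (simp add: const_poly_def single_add)

lemma const_poly_mult: "const_poly (a * b) = const_poly a * const_poly b"
  by (simp add: const_poly_def mult_single)

lemma const_poly_uminus: "const_poly (- a) = - const_poly a"
  by (simp add: const_poly_def single_uminus)

lemma const_poly_diff: "const_poly (a - b) = const_poly a - const_poly b"
  by (simp add: const_poly_def single_diff)

lemma const_poly_0 [simp]: "const_poly 0 = 0"
  by (simp add: const_poly_def)

lemma const_poly_1 [simp]: "const_poly 1 = 1"
  by (simp add: const_poly_def)

lemma const_poly_power: "const_poly (a ^ m) = const_poly a ^ m"
  by (induction m) (simp_all add: const_poly_mult)

lemma lookup_const_poly_mult:
  "Poly_Mapping.lookup (const_poly c * p) m = c * Poly_Mapping.lookup p m"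
proof -
  have "const_poly c * p = Poly_Mapping.map ((*) c) p"
    by (simp add: const_poly_def mult_map_scale_conv_mult)
  then show ?thesis
    by (simp add: map.rep_eq when_def)
qed

lemma keys_const_poly_mult: "Poly_Mapping.keys (const_poly c * p) \<subseteq> Poly_Mapping.keys p"
  by (auto simp: in_keys_iff lookup_const_poly_mult)

text \<open>Scaling is multiplication by a constant polynomial, so ideals and spaces of forms are
  subspaces, and spans, bases and extension of linear maps become available for them.\<close>

interpretation mp: vector_space "\<lambda>c (p :: 'k::field mpoly). const_poly c * p"
  by unfold_locales (simp_all add: const_poly_add const_poly_mult algebra_simps)

lemma polys_closed:
  fixes p q :: "'k::field mpoly"
  assumes "p \<in> polys n" "q \<in> polys n"
  shows "p + q \<in> polys n" "p * q \<in> polys n"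
proof -
  interpret R: cring "poly_ring n :: 'k mpoly ring"
    by (rule cring_poly_ring)
  show "p + q \<in> polys n" "p * q \<in> polys n"
    using R.a_closed[of p q] R.m_closed[of p q] assms by (simp_all add: poly_ring_def)
qed

lemma zero_in_polys [simp]: "0 \<in> polys n"
  and one_in_polys [simp]: "1 \<in> polys n"
  and uminus_in_polys [simp]: "p \<in> polys n \<Longrightarrow> - p \<in> polys n"
  and const_in_polys [simp]: "const_poly c \<in> polys n"
  by (auto simp: polys_def const_poly_def split: if_splits)

lemma diff_in_polys: "p \<in> polys n \<Longrightarrow> q \<in> polys n \<Longrightarrow> p - q \<in> polys n"
  using polys_closed(1)[of p n "- q"] by simp

lemma sum_in_polys: "(\<And>i. i \<in> A \<Longrightarrow> f i \<in> polys n) \<Longrightarrow> sum f A \<in> polys n"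
  by (induction A rule: infinite_finite_induct) (auto intro: polys_closed)

lemma subspace_polys: "mp.subspace (polys n)"
  unfolding mp.subspace_def by (auto intro: polys_closed)

lemma forms_in_polys: "p \<in> forms n d \<Longrightarrow> p \<in> polys n"
  by (simp add: forms_def)

lemma subspace_forms: "mp.subspace (forms n d)"
  unfolding mp.subspace_def forms_def
  using Poly_Mapping.keys_add keys_const_poly_mult
  by (fastforce intro: polys_closed)

lemma forms_mult:
  assumes "p \<in> forms n d" "q \<in> forms n e"
  shows "p * q \<in> forms n (d + e)"
proof -
  have "mono_degree m = d + e" if "m \<in> Poly_Mapping.keys (p * q)" for m
    using that Poly_Mapping.keys_mult[of p q] assms mono_degree_add unfolding forms_def by fastforce
  then show ?thesis
    using assms by (simp add: forms_def polys_closed)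
qed

lemma const_in_forms: "const_poly c \<in> forms n 0"
  by (auto simp: forms_def const_poly_def split: if_splits) (auto simp: polys_def)

lemma one_in_forms: "1 \<in> forms n 0"
  using const_in_forms[of 1] by simp

lemma power_in_forms: "p \<in> forms n 1 \<Longrightarrow> p ^ e \<in> forms n e"
proof (induction e)
  case (Suc e)
  then show ?case
    using forms_mult[of p n 1 "p ^ e" e] by simp
qed (simp add: one_in_forms)

lemma forms_0: "p \<in> forms n 0 \<Longrightarrow> p = const_poly (Poly_Mapping.lookup p 0)"
  by (rule poly_mapping_eqI) (auto simp: forms_def const_poly_def lookup_single when_def in_keys_iff)

definition monom_poly :: "(nat \<Rightarrow>\<^sub>0 nat) \<Rightarrow> 'k::field mpoly" where
  "monom_poly m = Poly_Mapping.single m 1"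

abbreviation var :: "nat \<Rightarrow> 'k::field mpoly" where
  "var i \<equiv> monom_poly (Poly_Mapping.single i 1)"

lemma monom_poly_add: "monom_poly (a + b) = monom_poly a * monom_poly b"
  by (simp add: monom_poly_def mult_single)

lemma monom_poly_in_forms:
  "Poly_Mapping.keys m \<subseteq> {..<n} \<Longrightarrow> mono_degree m = d \<Longrightarrow> monom_poly m \<in> forms n d"
  by (simp add: monom_poly_def forms_def polys_def)

lemma var_in_forms: "i < n \<Longrightarrow> var i \<in> forms n 1"
  by (rule monom_poly_in_forms) auto

lemma lookup_monom_poly: "Poly_Mapping.lookup (monom_poly m) m' = (if m = m' then 1 else 0)"
  by (simp add: monom_poly_def lookup_single when_def)

lemma poly_expansion:
  "p = (\<Sum>m\<in>Poly_Mapping.keys p. const_poly (Poly_Mapping.lookup p m) * monom_poly m)"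
  by (rule poly_mapping_eqI)
    (auto simp: lookup_sum lookup_const_poly_mult lookup_monom_poly in_keys_iff if_distrib cong: if_cong)

lemma poly_in_subspace:
  fixes J :: "'k::field mpoly set"
  assumes "mp.subspace J" "\<And>m. m \<in> Poly_Mapping.keys p \<Longrightarrow> monom_poly m \<in> J"
  shows "p \<in> J"
  by (subst poly_expansion) (intro mp.subspace_sum mp.subspace_scale assms)

lemma monom_degree_Suc:
  assumes "mono_degree m = Suc d" "Poly_Mapping.keys m \<subseteq> {..<n}"
  obtains i m' where "i < n" "m = Poly_Mapping.single i 1 + m'" "mono_degree m' = d"
    "Poly_Mapping.keys m' \<subseteq> {..<n}"
proof -
  have "m \<noteq> 0"
    using assms(1) by force
  then obtain i where i: "i \<in> Poly_Mapping.keys m"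
    by (metis keys_eq_empty ex_in_conv)
  define m' where "m' = m - Poly_Mapping.single i 1"
  have m: "m = Poly_Mapping.single i 1 + m'"
    by (rule poly_mapping_eqI)
      (use i in \<open>auto simp: m'_def lookup_add lookup_minus lookup_single when_def in_keys_iff\<close>)
  have "Poly_Mapping.keys m' \<subseteq> Poly_Mapping.keys m"
    by (auto simp: m'_def in_keys_iff lookup_minus)
  then show ?thesis
    using that[of i m'] m i assms mono_degree_add[of "Poly_Mapping.single i 1" m'] by auto
qed

text \<open>Every monomial of positive degree splits off a variable. This is the induction on the
  degree that all later spanning arguments use.\<close>

lemma forms_Suc_subset:
  fixes J :: "'k::field mpoly set"
  assumes "mp.subspace J" "\<And>i q. i < n \<Longrightarrow> q \<in> forms n d \<Longrightarrow> var i * q \<in> J"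
  shows "forms n (Suc d) \<subseteq> J"
proof
  fix p :: "'k mpoly"
  assume p: "p \<in> forms n (Suc d)"
  show "p \<in> J"
  proof (rule poly_in_subspace[OF assms(1)])
    fix m assume "m \<in> Poly_Mapping.keys p"
    then obtain i m' where "i < n" "m = Poly_Mapping.single i 1 + m'" "mono_degree m' = d"
      "Poly_Mapping.keys m' \<subseteq> {..<n}"
      using p monom_degree_Suc[of m d n] unfolding forms_def polys_def by blast
    then show "monom_poly m \<in> J"
      using assms(2)[of i "monom_poly m'"] monom_poly_in_forms[of m' n d]
      by (simp add: monom_poly_add)
  qed
qed

lemma forms_finitely_spanned:
  "\<exists>B :: 'k::field mpoly set. finite B \<and> B \<subseteq> forms n d \<and> forms n d \<subseteq> mp.span B"
proof (induction d)
  case 0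
  have "p \<in> mp.span {1}" if "p \<in> forms n 0" for p :: "'k mpoly"
    using forms_0[OF that] mp.span_scale[OF mp.span_base[of 1 "{1}"]]
    by (metis insertI1 mult.right_neutral)
  then show ?case
    by (intro exI[of _ "{1}"]) (auto simp: one_in_forms)
next
  case (Suc d)
  then obtain B :: "'k mpoly set" where B: "finite B" "B \<subseteq> forms n d" "forms n d \<subseteq> mp.span B"
    by blast
  let ?C = "(\<lambda>(i, b). var i * b) ` ({..<n} \<times> B)"
  have "var i * q \<in> mp.span ?C" if "i < n" "q \<in> forms n d" for i q
  proof -
    have "q \<in> mp.span B" using B that by blast
    then show ?thesis
    proof (induction rule: mp.span_induct_alt)
      case base
      show ?case by (simp add: mp.span_zero)
    next
      case (step c x y)
      have "var i * x \<in> mp.span ?C"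
        using step that by (intro mp.span_base) auto
      from mp.span_add[OF mp.span_scale[OF this, of c] step(2)] show ?case
        by (simp add: algebra_simps)
    qed
  qed
  then have "forms n (Suc d) \<subseteq> mp.span ?C"
    by (intro forms_Suc_subset) auto
  moreover have "?C \<subseteq> forms n (Suc d)"
    using B forms_mult[OF var_in_forms, of _ n _ d] by auto
  moreover have "finite ?C"
    using B(1) by simp
  ultimately show ?case by meson
qed

lemma lookup_homogeneous_component:
  "Poly_Mapping.lookup (homogeneous_component d p) m =
    (if mono_degree m = d then Poly_Mapping.lookup p m else 0)"
  by (auto simp: homogeneous_component_def lookup_sum lookup_single when_def in_keys_iff
      if_distrib cong: if_cong)

lemma homogeneous_component_form:
  assumes "p \<in> forms n d"
  shows "homogeneous_component e p = (if e = d then p else 0)"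
  by (rule poly_mapping_eqI)
    (use assms in \<open>auto simp: lookup_homogeneous_component forms_def in_keys_iff\<close>)

lemma homogeneous_component_add:
  "homogeneous_component e (p + q) = homogeneous_component e p + homogeneous_component e q"
  by (rule poly_mapping_eqI) (simp add: lookup_homogeneous_component lookup_add)

lemma homogeneous_component_diff:
  "homogeneous_component e (p - q) = homogeneous_component e p - homogeneous_component e q"
  by (rule poly_mapping_eqI) (simp add: lookup_homogeneous_component lookup_minus)

lemma homogeneous_component_in_forms: "p \<in> polys n \<Longrightarrow> homogeneous_component d p \<in> forms n d"
  by (auto simp: forms_def polys_def in_keys_iff lookup_homogeneous_component split: if_splits)

text \<open>The free lower bound \<open>e\<close> lets a caller assume that a component named in
  advance is among the summands.\<close>

lemma homogeneous_expansion:
  "\<exists>D>e. p = (\<Sum>d<D. homogeneous_component d p)"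
proof -
  define D where "D = Suc (Max (insert e (mono_degree ` Poly_Mapping.keys p)))"
  have D: "mono_degree m < D" if "m \<in> Poly_Mapping.keys p" for m
    using that by (auto simp: D_def less_Suc_eq_le intro!: Max_ge)
  have "p = (\<Sum>d<D. homogeneous_component d p)"
  proof (rule poly_mapping_eqI)
    fix m
    have "(\<Sum>d<D. if mono_degree m = d then Poly_Mapping.lookup p m else 0) = Poly_Mapping.lookup p m"
      using D[of m] by (subst sum.delta') (auto simp: in_keys_iff)
    then show "Poly_Mapping.lookup p m = Poly_Mapping.lookup (\<Sum>d<D. homogeneous_component d p) m"
      by (simp add: lookup_sum lookup_homogeneous_component)
  qed
  moreover have "e < D"
    by (simp add: D_def less_Suc_eq_le)
  ultimately show ?thesis by blast
qed

lemma homogeneous_component_sum: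
  "homogeneous_component e (sum f S) = (\<Sum>i\<in>S. homogeneous_component e (f i))"
  by (rule poly_mapping_eqI) (simp add: lookup_homogeneous_component lookup_sum)

lemma homogeneous_component_form_mult:
  assumes "u \<in> forms n k" "p \<in> polys n"
  shows "homogeneous_component (k + e) (u * p) = u * homogeneous_component e p"
proof -
  obtain D where D: "e < D" "p = (\<Sum>d<D. homogeneous_component d p)"
    using homogeneous_expansion by blast
  have f: "u * homogeneous_component d p \<in> forms n (k + d)" for d
    by (rule forms_mult[OF assms(1) homogeneous_component_in_forms[OF assms(2)]])
  have "homogeneous_component (k + e) (u * p) =
      (\<Sum>d<D. homogeneous_component (k + e) (u * homogeneous_component d p))"
    by (subst D(2)) (simp add: sum_distrib_left homogeneous_component_sum)
  also have "\<dots> = (\<Sum>d<D. if e = d then u * homogeneous_component d p else 0)"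
    by (intro sum.cong refl) (auto simp: homogeneous_component_form[OF f])
  also have "\<dots> = u * homogeneous_component e p"
    using D(1) by (subst sum.delta') auto
  finally show ?thesis .
qed

section \<open>Graded quotients\<close>

text \<open>Coefficients and vectors are functions on all of \<open>nat\<close>, of which only the
  values below \<open>m\<close> matter; they can be updated at \<open>m\<close> without changing the
  shorter combination.\<close>

definition comb :: "nat \<Rightarrow> (nat \<Rightarrow> 'k::field) \<Rightarrow> (nat \<Rightarrow> 'k mpoly) \<Rightarrow> 'k mpoly" where
  "comb m c v = (\<Sum>i<m. const_poly (c i) * v i)"

lemma comb_0 [simp]: "comb 0 c v = 0"
  and comb_Suc [simp]: "comb (Suc m) c v = comb m c v + const_poly (c m) * v m"
  by (simp_all add: comb_def)

lemma comb_cong: "(\<And>i. i < m \<Longrightarrow> c i = d i) \<Longrightarrow> (\<And>i. i < m \<Longrightarrow> v i = w i) \<Longrightarrow> comb m c v = comb m d w"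
  by (simp add: comb_def)

lemma comb_add: "comb m (\<lambda>i. c i + d i) v = comb m c v + comb m d v"
  by (simp add: comb_def const_poly_add algebra_simps sum.distrib)

lemma comb_diff: "comb m (\<lambda>i. c i - d i) v = comb m c v - comb m d v"
  by (simp add: comb_def const_poly_diff algebra_simps sum_subtractf)

lemma comb_scale: "comb m (\<lambda>i. a * c i) v = const_poly a * comb m c v"
  by (simp add: comb_def const_poly_mult sum_distrib_left algebra_simps)

lemma comb_zero [simp]: "comb m (\<lambda>_. 0) v = 0"
  by (simp add: comb_def)

lemma comb_delta: "j < m \<Longrightarrow> comb m (\<lambda>i. if i = j then a else 0) v = const_poly a * v j"
  by (simp add: comb_def if_distrib[of const_poly] if_distrib[of "\<lambda>x. x * _"] cong: if_cong)

lemma comb_mult: "p * comb m c v = comb m c (\<lambda>i. p * v i)"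
  by (simp add: comb_def sum_distrib_left algebra_simps)

lemma comb_in_subspace: "mp.subspace J \<Longrightarrow> (\<And>i. i < m \<Longrightarrow> v i \<in> J) \<Longrightarrow> comb m c v \<in> J"
  unfolding comb_def by (intro mp.subspace_sum mp.subspace_scale) auto

locale graded_quotient =
  fixes n :: nat and I :: "'k::field mpoly set"
  assumes homogeneous: "homogeneous_ideal n I"
begin

abbreviation "A \<equiv> quotient_algebra n I"
abbreviation "residue \<equiv> residue_class n I"

lemma ideal: "ideal I (poly_ring n)"
  using homogeneous by (simp add: homogeneous_ideal_def)

sublocale ideal I "poly_ring n"
  by (rule ideal)

sublocale A: cring A
  unfolding quotient_algebra_def by (rule quotient_is_cring[OF cring_poly_ring])

lemma I_mult: "p \<in> polys n \<Longrightarrow> q \<in> I \<Longrightarrow> p * q \<in> I" "p \<in> polys n \<Longrightarrow> q \<in> I \<Longrightarrow> q * p \<in> I"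
  using I_l_closed[of q p] by (simp_all add: poly_ring_def mult.commute)

lemma subspace_I: "mp.subspace I"
  unfolding mp.subspace_def
  using a_closed zero_closed additive_subgroup.a_closed[OF is_additive_subgroup]
    additive_subgroup.zero_closed[OF is_additive_subgroup]
  by (auto simp: poly_ring_def intro: I_mult)

lemmas I_zero [simp] = mp.subspace_0[OF subspace_I]
lemmas I_add = mp.subspace_add[OF subspace_I]
lemmas I_diff = mp.subspace_diff[OF subspace_I]
lemmas I_scale = mp.subspace_scale[OF subspace_I]
lemmas I_neg = mp.subspace_neg[OF subspace_I]

lemma scale_I_iff: "c \<noteq> 0 \<Longrightarrow> const_poly c * p \<in> I \<longleftrightarrow> p \<in> I"
  using I_scale[of p c] I_scale[of "const_poly c * p" "inverse c"]
  by (auto simp: const_poly_mult[symmetric] mult.assoc[symmetric])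

lemma homogeneous_component_I: "p \<in> I \<Longrightarrow> homogeneous_component d p \<in> I"
  using homogeneous by (simp add: homogeneous_ideal_def)

lemma residue_eq: "residue p = {a + p |a. a \<in> I}"
  by (auto simp: residue_class_def a_r_coset_def r_coset_def poly_ring_def)

lemma residue_eq_iff: "residue p = residue q \<longleftrightarrow> p - q \<in> I"
proof
  assume "residue p = residue q"
  moreover have "0 + p \<in> residue p"
    unfolding residue_eq using I_zero by blast
  ultimately obtain a where "a \<in> I" "p = a + q"
    unfolding residue_eq by auto
  then show "p - q \<in> I" by simp
next
  assume pq: "p - q \<in> I"
  have "a + p = (a + (p - q)) + q" "a + q = (a - (p - q)) + p" for a
    by simp_all
  then show "residue p = residue q"
    unfolding residue_eq using pq I_add I_diff by blast
qed

lemma carrier_A: "carrier A = residue ` polys n"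
  by (auto simp: quotient_algebra_def FactRing_def A_RCOSETS_def RCOSETS_def residue_class_def
      a_r_coset_def poly_ring_def)

lemma residue_in_carrier [simp]: "p \<in> polys n \<Longrightarrow> residue p \<in> carrier A"
  by (simp add: carrier_A)

lemma residue_add: "p \<in> polys n \<Longrightarrow> q \<in> polys n \<Longrightarrow> residue p \<oplus>\<^bsub>A\<^esub> residue q = residue (p + q)"
  using a_rcos_sum[of p q]
  by (simp add: quotient_algebra_def FactRing_def residue_class_def poly_ring_def)

lemma residue_mult: "p \<in> polys n \<Longrightarrow> q \<in> polys n \<Longrightarrow> residue p \<otimes>\<^bsub>A\<^esub> residue q = residue (p * q)"
  using rcoset_mult_add[of p q]
  by (simp add: quotient_algebra_def FactRing_def residue_class_def poly_ring_def)

lemma zero_A: "\<zero>\<^bsub>A\<^esub> = residue 0"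
  by (simp add: quotient_algebra_def FactRing_def residue_eq)

lemma residue_eq_zero_iff [simp]: "residue p = \<zero>\<^bsub>A\<^esub> \<longleftrightarrow> p \<in> I"
  by (simp add: zero_A residue_eq_iff)

lemma residue_in_graded_piece_iff: "residue p \<in> graded_piece n I i \<longleftrightarrow> (\<exists>q\<in>forms n i. p - q \<in> I)"
  by (auto simp: graded_piece_def image_iff residue_eq_iff)

text \<open>The component of degree \<open>i\<close> of p - q is \<open>p\<close> itself, and a
  homogeneous ideal contains the components of its elements.\<close>

lemma form_in_I_if_degree_neq:
  assumes "p \<in> forms n i" "q \<in> forms n j" "i \<noteq> j" "p - q \<in> I"
  shows "p \<in> I"
  using homogeneous_component_I[OF assms(4), of i] assms
  by (simp add: homogeneous_component_diff homogeneous_component_form)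

subsection \<open>Dimension\<close>

text \<open>Independence and span of residue classes are expressed on representatives, so that
  arguments take place among polynomials; \<open>dimensionI\<close> and \<open>dimensionE\<close>
  translate to the inductive \<open>A.dimension\<close>.\<close>

definition independent_mod :: "nat \<Rightarrow> (nat \<Rightarrow> 'k mpoly) \<Rightarrow> bool" where
  "independent_mod m v \<longleftrightarrow> (\<forall>c. comb m c v \<in> I \<longrightarrow> (\<forall>i<m. c i = 0))"

definition residue_span :: "nat \<Rightarrow> (nat \<Rightarrow> 'k mpoly) \<Rightarrow> 'k mpoly set set" where
  "residue_span m v = range (\<lambda>c. residue (comb m c v))"

lemma independent_modD: "independent_mod m v \<Longrightarrow> comb m c v \<in> I \<Longrightarrow> i < m \<Longrightarrow> c i = 0"
  by (auto simp: independent_mod_def)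

lemma comb_in_polys: "(\<And>i. i < m \<Longrightarrow> v i \<in> polys n) \<Longrightarrow> comb m c v \<in> polys n"
  by (rule comb_in_subspace[OF subspace_polys])

lemma residue_span_Suc:
  assumes "\<And>i. i < Suc m \<Longrightarrow> v i \<in> polys n"
  shows "residue_span (Suc m) v = A.line_extension (scalars n I) (residue (v m)) (residue_span m v)"
proof -
  have eq: "residue (const_poly k) \<otimes>\<^bsub>A\<^esub> residue (v m) \<oplus>\<^bsub>A\<^esub> residue (comb m c v)
      = residue (comb m c v + const_poly k * v m)" for c k
    using assms comb_in_polys[of m v c] by (simp add: residue_mult residue_add polys_closed add.commute)
  show ?thesis
  proof (intro equalityI subsetI)
    fix a assume "a \<in> residue_span (Suc m) v"
    then obtain c where "a = residue (comb (Suc m) c v)"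
      by (auto simp: residue_span_def)
    then show "a \<in> A.line_extension (scalars n I) (residue (v m)) (residue_span m v)"
      unfolding A.line_extension_mem_iff scalars_def residue_span_def using eq[of "c m" c] by force
  next
    fix a assume "a \<in> A.line_extension (scalars n I) (residue (v m)) (residue_span m v)"
    then obtain k c where "a = residue (comb m c v + const_poly k * v m)"
      unfolding A.line_extension_mem_iff scalars_def residue_span_def using eq by force
    also have "comb m c v + const_poly k * v m = comb (Suc m) (c(m := k)) v"
      using comb_cong[of m c "c(m := k)" v v] by simp
    finally show "a \<in> residue_span (Suc m) v"
      unfolding residue_span_def by blast
  qed
qed

text \<open>The right-hand side is the premise under which \<open>A.dimension\<close> grows by
  one.\<close>

lemma independent_mod_Suc_iff:
  "independent_mod (Suc m) v \<longleftrightarrow> independent_mod m v \<and> residue (v m) \<notin> residue_span m v"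
proof (intro iffI conjI)
  assume ind: "independent_mod (Suc m) v"
  show "independent_mod m v"
    unfolding independent_mod_def
  proof (intro allI impI)
    fix c i assume "comb m c v \<in> I" "i < m"
    then have "comb (Suc m) (c(m := 0)) v \<in> I"
      using comb_cong[of m c "c(m := 0)" v v] by simp
    from independent_modD[OF ind this, of i] show "c i = 0"
      using \<open>i < m\<close> by simp
  qed
  show "residue (v m) \<notin> residue_span m v"
  proof
    assume "residue (v m) \<in> residue_span m v"
    then obtain c where "v m - comb m c v \<in> I"
      by (auto simp: residue_span_def residue_eq_iff)
    then have "comb (Suc m) (c(m := -1)) v \<in> I"
      using I_neg comb_cong[of m c "c(m := -1)" v v] by (fastforce simp: const_poly_uminus)
    from independent_modD[OF ind this, of m] show False
      by simp
  qed
next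
  assume *: "independent_mod m v \<and> residue (v m) \<notin> residue_span m v"
  show "independent_mod (Suc m) v"
    unfolding independent_mod_def
  proof (intro allI impI)
    fix c i assume c: "comb (Suc m) c v \<in> I" and i: "i < Suc m"
    have cm: "c m = 0"
    proof (rule ccontr)
      assume nz: "c m \<noteq> 0"
      \<comment> \<open>Dividing the relation by its last coefficient solves it for
        \<open>v m\<close>.\<close>
      have "v m - comb m (\<lambda>i. - inverse (c m) * c i) v = const_poly (inverse (c m)) * comb (Suc m) c v"
        using nz unfolding comb_scale
        by (simp add: const_poly_uminus algebra_simps flip: mult.assoc const_poly_mult)
      then have "residue (v m) \<in> residue_span m v"
        using I_scale[OF c] unfolding residue_span_def residue_eq_iff image_iff
        by (metis UNIV_I residue_eq_iff)
      with * show False by blast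
    qed
    then show "c i = 0"
      using independent_modD[of m v c i] * c i by (cases "i = m") auto
  qed
qed

text \<open>This is the preimage of the span under the quotient map. Being a subspace of
  polynomials, it can serve as the target of the induction on forms.\<close>

lemma subspace_residue_span: "mp.subspace {p. \<exists>c. p - comb m c v \<in> I}"
proof (rule mp.subspaceI)
  show "0 \<in> {p. \<exists>c. p - comb m c v \<in> I}"
    by (auto intro!: exI[of _ "\<lambda>_. 0"])
next
  fix p q assume "p \<in> {p. \<exists>c. p - comb m c v \<in> I}" "q \<in> {p. \<exists>c. p - comb m c v \<in> I}"
  then obtain c d where "p - comb m c v \<in> I" "q - comb m d v \<in> I"
    by blast
  then have "p + q - comb m (\<lambda>i. c i + d i) v \<in> I"
    using I_add[of "p - comb m c v" "q - comb m d v"] by (simp add: comb_add algebra_simps)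
  then show "p + q \<in> {p. \<exists>c. p - comb m c v \<in> I}"
    by blast
next
  fix a p assume "p \<in> {p. \<exists>c. p - comb m c v \<in> I}"
  then obtain c where "p - comb m c v \<in> I"
    by blast
  then have "const_poly a * p - comb m (\<lambda>i. a * c i) v \<in> I"
    using I_scale[of "p - comb m c v" a] by (simp add: comb_scale right_diff_distrib)
  then show "const_poly a * p \<in> {p. \<exists>c. p - comb m c v \<in> I}"
    by blast
qed

lemma dimensionI:
  assumes "\<And>i. i < m \<Longrightarrow> v i \<in> polys n" "independent_mod m v"
  shows "A.dimension m (scalars n I) (residue_span m v)"
  using assms
proof (induction m)
  case 0
  then show ?case
    using A.dimension.zero_dim by (simp add: residue_span_def zero_A)
next
  case (Suc m)
  then show ?case
    using A.dimension.Suc_dim[of "residue (v m)" "residue_span m v" m "scalars n I"]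
    by (simp add: independent_mod_Suc_iff residue_span_Suc)
qed

lemma dimensionE:
  assumes "A.dimension m (scalars n I) E"
  shows "\<exists>v. (\<forall>i<m. v i \<in> polys n) \<and> independent_mod m v \<and> E = residue_span m v"
  using assms
proof (induction m "scalars n I" E rule: A.dimension.induct)
  case zero_dim
  then show ?case
    by (auto simp: independent_mod_def residue_span_def zero_A)
next
  case (Suc_dim a E m)
  then obtain v where v: "\<forall>i<m. v i \<in> polys n" "independent_mod m v" "E = residue_span m v"
    by blast
  obtain p where p: "p \<in> polys n" "a = residue p"
    using Suc_dim.hyps(1) by (auto simp: carrier_A)
  let ?v = "v(m := p)"
  have eq: "comb m c ?v = comb m c v" for c
    by (rule comb_cong) auto
  then have "residue_span m ?v = residue_span m v" "independent_mod m ?v = independent_mod m v"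
    by (simp_all add: residue_span_def independent_mod_def)
  moreover have "residue_span (Suc m) ?v = A.line_extension (scalars n I) a E"
    using v p residue_span_Suc[of m ?v] calculation by simp
  ultimately show ?case
    using v p Suc_dim.hyps(2)
    by (intro exI[of _ ?v]) (simp add: independent_mod_Suc_iff less_Suc_eq)
qed

lemma dimension_exists:
  assumes "\<And>i. i < m \<Longrightarrow> v i \<in> polys n"
  shows "\<exists>d. A.dimension d (scalars n I) (residue_span m v)"
  using assms
proof (induction m)
  case 0
  then show ?case
    using A.dimension.zero_dim by (auto simp: residue_span_def zero_A)
next
  case (Suc m)
  then obtain d where d: "A.dimension d (scalars n I) (residue_span m v)"
    by auto
  show ?case
  proof (cases "residue (v m) \<in> residue_span m v")
    case False
    then show ?thesis
      using A.dimension.Suc_dim[OF _ False d] Suc.prems by (auto simp: residue_span_Suc)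
  next
    case True
    then obtain c where c: "v m - comb m c v \<in> I"
      by (auto simp: residue_span_def residue_eq_iff)
    have "residue (comb (Suc m) e v) = residue (comb m (\<lambda>i. e i + e m * c i) v)" for e
      unfolding residue_eq_iff comb_add comb_scale
      using I_scale[OF c, of "e m"] by (simp add: algebra_simps)
    moreover have "residue (comb m e v) = residue (comb (Suc m) (e(m := 0)) v)" for e
      using comb_cong[of m e "e(m := 0)" v v] by simp
    ultimately have "residue_span (Suc m) v = residue_span m v"
      unfolding residue_span_def by blast
    with d show ?thesis by auto
  qed
qed

lemma graded_piece_dimension_exists:
  "\<exists>d. A.dimension d (scalars n I) (graded_piece n I i)"
proof -
  obtain B :: "'k mpoly set" where B: "finite B" "B \<subseteq> forms n i" "forms n i \<subseteq> mp.span B"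
    using forms_finitely_spanned[of n i] by metis
  obtain v m where v: "B = v ` {..<m::nat}" "inj_on v {..<m}"
    using finite_imp_nat_seg_image_inj_on[OF B(1)] by (auto simp: lessThan_def)
  have "mp.span B = range (\<lambda>c. comb m c v)"
  proof (intro equalityI subsetI)
    fix p assume "p \<in> mp.span B"
    then obtain u where "p = (\<Sum>b\<in>B. const_poly (u b) * b)"
      using mp.span_finite[OF B(1)] by auto
    then have "p = comb m (\<lambda>i. u (v i)) v"
      unfolding v(1) comb_def using v(2) by (simp add: sum.reindex)
    then show "p \<in> range (\<lambda>c. comb m c v)" by blast
  next
    fix p assume "p \<in> range (\<lambda>c. comb m c v)"
    then obtain c where "p = comb m c v" by blast
    moreover have "v i \<in> mp.span B" if "i < m" for i
      using that by (simp add: v(1) mp.span_base)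
    ultimately show "p \<in> mp.span B"
      using comb_in_subspace[OF mp.subspace_span] by blast
  qed
  moreover have "forms n i = mp.span B"
    using B(2,3) mp.span_minimal[OF B(2) subspace_forms] by blast
  ultimately have "graded_piece n I i = residue_span m v"
    by (auto simp: graded_piece_def residue_span_def)
  moreover have "v j \<in> polys n" if "j < m" for j
    using that B(2) v(1) forms_in_polys by auto
  ultimately show ?thesis
    using dimension_exists[of m v] by metis
qed

text \<open>The dimension predicate only provides arbitrary polynomials as representatives; each is
  congruent to a form of degree \<open>d\<close>, which replaces it.\<close>

lemma graded_basisE:
  assumes "has_dim n I r (graded_piece n I d)"
  obtains v where "\<And>i. i < r \<Longrightarrow> v i \<in> forms n d" "independent_mod r v"
    "\<And>p. p \<in> forms n d \<Longrightarrow> \<exists>c. p - comb r c v \<in> I"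
proof -
  obtain w where w: "\<forall>i<r. w i \<in> polys n" "independent_mod r w" "graded_piece n I d = residue_span r w"
    using dimensionE[OF assms[unfolded has_dim_def]] by metis
  have "\<exists>q. q \<in> forms n d \<and> w i - q \<in> I" if "i < r" for i
  proof -
    have "residue (w i) \<in> residue_span r w"
      using comb_delta[OF that, of 1 w]
      by (auto simp: residue_span_def intro!: range_eqI[of _ _ "\<lambda>j. if j = i then 1 else 0"])
    then show ?thesis
      using w(3) residue_in_graded_piece_iff[of "w i" d] by auto
  qed
  then obtain v where v: "\<And>i. i < r \<Longrightarrow> v i \<in> forms n d" "\<And>i. i < r \<Longrightarrow> w i - v i \<in> I"
    by metis
  have wv: "comb r c w - comb r c v \<in> I" for c
  proof -
    have "comb r c (\<lambda>i. w i - v i) \<in> I"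
      using v(2) by (intro comb_in_subspace[OF subspace_I])
    then show ?thesis
      by (simp add: comb_def algebra_simps sum_subtractf)
  qed
  have "comb r c w \<in> I" if "comb r c v \<in> I" for c
    using I_add[OF wv[of c] that] by simp
  then have "independent_mod r v"
    using w(2) unfolding independent_mod_def by simp
  moreover have "\<exists>c. p - comb r c v \<in> I" if "p \<in> forms n d" for p
  proof -
    obtain c where "p - comb r c w \<in> I"
    proof -
      have "residue p \<in> residue_span r w"
        unfolding w(3)[symmetric] graded_piece_def using \<open>p \<in> forms n d\<close> by (rule imageI)
      then show ?thesis
        using that by (auto simp: residue_span_def residue_eq_iff)
    qed
    then show ?thesis
      using I_add[OF _ wv[of c], of "p - comb r c w"] by (intro exI[of _ c]) simp
  qed
  ultimately show ?thesis
    using that v(1) by blast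
qed

lemmas codimensionE = graded_basisE[of _ 1, folded has_codimension_def]

lemma codimensionI:
  assumes "\<And>i. i < r \<Longrightarrow> v i \<in> forms n 1" "independent_mod r v"
    "\<And>p. p \<in> forms n 1 \<Longrightarrow> \<exists>c. p - comb r c v \<in> I"
  shows "has_codimension n I r"
proof -
  have "graded_piece n I 1 = residue_span r v"
    using assms(3) comb_in_subspace[OF subspace_forms assms(1)]
    unfolding graded_piece_def residue_span_def by (fastforce simp: residue_eq_iff image_iff)
  moreover have "A.dimension r (scalars n I) (residue_span r v)"
    by (rule dimensionI[OF forms_in_polys[OF assms(1)] assms(2)])
  ultimately show ?thesis
    unfolding has_codimension_def has_dim_def by metis
qed

section \<open>The socle, and criteria for the Weak Lefschetz Property\<close>

lemma I_mult_if_var_mult: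
  assumes "\<And>i. i < n \<Longrightarrow> var i * p \<in> I" "Poly_Mapping.lookup q 0 = 0" "q \<in> polys n" "p \<in> polys n"
  shows "q * p \<in> I"
proof -
  have "mp.subspace {q. q * p \<in> I}"
    unfolding mp.subspace_def by (simp add: distrib_right I_add mult.assoc I_scale)
  moreover have "monom_poly m \<in> {q. q * p \<in> I}" if m: "m \<in> Poly_Mapping.keys q" for m
  proof -
    have "m \<noteq> 0" using m assms(2) by (auto simp: in_keys_iff)
    then obtain d where "mono_degree m = Suc d"
      using mono_degree_eq_0_iff not0_implies_Suc by blast
    moreover have "Poly_Mapping.keys m \<subseteq> {..<n}"
      using m assms(3) by (auto simp: polys_def)
    ultimately obtain i m' where "i < n" "m = Poly_Mapping.single i 1 + m'"
      "Poly_Mapping.keys m' \<subseteq> {..<n}"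
      using monom_degree_Suc[of m d n] by metis
    then have "monom_poly m' \<in> polys n"
      using monom_poly_in_forms forms_in_polys by blast
    from I_mult(1)[OF this assms(1)[OF \<open>i < n\<close>]] show ?thesis
      by (simp add: \<open>m = _\<close> monom_poly_add mult_ac)
  qed
  ultimately show ?thesis
    using poly_in_subspace[of "{q. q * p \<in> I}" q] by blast
qed

text \<open>The variables generate the irrelevant ideal, so being killed by them is being killed by
  all of it.\<close>

lemma residue_in_socle_iff:
  assumes "p \<in> polys n"
  shows "residue p \<in> socle n I \<longleftrightarrow> (\<forall>i<n. var i * p \<in> I)"
proof
  assume *: "residue p \<in> socle n I"
  show "\<forall>i<n. var i * p \<in> I"
  proof (intro allI impI)
    fix i assume i: "i < n"
    have v: "(var i :: 'k mpoly) \<in> polys n"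
      using var_in_forms[OF i] by (rule forms_in_polys)
    have "Poly_Mapping.lookup (var i :: 'k mpoly) 0 = 0"
      by (auto simp: lookup_monom_poly dest: arg_cong[of _ _ mono_degree])
    then have "residue (var i) \<in> irrelevant_ideal n I"
      using v by (auto simp: irrelevant_ideal_def)
    then have "residue (var i) \<otimes>\<^bsub>A\<^esub> residue p = \<zero>\<^bsub>A\<^esub>"
      using * by (simp add: socle_def)
    then show "var i * p \<in> I"
      using v assms by (simp add: residue_mult)
  qed
next
  assume *: "\<forall>i<n. var i * p \<in> I"
  show "residue p \<in> socle n I"
    unfolding socle_def irrelevant_ideal_def
    using assms * I_mult_if_var_mult[of p] by (auto simp: residue_mult)
qed

lemma multiplication_has_maximal_rank_iff:
  assumes L: "L \<in> forms n 1"
  shows "multiplication_has_maximal_rank n I (residue L) i \<longleftrightarrow>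
    (\<forall>p\<in>forms n i. L * p \<in> I \<longrightarrow> p \<in> I) \<or>
    (\<forall>q\<in>forms n (Suc i). \<exists>p\<in>forms n i. q - L * p \<in> I)"
proof -
  have Lp: "L \<in> polys n" using L by (rule forms_in_polys)
  have mul: "residue L \<otimes>\<^bsub>A\<^esub> residue p = residue (L * p)" if "p \<in> forms n i" for p
    using that Lp forms_in_polys by (intro residue_mult)
  have "inj_on (\<lambda>a. residue L \<otimes>\<^bsub>A\<^esub> a) (graded_piece n I i) \<longleftrightarrow>
      (\<forall>p\<in>forms n i. \<forall>q\<in>forms n i. L * p - L * q \<in> I \<longrightarrow> p - q \<in> I)"
    by (simp add: inj_on_def graded_piece_def mul residue_eq_iff)
  also have "\<dots> \<longleftrightarrow> (\<forall>p\<in>forms n i. L * p \<in> I \<longrightarrow> p \<in> I)"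
  proof (intro iffI ballI impI)
    fix p assume "\<forall>p\<in>forms n i. \<forall>q\<in>forms n i. L * p - L * q \<in> I \<longrightarrow> p - q \<in> I"
      "p \<in> forms n i" "L * p \<in> I"
    then show "p \<in> I"
      using mp.subspace_0[OF subspace_forms, of n i] by (metis diff_zero mult_zero_right)
  next
    fix p q assume "\<forall>p\<in>forms n i. L * p \<in> I \<longrightarrow> p \<in> I"
      "p \<in> forms n i" "q \<in> forms n i" "L * p - L * q \<in> I"
    then show "p - q \<in> I"
      using mp.subspace_diff[OF subspace_forms, of p n i q] by (simp add: right_diff_distrib)
  qed
  finally have inj: "inj_on (\<lambda>a. residue L \<otimes>\<^bsub>A\<^esub> a) (graded_piece n I i) \<longleftrightarrow>
      (\<forall>p\<in>forms n i. L * p \<in> I \<longrightarrow> p \<in> I)" .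
  have img: "(\<lambda>a. residue L \<otimes>\<^bsub>A\<^esub> a) ` graded_piece n I i = (\<lambda>p. residue (L * p)) ` forms n i"
    by (simp add: graded_piece_def image_image mul)
  have "(\<lambda>p. residue (L * p)) ` forms n i \<subseteq> graded_piece n I (Suc i)"
    using forms_mult[OF L] by (auto simp: graded_piece_def)
  then have surj: "(\<lambda>a. residue L \<otimes>\<^bsub>A\<^esub> a) ` graded_piece n I i = graded_piece n I (Suc i) \<longleftrightarrow>
      (\<forall>q\<in>forms n (Suc i). \<exists>p\<in>forms n i. q - L * p \<in> I)"
    unfolding img set_eq_subset
    by (simp add: graded_piece_def image_subset_iff image_iff residue_eq_iff)
  show ?thesis
    unfolding multiplication_has_maximal_rank_def inj surj ..
qed

text \<open>A basic open set, the complement of the zeros of one polynomial function, suffices;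
  \<open>L0\<close> witnesses that it is non-empty.\<close>

lemma weak_lefschetzI:
  assumes "F \<in> polynomial_functions n I" "L0 \<in> forms n 1" "F (residue L0) \<noteq> 0"
    "\<And>L i. L \<in> forms n 1 \<Longrightarrow> F (residue L) \<noteq> 0 \<Longrightarrow>
      (\<forall>p\<in>forms n i. L * p \<in> I \<longrightarrow> p \<in> I) \<or>
      (\<forall>q\<in>forms n (Suc i). \<exists>p\<in>forms n i. q - L * p \<in> I)"
  shows "weak_lefschetz n I"
proof -
  define U where "U = {a \<in> graded_piece n I 1. \<exists>f\<in>{F}. f a \<noteq> 0}"
  have "zariski_open n I U"
    unfolding zariski_open_def U_def using assms(1) by blast
  moreover have "residue L0 \<in> U"
    unfolding U_def graded_piece_def using assms(2,3) by blast
  moreover have "multiplication_has_maximal_rank n I L i" if "L \<in> U" for L i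
    using that assms(4) unfolding U_def graded_piece_def
    by (auto simp: multiplication_has_maximal_rank_iff[unfolded One_nat_def])
  ultimately show ?thesis
    unfolding weak_lefschetz_def by (intro exI[of _ U]) auto
qed

text \<open>If one and the same degree fails for every \<open>L\<close>, any element of the open set
  is a contradiction, whatever the topology.\<close>

lemma not_weak_lefschetzI:
  assumes "\<And>L. L \<in> forms n 1 \<Longrightarrow>
      (\<exists>p\<in>forms n i. L * p \<in> I \<and> p \<notin> I) \<and> (\<exists>q\<in>forms n (Suc i). \<forall>p\<in>forms n i. q - L * p \<notin> I)"
  shows "\<not> weak_lefschetz n I"
proof
  assume "weak_lefschetz n I"
  then obtain U where U: "zariski_open n I U" "U \<noteq> {}"
    "\<forall>L\<in>U. \<forall>i. multiplication_has_maximal_rank n I L i"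
    unfolding weak_lefschetz_def by auto
  then obtain a where a: "a \<in> U" "a \<in> graded_piece n I 1"
    unfolding zariski_open_def by auto
  then obtain L where L: "L \<in> forms n 1" "a = residue L"
    by (auto simp: graded_piece_def)
  then have "multiplication_has_maximal_rank n I (residue L) i"
    using U(3) a(1) by auto
  then show False
    using assms[OF L(1)] unfolding multiplication_has_maximal_rank_iff[OF L(1)] by blast
qed

subsection \<open>Vanishing in high degree\<close>

lemma forms_Suc_in_I:
  assumes "forms n d \<subseteq> I"
  shows "forms n (Suc d) \<subseteq> I"
proof (rule forms_Suc_subset[OF subspace_I])
  fix i and q :: "'k mpoly"
  assume "i < n" "q \<in> forms n d"
  then show "var i * q \<in> I"
    using assms forms_in_polys[OF var_in_forms[of i n]] by (intro I_mult(1)) auto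
qed

lemma forms_in_I_mono:
  assumes "forms n d \<subseteq> I" "d \<le> e"
  shows "forms n e \<subseteq> I"
  using assms(2,1) by (induction rule: dec_induct) (auto intro: forms_Suc_in_I[THEN subsetD])

lemma graded_piece_zero_iff: "graded_piece n I i = {\<zero>\<^bsub>A\<^esub>} \<longleftrightarrow> forms n i \<subseteq> I"
proof -
  have "0 \<in> forms n i"
    by (rule mp.subspace_0[OF subspace_forms])
  then have "residue ` forms n i = {\<zero>\<^bsub>A\<^esub>} \<longleftrightarrow> (\<forall>p\<in>forms n i. residue p = \<zero>\<^bsub>A\<^esub>)"
    by blast
  then show ?thesis
    by (auto simp: graded_piece_def)
qed

lemma residue_ideal:
  assumes J: "mp.subspace J" "J \<subseteq> polys n" "\<And>p q. p \<in> polys n \<Longrightarrow> q \<in> J \<Longrightarrow> p * q \<in> J"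
  shows "Ideal.ideal (residue ` J) A"
proof (rule idealI)
  show "ring A"
    by (rule A.ring_axioms)
  show "subgroup (residue ` J) (add_monoid A)"
  proof (rule A.add.subgroupI)
    show "residue ` J \<subseteq> carrier A"
      using J(2) by (auto simp: carrier_A)
    show "residue ` J \<noteq> {}"
      using mp.subspace_0[OF J(1)] by blast
  next
    fix a assume "a \<in> residue ` J"
    then obtain p where p: "p \<in> J" "a = residue p" by blast
    have "residue (- p) \<oplus>\<^bsub>A\<^esub> residue p = \<zero>\<^bsub>A\<^esub>"
      using p J(2) by (subst residue_add) (auto simp: zero_A)
    then have "\<ominus>\<^bsub>A\<^esub> residue p = residue (- p)"
      using p J(2) by (intro A.minus_equality) auto
    then show "\<ominus>\<^bsub>A\<^esub> a \<in> residue ` J"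
      using mp.subspace_neg[OF J(1) p(1)] p(2) by simp
  next
    fix a b assume "a \<in> residue ` J" "b \<in> residue ` J"
    then obtain p q where "p \<in> J" "q \<in> J" "a = residue p" "b = residue q" by blast
    then show "a \<oplus>\<^bsub>A\<^esub> b \<in> residue ` J"
      using J(2) mp.subspace_add[OF J(1), of p q] by (subst \<open>a = _\<close>, subst \<open>b = _\<close>, subst residue_add) auto
  qed
next
  fix a x assume "a \<in> residue ` J" "x \<in> carrier A"
  then obtain p q where pq: "p \<in> J" "q \<in> polys n" "a = residue p" "x = residue q"
    by (auto simp: carrier_A)
  have "x \<otimes>\<^bsub>A\<^esub> a = residue (q * p)" "a \<otimes>\<^bsub>A\<^esub> x = residue (q * p)"
    using pq J(2) by (auto simp: residue_mult mult.commute)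
  then show "x \<otimes>\<^bsub>A\<^esub> a \<in> residue ` J" "a \<otimes>\<^bsub>A\<^esub> x \<in> residue ` J"
    using J(3)[OF pq(2,1)] by auto
qed

text \<open>The images of the ideals of polynomials of order at least \<open>d\<close> form a
  descending chain. Where it is stationary, a form of degree \<open>d\<close> is congruent to a
  polynomial of larger order, and the component of degree \<open>d\<close> of the difference is the
  form itself.\<close>

lemma artinian_imp_vanishing:
  assumes "artinian_ring A"
  shows "\<exists>d. forms n d \<subseteq> I"
proof -
  define J :: "nat \<Rightarrow> 'k mpoly set"
    where "J d = {p \<in> polys n. \<forall>m\<in>Poly_Mapping.keys p. d \<le> mono_degree m}" for d
  have sub: "mp.subspace (J d)" for d
  proof -
    have "p + q \<in> J d" if "p \<in> J d" "q \<in> J d" for p q :: "'k mpoly"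
      using that Poly_Mapping.keys_add[of p q] unfolding J_def by (auto simp: polys_closed)
    moreover have "const_poly c * p \<in> J d" if "p \<in> J d" for p :: "'k mpoly" and c
      using that keys_const_poly_mult[of c p] unfolding J_def by (auto simp: polys_closed)
    moreover have "0 \<in> J d"
      by (simp add: J_def)
    ultimately show ?thesis
      by (intro mp.subspaceI)
  qed
  have mult: "p * q \<in> J d" if "p \<in> polys n" "q \<in> J d" for p q :: "'k mpoly" and d
  proof -
    have "d \<le> mono_degree m" if "m \<in> Poly_Mapping.keys (p * q)" for m
      using that \<open>q \<in> J d\<close> Poly_Mapping.keys_mult[of p q] mono_degree_add unfolding J_def
      by (fastforce intro: trans_le_add2)
    then show ?thesis
      using that by (simp add: J_def polys_closed)
  qed
  have "Ideal.ideal (residue ` J d) A" for d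
    using sub mult by (intro residue_ideal) (auto simp: J_def)
  moreover have "residue ` J (Suc d) \<subseteq> residue ` J d" for d
    by (intro image_mono) (auto simp: J_def dest: Suc_leD)
  ultimately obtain d where d: "\<forall>i\<ge>d. residue ` J i = residue ` J d"
    using assms unfolding artinian_ring_def by meson
  have "p \<in> I" if p: "p \<in> forms n d" for p
  proof -
    have "p \<in> J d"
      using p by (auto simp: forms_def J_def)
    moreover have "residue ` J (Suc d) = residue ` J d"
      by (rule d[rule_format]) simp
    ultimately have "residue p \<in> residue ` J (Suc d)"
      by simp
    then obtain q where q: "q \<in> J (Suc d)" "p - q \<in> I"
      unfolding image_iff residue_eq_iff by blast
    have "homogeneous_component d q = 0"
      by (rule poly_mapping_eqI) (use q(1) in \<open>force simp: lookup_homogeneous_component J_def in_keys_iff\<close>)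
    then have "homogeneous_component d (p - q) = p"
      using p by (simp add: homogeneous_component_diff homogeneous_component_form)
    then show "p \<in> I"
      using homogeneous_component_I[OF q(2), of d] by simp
  qed
  then show ?thesis by blast
qed

lemma vanishing_above_socle_degree:
  assumes art: "artinian_ring A" and e: "socle_degree n I \<le> e" "e < d"
  shows "forms n d \<subseteq> I"
proof -
  obtain m where m: "forms n m \<subseteq> I"
    using artinian_imp_vanishing[OF art] by blast
  show "forms n d \<subseteq> I"
  proof (rule ccontr)
    assume *: "\<not> forms n d \<subseteq> I"
    \<comment> \<open>\<open>GREATEST\<close> is meaningful only for a bounded predicate;
      artinianness provides the bound.\<close>
    have "\<And>i. \<not> forms n i \<subseteq> I \<Longrightarrow> i \<le> m"
      using forms_in_I_mono[OF m] nat_le_linear by blast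
    then have "d \<le> socle_degree n I"
      unfolding socle_degree_def graded_piece_zero_iff
      by (intro Greatest_le_nat[where P = "\<lambda>i. \<not> forms n i \<subseteq> I"]) (use * in auto)
    with e show False by simp
  qed
qed

lemma socle_degree_eqI:
  assumes "\<not> forms n d \<subseteq> I" "forms n (Suc d) \<subseteq> I"
  shows "socle_degree n I = d"
  unfolding socle_degree_def graded_piece_zero_iff
proof (rule Greatest_equality[where P = "\<lambda>i. \<not> forms n i \<subseteq> I"])
  show "\<not> forms n d \<subseteq> I" by (rule assms(1))
next
  fix i assume "\<not> forms n i \<subseteq> I"
  then show "i \<le> d"
    using forms_in_I_mono[OF assms(2), of i] by force
qed

text \<open>Such a form represents a socle element, which by levelness also has a representative in
  the socle degree; two different degrees meet only in 0.\<close>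

lemma level_nondegenerate:
  assumes "level_of_type n I t" "socle_degree n I \<noteq> d" "p \<in> forms n d" "\<And>i. i < n \<Longrightarrow> var i * p \<in> I"
  shows "p \<in> I"
proof -
  have "residue p \<in> socle n I"
    using assms(3,4) by (subst residue_in_socle_iff) (auto intro: forms_in_polys)
  then have "residue p \<in> graded_piece n I (socle_degree n I)"
    using assms(1) by (auto simp: level_of_type_def)
  then obtain q where "q \<in> forms n (socle_degree n I)" "p - q \<in> I"
    by (auto simp: residue_in_graded_piece_iff)
  then show ?thesis
    using form_in_I_if_degree_neq[OF assms(3)] assms(2) by blast
qed

text \<open>The components of a socle element are again socle elements, so non-degeneracy degree by
  degree makes the socle equal to the top graded piece. The type is the dimension of that
  piece.\<close>

lemma levelI:
  assumes top: "\<not> forms n d \<subseteq> I" "forms n (Suc d) \<subseteq> I"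
    and nondeg: "\<And>p e. e < d \<Longrightarrow> p \<in> forms n e \<Longrightarrow> (\<And>i. i < n \<Longrightarrow> var i * p \<in> I) \<Longrightarrow> p \<in> I"
  shows "\<exists>t. level_of_type n I t"
proof -
  have sd: "socle_degree n I = d"
    by (rule socle_degree_eqI[OF top])
  have "socle n I = graded_piece n I d"
  proof (intro equalityI subsetI)
    fix a assume a: "a \<in> graded_piece n I d"
    then obtain p where p: "p \<in> forms n d" "a = residue p"
      by (auto simp: graded_piece_def)
    have "var i * p \<in> I" if "i < n" for i
      using top(2) forms_mult[OF var_in_forms[OF that] p(1)] by auto
    then show "a \<in> socle n I"
      using p by (subst p(2), subst residue_in_socle_iff) (auto intro: forms_in_polys)
  next
    fix a assume a: "a \<in> socle n I"
    then obtain p where p: "p \<in> polys n" "a = residue p"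
      by (auto simp: socle_def carrier_A)
    then have vp: "var i * p \<in> I" if "i < n" for i
      using a that by (simp add: residue_in_socle_iff)
    have hc: "homogeneous_component e p \<in> I" if "e \<noteq> d" for e
    proof (cases "e < d")
      case True
      have "var i * homogeneous_component e p \<in> I" if "i < n" for i
        using homogeneous_component_form_mult[OF var_in_forms[OF that] p(1), of e]
          homogeneous_component_I[OF vp[OF that], of "1 + e"] by simp
      then show ?thesis
        using nondeg[OF True homogeneous_component_in_forms[OF p(1)]] by blast
    next
      case False
      then show ?thesis
        using that forms_in_I_mono[OF top(2), of e] homogeneous_component_in_forms[OF p(1), of e] by auto
    qed
    have "p - homogeneous_component d p \<in> I"
    proof -
      let ?q = "p - homogeneous_component d p"
      obtain D where D: "?q = (\<Sum>e<D. homogeneous_component e ?q)"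
        using homogeneous_expansion by blast
      have "homogeneous_component e ?q \<in> I" for e
        using hc[of e] homogeneous_component_form[OF homogeneous_component_in_forms[OF p(1)], of e d]
        by (cases "e = d") (simp_all add: homogeneous_component_diff)
      then show ?thesis
        by (subst D) (intro mp.subspace_sum[OF subspace_I])
    qed
    then show "a \<in> graded_piece n I d"
      using homogeneous_component_in_forms[OF p(1)] p(2) by (auto simp: residue_in_graded_piece_iff)
  qed
  then show ?thesis
    using graded_piece_dimension_exists sd unfolding level_of_type_def has_dim_def by simp
qed

subsection \<open>Linear functionals\<close>

text \<open>Linear forms on the quotient, represented on all polynomials; vanishing on
  \<open>I\<close> makes them depend on the residue class only.\<close>

definition functional :: "('k mpoly \<Rightarrow> 'k) \<Rightarrow> bool" where
  "functional \<phi> \<longleftrightarrow> (\<forall>p q. \<phi> (p + q) = \<phi> p + \<phi> q) \<and> (\<forall>c p. \<phi> (const_poly c * p) = c * \<phi> p) \<and>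
     (\<forall>p\<in>I. \<phi> p = 0)"

lemma functional_add: "functional \<phi> \<Longrightarrow> \<phi> (p + q) = \<phi> p + \<phi> q"
  and functional_scale: "functional \<phi> \<Longrightarrow> \<phi> (const_poly c * p) = c * \<phi> p"
  and functional_I: "functional \<phi> \<Longrightarrow> p \<in> I \<Longrightarrow> \<phi> p = 0"
  by (simp_all add: functional_def)

lemma functional_cong: "functional \<phi> \<Longrightarrow> p - q \<in> I \<Longrightarrow> \<phi> p = \<phi> q"
  using functional_add[of \<phi> "p - q" q] functional_I[of \<phi> "p - q"] by simp

lemma functional_zero: "functional \<phi> \<Longrightarrow> \<phi> 0 = 0"
  by (simp add: functional_I)

lemma functional_comb: "functional \<phi> \<Longrightarrow> \<phi> (comb m c v) = (\<Sum>i<m. c i * \<phi> (v i))"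
  by (induction m) (simp_all add: functional_zero functional_add functional_scale)

lemma functional_mult:
  assumes "functional \<phi>" "u \<in> polys n"
  shows "functional (\<lambda>p. \<phi> (p * u))"
  using assms unfolding functional_def
  by (auto simp: distrib_right mult.assoc I_mult)

text \<open>\<open>S\<close> is the preimage of the span of the other vectors. Independence keeps
  \<open>v j\<close> outside \<open>S\<close>, so the functional that is 0 on a basis of
  \<open>S\<close> and 1 at \<open>v j\<close> is well defined and extends.\<close>

lemma dual_functional_exists:
  assumes ind: "independent_mod m v" and j: "j < m"
  shows "\<exists>\<phi>. functional \<phi> \<and> (\<forall>i<m. \<phi> (v i) = (if i = j then 1 else 0))"
proof -
  interpret mpk: vector_space_pair "\<lambda>c (p :: 'k mpoly). const_poly c * p" "(*) :: 'k \<Rightarrow> 'k \<Rightarrow> 'k"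
    by unfold_locales (simp_all add: algebra_simps)
  define S where "S = {q. \<exists>c. c j = 0 \<and> q - comb m c v \<in> I}"
  have S: "mp.subspace S"
  proof (rule mp.subspaceI)
    show "0 \<in> S"
      unfolding S_def by (auto intro!: exI[of _ "\<lambda>_. 0"])
  next
    fix p q assume "p \<in> S" "q \<in> S"
    then obtain c d where "c j = 0" "d j = 0" "p - comb m c v \<in> I" "q - comb m d v \<in> I"
      unfolding S_def by blast
    then show "p + q \<in> S"
      unfolding S_def using I_add[of "p - comb m c v" "q - comb m d v"]
      by (auto intro!: exI[of _ "\<lambda>i. c i + d i"] simp: comb_add algebra_simps)
  next
    fix a p assume "p \<in> S"
    then obtain c where "c j = 0" "p - comb m c v \<in> I"
      unfolding S_def by blast
    then show "const_poly a * p \<in> S"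
      unfolding S_def using I_scale[of "p - comb m c v" a]
      by (auto intro!: exI[of _ "\<lambda>i. a * c i"] simp: comb_scale right_diff_distrib)
  qed
  obtain B where B: "B \<subseteq> S" "mp.independent B" "S \<subseteq> mp.span B"
    using mp.maximal_independent_subset[of S] by blast
  have "v j \<notin> S"
  proof
    assume "v j \<in> S"
    then obtain c where c: "c j = 0" "v j - comb m c v \<in> I"
      unfolding S_def by blast
    have "comb m (\<lambda>i. (if i = j then 1 else 0) - c i) v \<in> I"
      using c(2) by (simp add: comb_diff comb_delta[OF j, of 1])
    from independent_modD[OF ind this j] show False
      using c(1) by simp
  qed
  moreover have "mp.span B = S"
    using B mp.span_minimal[OF B(1) S] by blast
  ultimately have "mp.independent (insert (v j) B)"
    using mp.independent_insertI[OF _ B(2)] by auto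
  from mpk.linear_independent_extend[OF this, of "\<lambda>b. if b = v j then 1 else 0"]
  obtain g where g: "Vector_Spaces.linear (\<lambda>c p. const_poly c * p) (*) g"
    "\<forall>x\<in>insert (v j) B. g x = (if x = v j then 1 else 0)"
    by blast
  interpret g: Vector_Spaces.linear "\<lambda>c p. const_poly c * p" "(*)" g
    by (rule g(1))
  have gS: "g p = 0" if "p \<in> S" for p
  proof (rule mpk.linear_eq_0_on_span[OF g(1), of B])
    show "p \<in> mp.span B"
      using that B(3) by blast
    show "g b = 0" if "b \<in> B" for b
      using g(2) that B(1) \<open>v j \<notin> S\<close> by auto
  qed
  have "p \<in> S" if "p \<in> I" for p
    unfolding S_def using that by (auto intro!: exI[of _ "\<lambda>_. 0"])
  moreover have "v i \<in> S" if "i < m" "i \<noteq> j" for i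
    unfolding S_def using that comb_delta[OF that(1), of 1 v]
    by (auto intro!: exI[of _ "\<lambda>l. if l = i then 1 else 0"])
  ultimately have "functional g" "\<forall>i<m. g (v i) = (if i = j then 1 else 0)"
    using gS g(2) unfolding functional_def by (auto simp: g.add g.scale)
  then show ?thesis by blast
qed

lemma dual_functionals:
  assumes "independent_mod m v"
  obtains \<phi> where "\<And>j. j < m \<Longrightarrow> functional (\<phi> j)"
    "\<And>i j. i < m \<Longrightarrow> j < m \<Longrightarrow> \<phi> j (v i) = (if i = j then 1 else 0)"
  using dual_functional_exists[OF assms] by metis

lemma dual_expansion:
  assumes \<phi>: "\<And>j. j < m \<Longrightarrow> functional (\<phi> j)"
    "\<And>i j. i < m \<Longrightarrow> j < m \<Longrightarrow> \<phi> j (v i) = (if i = j then 1 else 0)"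
    and span: "\<exists>c. p - comb m c v \<in> I"
  shows "p - comb m (\<lambda>j. \<phi> j p) v \<in> I"
proof -
  obtain c where c: "p - comb m c v \<in> I"
    using span by blast
  have "\<phi> j p = c j" if "j < m" for j
  proof -
    have "\<phi> j p = (\<Sum>i<m. c i * (if i = j then 1 else 0))"
      using functional_cong[OF \<phi>(1)[OF that] c] \<phi>(2)[OF _ that]
      unfolding functional_comb[OF \<phi>(1)[OF that]] by simp
    then show ?thesis
      using that by (simp add: if_distrib cong: if_cong)
  qed
  then have "comb m (\<lambda>j. \<phi> j p) v = comb m c v"
    by (intro comb_cong) auto
  with c show ?thesis by simp
qed

text \<open>Polynomial functions take cosets as arguments, whereas a \<open>functional\<close> takes
  polynomials. The choice of representative does not affect its value, by
  \<open>functional_degree_one_rep\<close>.\<close>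

definition degree_one_rep :: "'k mpoly set \<Rightarrow> 'k mpoly" where
  "degree_one_rep a = (SOME p. p \<in> forms n 1 \<and> residue p = a)"

lemma degree_one_rep:
  assumes "p \<in> forms n 1"
  shows "degree_one_rep (residue p) - p \<in> I"
proof -
  have "degree_one_rep (residue p) \<in> forms n 1 \<and> residue (degree_one_rep (residue p)) = residue p"
    unfolding degree_one_rep_def by (rule someI[of _ p]) (use assms in simp)
  then show ?thesis
    by (simp add: residue_eq_iff)
qed

lemma functional_degree_one_rep:
  assumes "functional \<phi>" "p \<in> forms n 1"
  shows "\<phi> (degree_one_rep (residue p)) = \<phi> p"
  using functional_cong[OF assms(1) degree_one_rep[OF assms(2)]] .

lemma linear_functional_degree_one_rep:
  assumes "functional \<phi>"
  shows "linear_functional n I (\<lambda>a. \<phi> (degree_one_rep a))"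
  unfolding linear_functional_def graded_piece_def
proof (intro conjI ballI allI; elim imageE; hypsubst)
  fix p q :: "'k mpoly" assume p: "p \<in> forms n 1" and q: "q \<in> forms n 1"
  have "p + q \<in> forms n 1"
    using p q by (rule mp.subspace_add[OF subspace_forms])
  then show "\<phi> (degree_one_rep (residue p \<oplus>\<^bsub>A\<^esub> residue q))
      = \<phi> (degree_one_rep (residue p)) + \<phi> (degree_one_rep (residue q))"
    using p q forms_in_polys[OF p] forms_in_polys[OF q]
    by (simp add: residue_add functional_degree_one_rep[OF assms] functional_add[OF assms] del: One_nat_def)
next
  fix c and p :: "'k mpoly" assume p: "p \<in> forms n 1"
  have "const_poly c * p \<in> forms n 1"
    using p by (rule mp.subspace_scale[OF subspace_forms])
  then show "\<phi> (degree_one_rep (residue (const_poly c) \<otimes>\<^bsub>A\<^esub> residue p)) = c * \<phi> (degree_one_rep (residue p))"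
    using p forms_in_polys[OF p]
    by (simp add: residue_mult functional_degree_one_rep[OF assms] functional_scale[OF assms] del: One_nat_def)
qed

lemma polynomial_functions_functional:
  "functional \<phi> \<Longrightarrow> (\<lambda>a. \<phi> (degree_one_rep a)) \<in> polynomial_functions n I"
  by (rule polynomial_functions.linear[OF linear_functional_degree_one_rep])

lemma polynomial_functions_sum:
  "(\<And>i. i \<in> S \<Longrightarrow> f i \<in> polynomial_functions n I) \<Longrightarrow> (\<lambda>a. \<Sum>i\<in>S. f i a) \<in> polynomial_functions n I"
  by (induction S rule: infinite_finite_induct) (auto intro: polynomial_functions.intros)

lemma polynomial_functions_prod:
  "(\<And>i. i \<in> S \<Longrightarrow> f i \<in> polynomial_functions n I) \<Longrightarrow> (\<lambda>a. \<Prod>i\<in>S. f i a) \<in> polynomial_functions n I"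
  by (induction S rule: infinite_finite_induct) (auto intro: polynomial_functions.intros)

lemma polynomial_functions_power:
  "f \<in> polynomial_functions n I \<Longrightarrow> (\<lambda>a. f a ^ k) \<in> polynomial_functions n I"
  by (induction k) (auto intro: polynomial_functions.intros)

subsection \<open>Codimension at most two\<close>

text \<open>The variables are replaced by representatives of a basis of A_1: \<open>I\<close> may
  contain linear forms, so \<open>n\<close> can exceed the codimension.\<close>

lemma forms_Suc_subset_mod:
  assumes J: "mp.subspace J" "I \<subseteq> J"
    and v: "\<And>p. p \<in> forms n 1 \<Longrightarrow> \<exists>c. p - comb r c v \<in> I"
    and step: "\<And>k q. k < r \<Longrightarrow> q \<in> forms n d \<Longrightarrow> v k * q \<in> J"
  shows "forms n (Suc d) \<subseteq> J"
proof (rule forms_Suc_subset[OF J(1)])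
  fix i and q :: "'k mpoly"
  assume i: "i < n" and q: "q \<in> forms n d"
  obtain c where c: "var i - comb r c v \<in> I"
    using v[OF var_in_forms[OF i]] by blast
  have "(var i - comb r c v) * q \<in> J"
    using I_mult(2)[OF forms_in_polys[OF q] c] J(2) by blast
  moreover have "q * comb r c v \<in> J"
    unfolding comb_mult using step[OF _ q] by (intro comb_in_subspace[OF J(1)]) (simp add: mult.commute)
  ultimately have "(var i - comb r c v) * q + q * comb r c v \<in> J"
    by (rule mp.subspace_add[OF J(1)])
  then show "var i * q \<in> J"
    by (simp add: algebra_simps)
qed

text \<open>The preimage of L A_d under the quotient map. It contains \<open>I\<close>, so
  membership depends on the residue class alone, and surjectivity becomes an inclusion of subspaces
  of polynomials.\<close>

definition image_mod :: "'k mpoly \<Rightarrow> nat \<Rightarrow> 'k mpoly set" where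
  "image_mod L d = {q. \<exists>p\<in>forms n d. q - L * p \<in> I}"

lemma image_modI: "p \<in> forms n d \<Longrightarrow> q - L * p \<in> I \<Longrightarrow> q \<in> image_mod L d"
  by (auto simp: image_mod_def)

lemma image_mod_mult: "p \<in> forms n d \<Longrightarrow> L * p \<in> image_mod L d"
  by (rule image_modI) auto

lemma I_subset_image_mod: "I \<subseteq> image_mod L d"
  using image_modI[OF mp.subspace_0[OF subspace_forms]] by auto

lemma subspace_image_mod: "mp.subspace (image_mod L d)"
proof (rule mp.subspaceI)
  show "0 \<in> image_mod L d"
    using subsetD[OF I_subset_image_mod I_zero] .
next
  fix q q' assume "q \<in> image_mod L d" "q' \<in> image_mod L d"
  then obtain p p' where "p \<in> forms n d" "p' \<in> forms n d" "q - L * p \<in> I" "q' - L * p' \<in> I"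
    by (auto simp: image_mod_def)
  then show "q + q' \<in> image_mod L d"
    using I_add[of "q - L * p" "q' - L * p'"] mp.subspace_add[OF subspace_forms]
    by (intro image_modI[of "p + p'"]) (auto simp: algebra_simps)
next
  fix c q assume "q \<in> image_mod L d"
  then obtain p where p: "p \<in> forms n d" "q - L * p \<in> I"
    by (auto simp: image_mod_def)
  have "const_poly c * q - L * (const_poly c * p) = const_poly c * (q - L * p)"
    by (simp add: algebra_simps)
  then show "const_poly c * q \<in> image_mod L d"
    using p I_scale mp.subspace_scale[OF subspace_forms]
    by (intro image_modI[of "const_poly c * p"]) auto
qed

lemma surjective_iff: "(\<forall>q\<in>forms n (Suc d). \<exists>p\<in>forms n d. q - L * p \<in> I) \<longleftrightarrow> forms n (Suc d) \<subseteq> image_mod L d"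
  by (auto simp: image_mod_def)

lemma const_mult_in_image_mod_iff:
  "c \<noteq> 0 \<Longrightarrow> const_poly c * q \<in> image_mod L d \<longleftrightarrow> q \<in> image_mod L d"
  using mp.subspace_scale[OF subspace_image_mod, of q L d c]
    mp.subspace_scale[OF subspace_image_mod, of "const_poly c * q" L d "inverse c"]
  by (auto simp: const_poly_mult[symmetric] mult.assoc[symmetric])

lemma image_mod_cong:
  assumes "q - q' \<in> I"
  shows "q \<in> image_mod L d \<longleftrightarrow> q' \<in> image_mod L d"
proof -
  have qq: "q - q' \<in> image_mod L d"
    using assms I_subset_image_mod by blast
  show ?thesis
    using mp.subspace_add[OF subspace_image_mod _ qq, of q'] mp.subspace_diff[OF subspace_image_mod _ qq, of q]
    by auto
qed

text \<open>Every \<open>L\<close> with non-zero coordinate is a non-zero multiple of the generator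
  of A_1 modulo \<open>I\<close>, hence surjective in each degree.\<close>

lemma weak_lefschetz_codim_1:
  assumes "has_codimension n I 1"
  shows "weak_lefschetz n I"
proof -
  obtain v where v: "\<And>i. i < 1 \<Longrightarrow> v i \<in> forms n 1" "independent_mod 1 v"
    "\<And>p. p \<in> forms n 1 \<Longrightarrow> \<exists>c. p - comb 1 c v \<in> I"
    using codimensionE[OF assms] by metis
  obtain \<phi> where "\<And>j. j < 1 \<Longrightarrow> functional (\<phi> j)"
    "\<And>i j. i < 1 \<Longrightarrow> j < 1 \<Longrightarrow> \<phi> j (v i) = (if i = j then 1 else 0)"
    using dual_functionals[OF v(2)] by metis
  then have \<phi>: "functional (\<phi> 0)" "\<phi> 0 (v 0) = 1"
    by auto
  show ?thesis
  proof (rule weak_lefschetzI[of "\<lambda>a. \<phi> 0 (degree_one_rep a)" "v 0"])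
    show "(\<lambda>a. \<phi> 0 (degree_one_rep a)) \<in> polynomial_functions n I"
      by (rule polynomial_functions_functional[OF \<phi>(1)])
    show "v 0 \<in> forms n 1"
      by (rule v(1)) simp
    show "\<phi> 0 (degree_one_rep (residue (v 0))) \<noteq> 0"
      using v(1)[of 0] \<phi> by (simp add: functional_degree_one_rep)
  next
    fix L i assume L: "L \<in> forms n 1" "\<phi> 0 (degree_one_rep (residue L)) \<noteq> 0"
    obtain c where c: "L - comb 1 c v \<in> I"
      using v(3)[OF L(1)] by blast
    have "\<phi> 0 L = c 0"
      using functional_cong[OF \<phi>(1) c] \<phi>(2) by (simp add: functional_scale[OF \<phi>(1)])
    then have c0: "c 0 \<noteq> 0"
      using L by (simp add: functional_degree_one_rep[OF \<phi>(1)] del: One_nat_def)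
    have "forms n (Suc i) \<subseteq> image_mod L i"
    proof (rule forms_Suc_subset_mod[OF subspace_image_mod I_subset_image_mod v(3)])
      fix k and q :: "'k mpoly"
      assume "k < (1::nat)" and q: "q \<in> forms n i"
      then have "k = 0" by simp
      have "const_poly (c 0) * (v 0 * q) - L * q = - ((L - comb 1 c v) * q)"
        by (simp add: algebra_simps)
      also have "\<dots> \<in> I"
        by (intro I_neg I_mult(2) c forms_in_polys[OF q])
      finally have "const_poly (c 0) * (v 0 * q) \<in> image_mod L i"
        by (rule image_modI[OF q])
      then show "v k * q \<in> image_mod L i"
        using c0 by (simp add: const_mult_in_image_mod_iff \<open>k = 0\<close>)
    qed
    then show "(\<forall>p\<in>forms n i. L * p \<in> I \<longrightarrow> p \<in> I) \<or> (\<forall>q\<in>forms n (Suc i). \<exists>p\<in>forms n i. q - L * p \<in> I)"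
      by (simp add: surjective_iff)
  qed
qed

end

section \<open>Codimension two: binary forms and their first relation\<close>

lemma exists_nonroot:
  fixes c :: "nat \<Rightarrow> 'k::field_char_0"
  assumes "a < m" "c a \<noteq> 0"
  shows "\<exists>t. (\<Sum>i<m. c i * t ^ i) \<noteq> 0"
proof -
  define p where "p = (\<Sum>i<m. Polynomial.monom (c i) i)"
  have "coeff p a = c a"
    using assms(1) by (simp add: p_def coeff_sum)
  then have "p \<noteq> 0"
    using assms(2) by auto
  then have "finite {t. poly p t = 0}"
    by (rule poly_roots_finite)
  then obtain t where "poly p t \<noteq> 0"
    using ex_new_if_finite[OF infinite_UNIV_char_0] by auto
  then show ?thesis
    by (auto simp: p_def poly_sum poly_monom)
qed

context graded_quotient
begin

definition binary_monomial :: "'k mpoly \<Rightarrow> 'k mpoly \<Rightarrow> nat \<Rightarrow> nat \<Rightarrow> 'k mpoly" where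
  "binary_monomial x y d a = x ^ a * y ^ (d - a)"

text \<open>With the monomials indexed by the exponent of \<open>x\<close>, multiplication by
  \<open>x\<close> shifts the coefficients up by one, and multiplication by \<open>y\<close> leaves
  them in place and adds a zero at the top.\<close>

lemma mult_x_comb_binary_monomial:
  "x * comb (Suc d) c (binary_monomial x y d)
    = comb (Suc (Suc d)) (case_nat 0 c) (binary_monomial x y (Suc d))"
  unfolding comb_def sum.lessThan_Suc_shift[of _ "Suc d"] sum_distrib_left
  by (auto simp: binary_monomial_def algebra_simps intro!: sum.cong)

lemma mult_y_comb_binary_monomial:
  "y * comb (Suc d) c (binary_monomial x y d)
    = comb (Suc (Suc d)) (c(Suc d := 0)) (binary_monomial x y (Suc d))"
proof -
  have "y * comb (Suc d) c (binary_monomial x y d)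
      = comb (Suc d) (c(Suc d := 0)) (binary_monomial x y (Suc d))"
    unfolding comb_mult
    by (rule comb_def[THEN trans], rule trans[OF _ comb_def[symmetric]], rule sum.cong)
      (auto simp: binary_monomial_def Suc_diff_le less_Suc_eq_le algebra_simps)
  then show ?thesis by simp
qed

lemma binary_monomial_in_forms:
  "x \<in> forms n 1 \<Longrightarrow> y \<in> forms n 1 \<Longrightarrow> a \<le> d \<Longrightarrow> binary_monomial x y d a \<in> forms n d"
  using forms_mult[OF power_in_forms[of x n a] power_in_forms[of y n "d - a"]]
  by (simp add: binary_monomial_def)

lemma forms_binary:
  assumes v: "\<And>k. k < 2 \<Longrightarrow> v k \<in> forms n 1"
    and span: "\<And>p. p \<in> forms n 1 \<Longrightarrow> \<exists>c. p - comb 2 c v \<in> I" and p: "p \<in> forms n d"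
  shows "\<exists>c. p - comb (Suc d) c (binary_monomial (v 0) (v 1) d) \<in> I"
proof -
  have "forms n d \<subseteq> {p. \<exists>c. p - comb (Suc d) c (binary_monomial (v 0) (v 1) d) \<in> I}"
  proof (induction d)
    case 0
    show ?case
    proof
      fix p :: "'k mpoly" assume "p \<in> forms n 0"
      then have "p - comb (Suc 0) (\<lambda>_. Poly_Mapping.lookup p 0) (binary_monomial (v 0) (v 1) 0) = 0"
        using forms_0 by (simp add: binary_monomial_def)
      then show "p \<in> {p. \<exists>c. p - comb (Suc 0) c (binary_monomial (v 0) (v 1) 0) \<in> I}"
        using I_zero by (metis (mono_tags, lifting) mem_Collect_eq)
    qed
  next
    case (Suc d)
    let ?J = "{p. \<exists>c. p - comb (Suc (Suc d)) c (binary_monomial (v 0) (v 1) (Suc d)) \<in> I}"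
    show ?case
    proof (rule forms_Suc_subset_mod[where v = v and r = 2, OF subspace_residue_span])
      show "I \<subseteq> ?J"
        by (auto simp del: comb_Suc intro!: exI[of _ "\<lambda>_. 0"])
      show "\<And>p. p \<in> forms n 1 \<Longrightarrow> \<exists>c. p - comb 2 c v \<in> I"
        by (rule span)
      fix k and q :: "'k mpoly" assume k: "k < (2::nat)" and q: "q \<in> forms n d"
      obtain c where c: "q - comb (Suc d) c (binary_monomial (v 0) (v 1) d) \<in> I"
        using Suc q by blast
      have "\<exists>e. v k * comb (Suc d) c (binary_monomial (v 0) (v 1) d)
          = comb (Suc (Suc d)) e (binary_monomial (v 0) (v 1) (Suc d))"
      proof (cases "k = 0")
        case True
        then show ?thesis using mult_x_comb_binary_monomial by blast
      next
        case False
        with k have "k = 1" by simp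
        then show ?thesis using mult_y_comb_binary_monomial by blast
      qed
      then obtain e where e: "v k * comb (Suc d) c (binary_monomial (v 0) (v 1) d)
          = comb (Suc (Suc d)) e (binary_monomial (v 0) (v 1) (Suc d))" by blast
      have "v k * (q - comb (Suc d) c (binary_monomial (v 0) (v 1) d)) \<in> I"
        by (rule I_mult(1)[OF forms_in_polys[OF v[OF k]] c])
      then have "v k * q - comb (Suc (Suc d)) e (binary_monomial (v 0) (v 1) (Suc d)) \<in> I"
        by (simp only: right_diff_distrib e)
      then show "v k * q \<in> ?J"
        by blast
    qed
  qed
  with p show ?thesis by blast
qed

text \<open>Comparing coefficients in degree d + 1 gives \<alpha> e_(a-1) + \<beta> e_a = 0 with
  e_(d+1) = 0. Since \<alpha> \<noteq> 0, the e_a vanish one after the other from the top.\<close>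

lemma binary_injective:
  assumes ind: "independent_mod (Suc (Suc d)) (binary_monomial x y (Suc d))"
    and "\<alpha> \<noteq> 0" and p: "p - comb (Suc d) e (binary_monomial x y d) \<in> I"
    and Lp: "(const_poly \<alpha> * x + const_poly \<beta> * y) * comb (Suc d) e (binary_monomial x y d) \<in> I"
  shows "p \<in> I"
proof -
  define m where "m = Suc d"
  have "(const_poly \<alpha> * x + const_poly \<beta> * y) * comb (Suc d) e (binary_monomial x y d)
      = comb (Suc (Suc d)) (\<lambda>a. \<alpha> * case_nat 0 e a + \<beta> * (e(Suc d := 0)) a) (binary_monomial x y (Suc d))"
    unfolding comb_add comb_scale distrib_right mult.assoc
      mult_x_comb_binary_monomial mult_y_comb_binary_monomial ..
  with Lp have *: "\<alpha> * case_nat 0 e a + \<beta> * (e(Suc d := 0)) a = 0" if "a < Suc (Suc d)" for a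
    using independent_modD[OF ind _ that] by metis
  have "e (d - k) = 0" if "k \<le> d" for k
    using that
  proof (induction k)
    case 0
    then show ?case using *[of "Suc d"] \<open>\<alpha> \<noteq> 0\<close> by simp
  next
    case (Suc k)
    then have eq: "Suc (d - Suc k) = d - k" by simp
    have "\<alpha> * e (d - Suc k) + \<beta> * e (d - k) = 0"
    proof -
      have "d - Suc k \<noteq> d" using Suc.prems by simp
      then show ?thesis
        using *[of "d - k"] unfolding eq[symmetric] by simp
    qed
    then show ?case
      using Suc \<open>\<alpha> \<noteq> 0\<close> by simp
  qed
  then have "e a = 0" if "a < Suc d" for a
    using that by (metis diff_diff_cancel diff_le_self less_Suc_eq_le)
  then have "comb (Suc d) e (binary_monomial x y d) = 0"
    using comb_cong[of "Suc d" e "\<lambda>_. 0"] by (metis comb_zero)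
  with p show ?thesis by simp
qed

text \<open>Modulo \<open>L\<close> one has x = \<delta> y with \<delta> = -\<beta>/\<alpha>, so
  each monomial of degree d + 1 becomes a multiple of y^(d+1). The relation becomes its value at
  (\<delta>, 1) times y^(d+1). By \<open>nz\<close> this value is non-zero, that is,
  \<open>L\<close> does not divide the relation, and so y^(d+1) lies in the image.\<close>

lemma binary_surjective:
  assumes xy: "x \<in> forms n 1" "y \<in> forms n 1"
    and \<alpha>: "\<alpha> \<noteq> 0" and L: "L - (const_poly \<alpha> * x + const_poly \<beta> * y) \<in> I"
    and f: "comb (Suc (Suc d)) c (binary_monomial x y (Suc d)) \<in> I"
    and nz: "(\<Sum>a<Suc (Suc d). c a * (- (\<beta> / \<alpha>)) ^ a) \<noteq> 0"
    and a: "a \<le> Suc d"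
  shows "binary_monomial x y (Suc d) a \<in> image_mod L d"
proof -
  define \<delta> where "\<delta> = - (\<beta> / \<alpha>)"
  let ?T = "image_mod L d"
  have reduce: "binary_monomial x y (Suc d) a - const_poly (\<delta> ^ a) * y ^ Suc d \<in> ?T" if "a \<le> Suc d" for a
  proof (cases a)
    case 0
    then show ?thesis
      using subsetD[OF I_subset_image_mod I_zero] by (simp add: binary_monomial_def)
  next
    case (Suc b)
    \<comment> \<open>The cofactor in x^(b+1) - (\<delta> y)^(b+1) = (x - \<delta> y) (...), times
      the remaining power of \<open>y\<close>.\<close>
    define g where "g = (\<Sum>i<Suc b. x ^ i * (const_poly \<delta> * y) ^ (b - i)) * y ^ (d - b)"
    have "x ^ i * (const_poly \<delta> * y) ^ (b - i) \<in> forms n b" if "i < Suc b" for i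
      using that xy forms_mult[OF power_in_forms[of x n i] power_in_forms[of "const_poly \<delta> * y" n "b - i"]]
        mp.subspace_scale[OF subspace_forms, of y n 1 \<delta>] by simp
    then have "(\<Sum>i<Suc b. x ^ i * (const_poly \<delta> * y) ^ (b - i)) \<in> forms n b"
      by (intro mp.subspace_sum[OF subspace_forms]) auto
    from forms_mult[OF this power_in_forms[OF xy(2), of "d - b"]]
    have g: "g \<in> forms n d"
      using that Suc by (simp add: g_def)
    have "binary_monomial x y (Suc d) a - const_poly (\<delta> ^ a) * y ^ Suc d
        = (x ^ Suc b - (const_poly \<delta> * y) ^ Suc b) * y ^ (d - b)"
    proof -
      have "y ^ Suc d = y ^ Suc b * y ^ (d - b)"
        using that Suc by (simp add: power_add[symmetric])
      then show ?thesis
        using Suc by (simp only: binary_monomial_def const_poly_power power_mult_distrib diff_Suc_Suc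
            left_diff_distrib mult.assoc)
    qed
    also have "\<dots> = (x - const_poly \<delta> * y) * g"
      unfolding g_def diff_power_eq_sum by (simp only: mult.assoc)
    finally have eq: "binary_monomial x y (Suc d) a - const_poly (\<delta> ^ a) * y ^ Suc d = (x - const_poly \<delta> * y) * g" .
    have "const_poly \<alpha> * (x - const_poly \<delta> * y) = const_poly \<alpha> * x + const_poly \<beta> * y"
    proof -
      have "\<alpha> * \<delta> = - \<beta>"
        using \<alpha> by (simp add: \<delta>_def)
      then have "const_poly \<alpha> * const_poly \<delta> = - const_poly \<beta>"
        by (simp add: const_poly_mult[symmetric] const_poly_uminus)
      then show ?thesis
        by (simp add: right_diff_distrib mult.assoc[symmetric])
    qed
    then have "const_poly \<alpha> * ((x - const_poly \<delta> * y) * g) = (const_poly \<alpha> * x + const_poly \<beta> * y) * g"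
      by (simp only: mult.assoc[symmetric])
    then have "const_poly \<alpha> * ((x - const_poly \<delta> * y) * g) - L * g
        = - ((L - (const_poly \<alpha> * x + const_poly \<beta> * y)) * g)"
      by (simp only: left_diff_distrib minus_diff_eq)
    also have "\<dots> \<in> I"
      by (intro I_neg I_mult(2) L forms_in_polys[OF g])
    finally have "const_poly \<alpha> * ((x - const_poly \<delta> * y) * g) \<in> ?T"
      by (rule image_modI[OF g])
    then show ?thesis
      unfolding eq const_mult_in_image_mod_iff[OF \<alpha>] .
  qed
  have "comb (Suc (Suc d)) c (\<lambda>a. binary_monomial x y (Suc d) a - const_poly (\<delta> ^ a) * y ^ Suc d) \<in> ?T"
    using reduce by (intro comb_in_subspace[OF subspace_image_mod]) auto
  moreover have "comb (Suc (Suc d)) c (\<lambda>a. binary_monomial x y (Suc d) a - const_poly (\<delta> ^ a) * y ^ Suc d)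
      = comb (Suc (Suc d)) c (binary_monomial x y (Suc d))
        - const_poly (\<Sum>a<Suc (Suc d). c a * \<delta> ^ a) * y ^ Suc d"
  proof -
    have "const_poly (sum h S) = (\<Sum>a\<in>S. const_poly (h a))" for h :: "nat \<Rightarrow> 'k" and S
      by (induction S rule: infinite_finite_induct) (simp_all add: const_poly_add)
    then show ?thesis
      by (simp only: comb_def right_diff_distrib sum_subtractf sum_distrib_right const_poly_mult mult.assoc)
  qed
  ultimately have "comb (Suc (Suc d)) c (binary_monomial x y (Suc d))
        - const_poly (\<Sum>a<Suc (Suc d). c a * \<delta> ^ a) * y ^ Suc d \<in> ?T"
    by (simp only:)
  from mp.subspace_diff[OF subspace_image_mod subsetD[OF I_subset_image_mod f] this]
  have "const_poly (\<Sum>a<Suc (Suc d). c a * \<delta> ^ a) * y ^ Suc d \<in> ?T"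
    by (simp only: diff_diff_eq2 add_diff_cancel_left' add.commute)
  then have "y ^ Suc d \<in> ?T"
    by (rule iffD1[OF const_mult_in_image_mod_iff[OF nz[folded \<delta>_def]]])
  from mp.subspace_add[OF subspace_image_mod reduce[OF a] mp.subspace_scale[OF subspace_image_mod this]]
  have "binary_monomial x y (Suc d) a - const_poly (\<delta> ^ a) * y ^ Suc d + const_poly (\<delta> ^ a) * y ^ Suc d \<in> ?T" .
  then show ?thesis
    by (simp only: diff_add_cancel)
qed

text \<open>A_(d+2) is A_1 A_(d+1), and a preimage of \<open>q\<close> multiplied by
  \<open>v k\<close> is a preimage of v_k q.\<close>

lemma surjective_Suc:
  assumes L: "L \<in> forms n 1" and v: "\<And>k. k < r \<Longrightarrow> v k \<in> forms n 1"
    "\<And>p. p \<in> forms n 1 \<Longrightarrow> \<exists>c. p - comb r c v \<in> I"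
    and surj: "forms n (Suc d) \<subseteq> image_mod L d"
  shows "forms n (Suc (Suc d)) \<subseteq> image_mod L (Suc d)"
proof (rule forms_Suc_subset_mod[OF subspace_image_mod I_subset_image_mod v(2)])
  fix k and q :: "'k mpoly"
  assume k: "k < r" and q: "q \<in> forms n (Suc d)"
  obtain p where p: "p \<in> forms n d" "q - L * p \<in> I"
    using surj q by (auto simp: image_mod_def)
  have "v k * q - L * (v k * p) = v k * (q - L * p)"
    by (simp add: algebra_simps)
  also have "\<dots> \<in> I"
    by (rule I_mult(1)[OF forms_in_polys[OF v(1)[OF k]] p(2)])
  finally show "v k * q \<in> image_mod L (Suc d)"
    using forms_mult[OF v(1)[OF k] p(1)] by (intro image_modI) auto
qed

end

locale graded_quotient_char_0 = graded_quotient n I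
  for n :: nat and I :: "'k::field_char_0 mpoly set"
begin

lemma weak_lefschetz_codim_2:
  assumes codim: "has_codimension n I 2"
  shows "weak_lefschetz n I"
proof -
  obtain v where v: "\<And>i. i < 2 \<Longrightarrow> v i \<in> forms n 1" "independent_mod 2 v"
    "\<And>p. p \<in> forms n 1 \<Longrightarrow> \<exists>c. p - comb 2 c v \<in> I"
    using codimensionE[OF codim] by metis
  obtain \<phi> where dual: "\<And>j. j < 2 \<Longrightarrow> functional (\<phi> j)"
    "\<And>i j. i < 2 \<Longrightarrow> j < 2 \<Longrightarrow> \<phi> j (v i) = (if i = j then 1 else 0)"
    using dual_functionals[OF v(2)] by metis
  then have \<phi>: "functional (\<phi> 0)" "functional (\<phi> 1)"
    "\<phi> 0 (v 0) = 1" "\<phi> 0 (v 1) = 0" "\<phi> 1 (v 0) = 0" "\<phi> 1 (v 1) = 1"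
    by auto
  have v01: "v 0 \<in> forms n 1" "v 1 \<in> forms n 1"
    using v(1) by auto
  let ?M = "binary_monomial (v 0) (v 1)"
  define rel where "rel d \<longleftrightarrow> \<not> independent_mod (Suc d) (?M d)" for d
  have coord: "L - (const_poly (\<phi> 0 L) * v 0 + const_poly (\<phi> 1 L) * v 1) \<in> I" if L: "L \<in> forms n 1" for L
    using dual_expansion[OF dual v(3)[OF L]] by (simp add: numeral_2_eq_2)
  have inj: "p \<in> I" if h: "\<not> rel (Suc i)" "L \<in> forms n 1" "\<phi> 0 L \<noteq> 0" "p \<in> forms n i" "L * p \<in> I" for L p i
  proof -
    obtain e where e: "p - comb (Suc i) e (?M i) \<in> I"
      using forms_binary[OF v(1,3) h(4)] by blast
    let ?q = "comb (Suc i) e (?M i)" and ?L = "const_poly (\<phi> 0 L) * v 0 + const_poly (\<phi> 1 L) * v 1"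
    have q: "?q \<in> forms n i"
      by (rule comb_in_subspace[OF subspace_forms binary_monomial_in_forms[OF v01]]) simp
    have "?L * ?q = L * p - L * (p - ?q) - (L - ?L) * ?q"
      by (simp only: right_diff_distrib left_diff_distrib) simp
    also have "\<dots> \<in> I"
      by (intro I_diff h(5) I_mult(1)[OF forms_in_polys[OF h(2)] e]
          I_mult(2)[OF forms_in_polys[OF q] coord[OF h(2)]])
    finally show ?thesis
      using binary_injective[OF _ h(3) e] h(1) unfolding rel_def by blast
  qed
  show ?thesis
  proof (cases "\<exists>d. rel d")
    case False
    show ?thesis
    proof (rule weak_lefschetzI[of "\<lambda>a. \<phi> 0 (degree_one_rep a)" "v 0"])
      show "(\<lambda>a. \<phi> 0 (degree_one_rep a)) \<in> polynomial_functions n I"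
        by (rule polynomial_functions_functional[OF \<phi>(1)])
      show "v 0 \<in> forms n 1"
        by (rule v01)
      show "\<phi> 0 (degree_one_rep (residue (v 0))) \<noteq> 0"
        using \<phi> by (simp add: functional_degree_one_rep[OF \<phi>(1) v01(1)])
    next
      fix L i assume "L \<in> forms n 1" "\<phi> 0 (degree_one_rep (residue L)) \<noteq> 0"
      then show "(\<forall>p\<in>forms n i. L * p \<in> I \<longrightarrow> p \<in> I) \<or>
          (\<forall>q\<in>forms n (Suc i). \<exists>p\<in>forms n i. q - L * p \<in> I)"
        using inj[of i L] False functional_degree_one_rep[OF \<phi>(1)] by auto
    qed
  next
    case True
    \<comment> \<open>A relation in degree 0 would be a non-zero constant in \<open>I\<close>, and
      the whole algebra would vanish.\<close>
    have "\<not> rel 0"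
    proof
      assume "rel 0"
      then obtain a where a: "const_poly a \<in> I" "a \<noteq> 0"
        by (auto simp: rel_def independent_mod_def binary_monomial_def)
      have "forms n 0 \<subseteq> I"
        using forms_0 scale_I_iff[OF a(2), of 1] a(1) I_scale[of 1] by (metis mult.right_neutral subsetI)
      then have "v 0 \<in> I"
        using forms_in_I_mono[of 0 1] v01(1) by auto
      then show False
        using \<phi>(1,3) functional_I by fastforce
    qed
    \<comment> \<open>The least degree of a relation is d + 1; injectivity is claimed below degree
      \<open>d\<close>, surjectivity from \<open>d\<close> on.\<close>
    define d where "d = (LEAST d. rel d) - 1"
    have d: "(LEAST d. rel d) = Suc d"
      using \<open>\<not> rel 0\<close> LeastI_ex[OF True] unfolding d_def by (metis Suc_pred' gr0I)
    then have "rel (Suc d)" and least: "\<And>i. rel i \<Longrightarrow> Suc d \<le> i"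
      using LeastI_ex[OF True] Least_le[of rel] by metis+
    then obtain c a where c: "comb (Suc (Suc d)) c (?M (Suc d)) \<in> I" "a < Suc (Suc d)" "c a \<noteq> 0"
      unfolding rel_def independent_mod_def by blast
    let ?m = "Suc (Suc d)"
    \<comment> \<open>With \<alpha>, \<beta> the coordinates of the linear form, the sum is the
      relation evaluated at (-\<beta>, \<alpha>), a homogeneous expression free of division. The
      extra factor ensures \<alpha> \<noteq> 0.\<close>
    define F where "F a = \<phi> 0 (degree_one_rep a) *
      (\<Sum>i<?m. c i * ((- 1) * \<phi> 1 (degree_one_rep a)) ^ i * \<phi> 0 (degree_one_rep a) ^ (Suc d - i))" for a
    obtain t where t: "(\<Sum>i<?m. c i * t ^ i) \<noteq> 0"
      using exists_nonroot[of a ?m c] c(2,3) by blast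
    \<comment> \<open>Here \<alpha> = 1 and \<beta> = -t, so \<open>F\<close> takes the value of the
      dehomogenized relation at \<open>t\<close>.\<close>
    define L0 where "L0 = v 0 + const_poly (- t) * v 1"
    have L0: "L0 \<in> forms n 1"
      unfolding L0_def using v01
      by (intro mp.subspace_add[OF subspace_forms] mp.subspace_scale[OF subspace_forms])
    have \<phi>L0: "\<phi> 0 L0 = 1" "\<phi> 1 L0 = - t"
      unfolding L0_def functional_add[OF \<phi>(1)] functional_add[OF \<phi>(2)]
        functional_scale[OF \<phi>(1)] functional_scale[OF \<phi>(2)] using \<phi>(3-6) by simp_all
    have rep: "\<phi> 0 (degree_one_rep (residue L)) = \<phi> 0 L" "\<phi> 1 (degree_one_rep (residue L)) = \<phi> 1 L"
      if "L \<in> forms n 1" for L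
      using functional_degree_one_rep[OF \<phi>(1) that] functional_degree_one_rep[OF \<phi>(2) that] .
    show ?thesis
    proof (rule weak_lefschetzI[of F L0])
      show "F \<in> polynomial_functions n I"
        unfolding F_def
        by (intro polynomial_functions.mult polynomial_functions_sum polynomial_functions_power
            polynomial_functions.const polynomial_functions_functional \<phi>)
      show "L0 \<in> forms n 1" by (rule L0)
      show "F (residue L0) \<noteq> 0"
        unfolding F_def rep[OF L0] \<phi>L0 using t by (simp del: sum.lessThan_Suc)
    next
      fix L i assume L: "L \<in> forms n 1" and FL: "F (residue L) \<noteq> 0"
      let ?\<alpha> = "\<phi> 0 L" and ?\<beta> = "\<phi> 1 L"
      have \<alpha>: "?\<alpha> \<noteq> 0" and nz: "(\<Sum>i<?m. c i * (- ?\<beta>) ^ i * ?\<alpha> ^ (Suc d - i)) \<noteq> 0"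
        using FL unfolding F_def rep[OF L] by (auto simp del: sum.lessThan_Suc)
      have "(- ?\<beta>) ^ i * ?\<alpha> ^ (Suc d - i) = (- (?\<beta> / ?\<alpha>)) ^ i * ?\<alpha> ^ Suc d" if "i < ?m" for i
      proof -
        have "?\<alpha> ^ Suc d = ?\<alpha> ^ i * ?\<alpha> ^ (Suc d - i)"
          using that by (simp add: power_add[symmetric])
        moreover have "(- (?\<beta> / ?\<alpha>)) ^ i * ?\<alpha> ^ i = (- ?\<beta>) ^ i"
          using \<alpha> by (simp add: power_mult_distrib[symmetric])
        ultimately show ?thesis
          by (simp only: mult.assoc[symmetric])
      qed
      then have "(\<Sum>i<?m. c i * (- ?\<beta>) ^ i * ?\<alpha> ^ (Suc d - i))
          = (\<Sum>i<?m. c i * (- (?\<beta> / ?\<alpha>)) ^ i) * ?\<alpha> ^ Suc d"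
        unfolding sum_distrib_right by (intro sum.cong) (auto simp only: mult.assoc lessThan_iff)
      with nz have nz': "(\<Sum>i<?m. c i * (- (?\<beta> / ?\<alpha>)) ^ i) \<noteq> 0"
        by auto
      show "(\<forall>p\<in>forms n i. L * p \<in> I \<longrightarrow> p \<in> I) \<or>
          (\<forall>q\<in>forms n (Suc i). \<exists>p\<in>forms n i. q - L * p \<in> I)"
      proof (cases "i < d")
        case True
        then have "\<not> rel (Suc i)"
          using least[of "Suc i"] by auto
        then show ?thesis
          using inj[OF _ L \<alpha>] by blast
      next
        case False
        then have "d \<le> i" by simp
        then have "forms n (Suc i) \<subseteq> image_mod L i"
        proof (induction i rule: dec_induct)
          case base
          show ?case
          proof
            fix p :: "'k mpoly" assume "p \<in> forms n (Suc d)"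
            then obtain e where e: "p - comb ?m e (?M (Suc d)) \<in> I"
              using forms_binary[OF v(1,3)] by blast
            have "comb ?m e (?M (Suc d)) \<in> image_mod L d"
              using binary_surjective[OF v01 \<alpha> coord[OF L] c(1) nz']
              by (intro comb_in_subspace[OF subspace_image_mod]) auto
            then show "p \<in> image_mod L d"
              using image_mod_cong[OF e] by simp
          qed
        next
          case (step i)
          show ?case
            by (rule surjective_Suc[OF L v(1,3) step.IH])
        qed
        then show ?thesis
          by (simp add: surjective_iff)
      qed
    qed
  qed
qed

end

context graded_quotient
begin

subsection \<open>Maximal rank is an open condition\<close>

lemma polynomial_functions_det:
  assumes "\<And>i j. i < m \<Longrightarrow> j < m \<Longrightarrow> f i j \<in> polynomial_functions n I"
  shows "(\<lambda>a. Determinant.det (Matrix.mat m m (\<lambda>(i, j). f i j a))) \<in> polynomial_functions n I"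
proof -
  have "Determinant.det (Matrix.mat m m (\<lambda>(i, j). f i j a))
      = (\<Sum>p | p permutes {0..<m}. signof p * (\<Prod>i = 0..<m. f i (p i) a))" for a
    unfolding det_def'[OF mat_carrier]
    by (intro sum.cong arg_cong2[where f = "(*)"] prod.cong refl) (auto simp: permutes_in_image)
  moreover have "(\<lambda>a. \<Sum>p | p permutes {0..<m}. signof p * (\<Prod>i = 0..<m. f i (p i) a))
      \<in> polynomial_functions n I"
    by (intro polynomial_functions_sum polynomial_functions.mult polynomial_functions.const
        polynomial_functions_prod assms) (auto simp: permutes_in_image)
  ultimately show ?thesis by simp
qed

text \<open>The matrix with entries \<phi>_j (L q_i) is the identity at \<open>L0\<close>, and its
  determinant is a polynomial function of \<open>L\<close>. \<open>G\<close> is its inverse where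
  the determinant is non-zero: the first identity serves injectivity, the second
  surjectivity.\<close>

lemma multiplication_matrix:
  assumes L0: "L0 \<in> forms n 1" and q: "\<And>i. i < m \<Longrightarrow> q i \<in> forms n d"
    and ind: "independent_mod m (\<lambda>i. L0 * q i)"
  obtains F \<phi> where "F \<in> polynomial_functions n I" "F (residue L0) \<noteq> 0"
    "\<And>j. j < m \<Longrightarrow> functional (\<phi> j)"
    "\<And>i j. i < m \<Longrightarrow> j < m \<Longrightarrow> \<phi> j (L0 * q i) = (if i = j then 1 else 0)"
    "\<And>L. L \<in> forms n 1 \<Longrightarrow> F (residue L) \<noteq> 0 \<Longrightarrow> \<exists>G. \<forall>i<m. \<forall>k<m.
        (\<Sum>j<m. \<phi> j (L * q i) * G j k) = (if i = k then 1 else 0) \<and>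
        (\<Sum>j<m. G i j * \<phi> k (L * q j)) = (if i = k then 1 else 0)"
proof -
  obtain \<phi> where \<phi>: "\<And>j. j < m \<Longrightarrow> functional (\<phi> j)"
    "\<And>i j. i < m \<Longrightarrow> j < m \<Longrightarrow> \<phi> j (L0 * q i) = (if i = j then 1 else 0)"
    using dual_functionals[OF ind] by metis
  define M where "M L = Matrix.mat m m (\<lambda>(i, j). \<phi> j (L * q i))" for L
  define F where "F a = Determinant.det (M (degree_one_rep a))" for a
  have M: "M L \<in> carrier_mat m m" for L
    by (simp add: M_def)
  have fun_mult: "functional (\<lambda>p. \<phi> j (p * q i))" if "i < m" "j < m" for i j
    by (rule functional_mult[OF \<phi>(1)[OF that(2)] forms_in_polys[OF q[OF that(1)]]])
  have F_eq: "F (residue L) = Determinant.det (M L)" if "L \<in> forms n 1" for L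
  proof -
    have "M (degree_one_rep (residue L)) = M L"
      unfolding M_def using functional_degree_one_rep[OF fun_mult that]
      by (intro eq_matI) auto
    then show ?thesis by (simp add: F_def)
  qed
  show ?thesis
  proof (rule that)
    show "F \<in> polynomial_functions n I"
      unfolding F_def M_def
      by (rule polynomial_functions_det[OF polynomial_functions_functional[OF fun_mult]])
    have "M L0 = 1\<^sub>m m"
      unfolding M_def using \<phi>(2) by (intro eq_matI) auto
    then show "F (residue L0) \<noteq> 0"
      by (simp add: F_eq[OF L0])
    show "functional (\<phi> j)" if "j < m" for j by (rule \<phi>(1)[OF that])
    show "\<phi> j (L0 * q i) = (if i = j then 1 else 0)" if "i < m" "j < m" for i j
      by (rule \<phi>(2)[OF that])
    show "\<exists>G. \<forall>i<m. \<forall>k<m.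
        (\<Sum>j<m. \<phi> j (L * q i) * G j k) = (if i = k then 1 else 0) \<and>
        (\<Sum>j<m. G i j * \<phi> k (L * q j)) = (if i = k then 1 else 0)"
      if L: "L \<in> forms n 1" "F (residue L) \<noteq> 0" for L
    proof -
      have "Determinant.det (M L) \<noteq> 0"
        using L F_eq by simp
      from det_non_zero_imp_unit[OF M this] obtain N where
        N: "N \<in> carrier_mat m m" "N * M L = 1\<^sub>m m" "M L * N = 1\<^sub>m m"
        unfolding Units_def ring_mat_def by auto
      have "(\<Sum>j<m. \<phi> j (L * q i) * N $$ (j, k)) = (if i = k then 1 else 0) \<and>
        (\<Sum>j<m. N $$ (i, j) * \<phi> k (L * q j)) = (if i = k then 1 else 0)" if "i < m" "k < m" for i k
      proof -
        have "(M L * N) $$ (i, k) = (1\<^sub>m m :: 'k mat) $$ (i, k)" "(N * M L) $$ (i, k) = (1\<^sub>m m :: 'k mat) $$ (i, k)"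
          using N by simp_all
        then show ?thesis
          using that N(1) by (simp add: M_def scalar_prod_def atLeast0LessThan)
      qed
      then show ?thesis
        by (intro exI[of _ "\<lambda>i j. N $$ (i, j)"]) blast
    qed
  qed
qed

definition max_rank :: "'k mpoly \<Rightarrow> nat \<Rightarrow> bool" where
  "max_rank L d \<longleftrightarrow> (\<forall>p\<in>forms n d. L * p \<in> I \<longrightarrow> p \<in> I) \<or> forms n (Suc d) \<subseteq> image_mod L d"

text \<open>In both cases the products \<open>L0 * q i\<close> are independent: for injective
  \<open>L0\<close> the \<open>q i\<close> are a basis of A_d, for surjective \<open>L0\<close> they
  are preimages of a basis of A_(d+1). The same minor being non-zero at \<open>L\<close> carries the
  property over.\<close>

lemma max_rank_open:
  assumes L0: "L0 \<in> forms n 1" and max: "max_rank L0 d"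
  obtains F where "F \<in> polynomial_functions n I" "F (residue L0) \<noteq> 0"
    "\<And>L. L \<in> forms n 1 \<Longrightarrow> F (residue L) \<noteq> 0 \<Longrightarrow> max_rank L d"
proof (cases "\<forall>p\<in>forms n d. L0 * p \<in> I \<longrightarrow> p \<in> I")
  case True
  obtain m where "has_dim n I m (graded_piece n I d)"
    using graded_piece_dimension_exists[of d] unfolding has_dim_def by auto
  then obtain q where q: "\<And>i. i < m \<Longrightarrow> q i \<in> forms n d" "independent_mod m q"
    "\<And>p. p \<in> forms n d \<Longrightarrow> \<exists>c. p - comb m c q \<in> I"
    using graded_basisE[of m d] by metis
  have "comb m c q \<in> I" if "comb m c (\<lambda>i. L0 * q i) \<in> I" for c
  proof -
    have "comb m c q \<in> forms n d"
      by (rule comb_in_subspace[OF subspace_forms q(1)])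
    then show ?thesis
      using True that unfolding comb_mult[symmetric] by blast
  qed
  then have ind: "independent_mod m (\<lambda>i. L0 * q i)"
    using q(2) unfolding independent_mod_def by blast
  obtain F \<phi> where
    F: "F \<in> polynomial_functions n I" "F (residue L0) \<noteq> 0"
    "\<And>j. j < m \<Longrightarrow> functional (\<phi> j)"
    "\<And>i j. i < m \<Longrightarrow> j < m \<Longrightarrow> \<phi> j (L0 * q i) = (if i = j then 1 else 0)"
    "\<And>L. L \<in> forms n 1 \<Longrightarrow> F (residue L) \<noteq> 0 \<Longrightarrow> \<exists>G. \<forall>i<m. \<forall>k<m.
        (\<Sum>j<m. \<phi> j (L * q i) * G j k) = (if i = k then 1 else 0) \<and>
        (\<Sum>j<m. G i j * \<phi> k (L * q j)) = (if i = k then 1 else 0)"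
    by (rule multiplication_matrix[OF L0 _ ind], erule q(1)) (rule that)
  show ?thesis
  proof (rule that[OF F(1,2)])
    fix L assume L: "L \<in> forms n 1" "F (residue L) \<noteq> 0"
    obtain G where G: "\<And>i k. i < m \<Longrightarrow> k < m \<Longrightarrow>
        (\<Sum>j<m. \<phi> j (L * q i) * G j k) = (if i = k then 1 else 0)"
      using F(5)[OF L] by metis
    have "p \<in> I" if p: "p \<in> forms n d" "L * p \<in> I" for p
    proof -
      obtain c where c: "p - comb m c q \<in> I"
        using q(3)[OF p(1)] by blast
      have "L * p - L * (p - comb m c q) \<in> I"
        by (intro I_diff p(2) I_mult(1)[OF forms_in_polys[OF L(1)] c])
      then have "comb m c (\<lambda>i. L * q i) \<in> I"
        unfolding comb_mult[symmetric] by (simp add: algebra_simps)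
      then have 0: "(\<Sum>i<m. c i * \<phi> j (L * q i)) = 0" if "j < m" for j
        using functional_I[OF F(3)[OF that]] functional_comb[OF F(3)[OF that]] by metis
      \<comment> \<open>All coordinates of \<open>L * p\<close> vanish; the inverse matrix recovers
        \<open>c k\<close> from them.\<close>
      have "c k = 0" if k: "k < m" for k
      proof -
        have "c k = (\<Sum>i<m. c i * (if i = k then 1 else 0))"
          using k by (simp add: if_distrib cong: if_cong)
        also have "\<dots> = (\<Sum>i<m. c i * (\<Sum>j<m. \<phi> j (L * q i) * G j k))"
          using G k by (intro sum.cong) auto
        also have "\<dots> = (\<Sum>i<m. \<Sum>j<m. c i * \<phi> j (L * q i) * G j k)"
          by (simp only: sum_distrib_left mult.assoc)
        also have "\<dots> = (\<Sum>j<m. \<Sum>i<m. c i * \<phi> j (L * q i) * G j k)"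
          by (rule sum.swap)
        also have "\<dots> = (\<Sum>j<m. (\<Sum>i<m. c i * \<phi> j (L * q i)) * G j k)"
          by (simp only: sum_distrib_right)
        also have "\<dots> = 0"
          using 0 by (intro sum.neutral) auto
        finally show ?thesis .
      qed
      then have "comb m c q = comb m (\<lambda>_. 0) q"
        by (intro comb_cong) auto
      with c show "p \<in> I" by simp
    qed
    then show "max_rank L d" by (auto simp: max_rank_def)
  qed
next
  case False
  then have surj: "forms n (Suc d) \<subseteq> image_mod L0 d"
    using max by (auto simp: max_rank_def)
  obtain m where "has_dim n I m (graded_piece n I (Suc d))"
    using graded_piece_dimension_exists[of "Suc d"] unfolding has_dim_def by auto
  then obtain u where u: "\<And>i. i < m \<Longrightarrow> u i \<in> forms n (Suc d)" "independent_mod m u"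
    "\<And>p. p \<in> forms n (Suc d) \<Longrightarrow> \<exists>c. p - comb m c u \<in> I"
    using graded_basisE[of m "Suc d"] by metis
  have "\<exists>p. p \<in> forms n d \<and> u i - L0 * p \<in> I" if "i < m" for i
    using subsetD[OF surj u(1)[OF that]] by (auto simp: image_mod_def)
  then obtain q where q: "\<And>i. i < m \<Longrightarrow> q i \<in> forms n d" "\<And>i. i < m \<Longrightarrow> u i - L0 * q i \<in> I"
    by metis
  have uq: "comb m c u - comb m c (\<lambda>i. L0 * q i) \<in> I" for c
  proof -
    have "comb m c (\<lambda>i. u i - L0 * q i) \<in> I"
      by (rule comb_in_subspace[OF subspace_I q(2)])
    then show ?thesis
      by (simp add: comb_def right_diff_distrib sum_subtractf)
  qed
  have "comb m c u \<in> I" if "comb m c (\<lambda>i. L0 * q i) \<in> I" for c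
    using I_add[OF uq[of c] that] by simp
  then have ind: "independent_mod m (\<lambda>i. L0 * q i)"
    using u(2) unfolding independent_mod_def by blast
  obtain F \<phi> where
    F: "F \<in> polynomial_functions n I" "F (residue L0) \<noteq> 0"
    "\<And>j. j < m \<Longrightarrow> functional (\<phi> j)"
    "\<And>i j. i < m \<Longrightarrow> j < m \<Longrightarrow> \<phi> j (L0 * q i) = (if i = j then 1 else 0)"
    "\<And>L. L \<in> forms n 1 \<Longrightarrow> F (residue L) \<noteq> 0 \<Longrightarrow> \<exists>G. \<forall>i<m. \<forall>k<m.
        (\<Sum>j<m. \<phi> j (L * q i) * G j k) = (if i = k then 1 else 0) \<and>
        (\<Sum>j<m. G i j * \<phi> k (L * q j)) = (if i = k then 1 else 0)"
    by (rule multiplication_matrix[OF L0 _ ind], erule q(1)) (rule that)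
  have expand: "p - comb m (\<lambda>j. \<phi> j p) (\<lambda>i. L0 * q i) \<in> I" if p: "p \<in> forms n (Suc d)" for p
  proof -
    obtain c where "p - comb m c u \<in> I"
      using u(3)[OF p] by blast
    from I_add[OF this uq[of c]] have c: "p - comb m c (\<lambda>i. L0 * q i) \<in> I"
      by simp
    then show ?thesis
      by (intro dual_expansion[OF F(3,4)]) blast+
  qed
  show ?thesis
  proof (rule that[OF F(1,2)])
    fix L assume L: "L \<in> forms n 1" "F (residue L) \<noteq> 0"
    obtain G where G: "\<And>i k. i < m \<Longrightarrow> k < m \<Longrightarrow>
        (\<Sum>j<m. G i j * \<phi> k (L * q j)) = (if i = k then 1 else 0)"
      using F(5)[OF L] by metis
    \<comment> \<open>Row \<open>i\<close> of the inverse matrix combines the \<open>q j\<close>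
      into an element which \<open>L\<close> sends to \<open>L0 * q i\<close>.\<close>
    have basis: "L0 * q i \<in> image_mod L d" if i: "i < m" for i
    proof (rule image_modI)
      let ?p = "comb m (G i) q"
      show p: "?p \<in> forms n d"
        by (rule comb_in_subspace[OF subspace_forms q(1)])
      have Lp: "L * ?p \<in> forms n (Suc d)"
        using forms_mult[OF L(1) p] by simp
      have "\<phi> k (L * ?p) = (if i = k then 1 else 0)" if "k < m" for k
        unfolding comb_mult functional_comb[OF F(3)[OF that]] using G i that by simp
      then have "comb m (\<lambda>j. \<phi> j (L * ?p)) (\<lambda>i. L0 * q i) = comb m (\<lambda>j. if j = i then 1 else 0) (\<lambda>i. L0 * q i)"
        by (intro comb_cong) auto
      also have "\<dots> = L0 * q i"
        using comb_delta[OF i, of 1 "\<lambda>i. L0 * q i"] by simp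
      finally show "L0 * q i - L * ?p \<in> I"
        using I_neg[OF expand[OF Lp]] by simp
    qed
    have "forms n (Suc d) \<subseteq> image_mod L d"
    proof
      fix p :: "'k mpoly" assume "p \<in> forms n (Suc d)"
      from image_mod_cong[OF expand[OF this]] show "p \<in> image_mod L d"
        by (rule iffD2) (rule comb_in_subspace[OF subspace_image_mod basis])
    qed
    then show "max_rank L d" by (simp add: max_rank_def)
  qed
qed

end

section \<open>Codimension three and socle degree two\<close>

lemma product_remainders:
  fixes x y c d l :: "'a::comm_ring_1"
  shows "x * y = (d * (l * (x - c * l)) + c * (l * (y - d * l))) + (c * d * (l * l) + (x - c * l) * (y - d * l))"
  by (simp add: algebra_simps)

lemma product_three_terms:
  fixes x y z s u p q r :: "'a::comm_ring_1"
  shows "(x + s * y + u * z) * (p * x + q * y + r * z)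
    = p * (x * x + s * (x * y) + u * (x * z)) + q * (x * y + s * (y * y) + u * (y * z))
      + r * (x * z + s * (y * z) + u * (z * z))"
  by (simp add: algebra_simps)

context graded_quotient
begin

text \<open>The coordinates of \<open>w\<close> in the basis \<open>v\<close> form an invertible
  matrix, as a kernel vector would be a relation between the \<open>w i\<close>. Column
  \<open>k\<close> of the inverse expresses \<open>v k\<close> through them.\<close>

lemma independent_mod_spans:
  assumes v: "\<And>i. i < m \<Longrightarrow> v i \<in> forms n d" "independent_mod m v"
    "\<And>p. p \<in> forms n d \<Longrightarrow> \<exists>c. p - comb m c v \<in> I"
    and w: "\<And>i. i < m \<Longrightarrow> w i \<in> forms n d" "independent_mod m w"
    and p: "p \<in> forms n d"
  shows "\<exists>c. p - comb m c w \<in> I"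
proof -
  obtain \<phi> where \<phi>: "\<And>j. j < m \<Longrightarrow> functional (\<phi> j)"
    "\<And>i j. i < m \<Longrightarrow> j < m \<Longrightarrow> \<phi> j (v i) = (if i = j then 1 else 0)"
    using dual_functionals[OF v(2)] by metis
  have expand: "q - comb m (\<lambda>j. \<phi> j q) v \<in> I" if q: "q \<in> forms n d" for q
    by (rule dual_expansion[OF \<phi> v(3)[OF q]])
  define M where "M = Matrix.mat m m (\<lambda>(j, i). \<phi> j (w i))"
  have M: "M \<in> carrier_mat m m"
    by (simp add: M_def)
  have "Determinant.det M \<noteq> 0"
  proof
    assume "Determinant.det M = 0"
    then obtain x where x: "x \<in> carrier_vec m" "x \<noteq> 0\<^sub>v m" "M *\<^sub>v x = 0\<^sub>v m"
      using det_0_iff_vec_prod_zero_field[OF M] by blast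
    let ?q = "comb m (\<lambda>i. x $ i) w"
    have q: "?q \<in> forms n d"
      by (rule comb_in_subspace[OF subspace_forms w(1)])
    have "\<phi> j ?q = 0" if "j < m" for j
    proof -
      have "\<phi> j ?q = (M *\<^sub>v x) $ j"
        unfolding functional_comb[OF \<phi>(1)[OF that]] using that x(1)
        by (simp add: M_def scalar_prod_def atLeast0LessThan mult.commute)
      then show ?thesis
        using x(3) that by simp
    qed
    then have "comb m (\<lambda>j. \<phi> j ?q) v = comb m (\<lambda>_. 0) v"
      by (intro comb_cong) auto
    then have "?q \<in> I"
      using expand[OF q] by simp
    then have "x $ i = 0" if "i < m" for i
      using independent_modD[OF w(2) _ that] by blast
    then have "x = 0\<^sub>v m"
      using x(1) by (intro eq_vecI) auto
    with x(2) show False by simp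
  qed
  from det_non_zero_imp_unit[OF M this] obtain N where
    N: "N \<in> carrier_mat m m" "M * N = 1\<^sub>m m"
    unfolding Units_def ring_mat_def by auto
  let ?J = "{p. \<exists>c. p - comb m c w \<in> I}"
  have "v k \<in> ?J" if k: "k < m" for k
  proof -
    let ?q = "comb m (\<lambda>i. N $$ (i, k)) w"
    have q: "?q \<in> forms n d"
      by (rule comb_in_subspace[OF subspace_forms w(1)])
    have "\<phi> j ?q = (if j = k then 1 else 0)" if "j < m" for j
    proof -
      have "\<phi> j ?q = (M * N) $$ (j, k)"
        unfolding functional_comb[OF \<phi>(1)[OF that]] using that k N(1)
        by (simp add: M_def scalar_prod_def atLeast0LessThan mult.commute)
      then show ?thesis
        using N(2) that k by simp
    qed
    then have "comb m (\<lambda>j. \<phi> j ?q) v = comb m (\<lambda>j. if j = k then 1 else 0) v"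
      by (intro comb_cong) auto
    also have "\<dots> = v k"
      using comb_delta[OF k, of 1 v] by simp
    finally have "v k - ?q \<in> I"
      using I_neg[OF expand[OF q]] by simp
    then show ?thesis by blast
  qed
  then have "comb m c v \<in> ?J" for c
    by (rule comb_in_subspace[OF subspace_residue_span])
  moreover have "p - comb m (\<lambda>j. \<phi> j p) v \<in> ?J"
  proof -
    have "p - comb m (\<lambda>j. \<phi> j p) v - comb m (\<lambda>_. 0) w \<in> I"
      using expand[OF p] by simp
    then show ?thesis by blast
  qed
  ultimately have "(p - comb m (\<lambda>j. \<phi> j p) v) + comb m (\<lambda>j. \<phi> j p) v \<in> ?J"
    by (intro mp.subspace_add[OF subspace_residue_span])
  then show ?thesis by simp
qed

lemma scale_divide:
  assumes "c \<noteq> 0"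
  shows "const_poly c * (const_poly (a / c) * p) = const_poly a * p"
  using assms by (simp add: mult.assoc[symmetric] const_poly_mult[symmetric])

lemma comb_3: "comb 3 c (nth [x, y, z]) = const_poly (c 0) * x + const_poly (c 1) * y + const_poly (c 2) * z"
  by (simp add: numeral_3_eq_3 numeral_2_eq_2)

lemma independent_mod_3I:
  assumes "\<And>\<alpha> \<beta> \<gamma>. const_poly \<alpha> * x + const_poly \<beta> * y + const_poly \<gamma> * z \<in> I \<Longrightarrow> \<alpha> = 0 \<and> \<beta> = 0 \<and> \<gamma> = 0"
  shows "independent_mod 3 (nth [x, y, z])"
  unfolding independent_mod_def comb_3
proof (intro allI impI)
  fix c :: "nat \<Rightarrow> 'k" and i :: nat
  assume "const_poly (c 0) * x + const_poly (c 1) * y + const_poly (c 2) * z \<in> I" "i < 3"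
  from assms[OF this(1)] this(2) show "c i = 0"
    by (auto simp: less_Suc_eq numeral_3_eq_3 numeral_2_eq_2)
qed

lemma dual_functionals_3:
  assumes "independent_mod 3 (nth [x, y, z])"
  obtains \<phi> \<psi> \<theta> where "functional \<phi>" "functional \<psi>" "functional \<theta>"
    "\<phi> x = 1" "\<phi> y = 0" "\<phi> z = 0" "\<psi> x = 0" "\<psi> y = 1" "\<psi> z = 0" "\<theta> x = 0" "\<theta> y = 0" "\<theta> z = 1"
proof -
  obtain \<phi> where \<phi>: "\<And>j. j < 3 \<Longrightarrow> functional (\<phi> j)"
    "\<And>i j. i < 3 \<Longrightarrow> j < 3 \<Longrightarrow> \<phi> j ([x, y, z] ! i) = (if i = j then 1 else 0)"
    using dual_functionals[OF assms] by metis
  show ?thesis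
    using \<phi>(1)[of 0] \<phi>(1)[of 1] \<phi>(1)[of 2] \<phi>(2)[of 0 0] \<phi>(2)[of 1 0] \<phi>(2)[of 2 0]
      \<phi>(2)[of 0 1] \<phi>(2)[of 1 1] \<phi>(2)[of 2 1] \<phi>(2)[of 0 2] \<phi>(2)[of 1 2] \<phi>(2)[of 2 2]
    by (intro that[of "\<phi> 0" "\<phi> 1" "\<phi> 2"]) simp_all
qed

text \<open>The preimage of the line spanned by \<open>z\<close> in the quotient.\<close>

definition multiples_mod :: "'k mpoly \<Rightarrow> 'k mpoly set" where
  "multiples_mod z = {p. \<exists>c. p - const_poly c * z \<in> I}"

lemma subspace_multiples_mod: "mp.subspace (multiples_mod z)"
proof -
  have "multiples_mod z = {p. \<exists>c. p - comb 1 c (\<lambda>_. z) \<in> I}"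
    unfolding multiples_mod_def by (auto simp: comb_def intro: exI[of _ "\<lambda>_. c" for c])
  then show ?thesis
    using subspace_residue_span[of 1 "\<lambda>_. z"] by simp
qed

lemma multiples_modI: "p - const_poly c * z \<in> I \<Longrightarrow> p \<in> multiples_mod z"
  by (auto simp: multiples_mod_def)

lemma I_subset_multiples_mod: "p \<in> I \<Longrightarrow> p \<in> multiples_mod z"
  by (rule multiples_modI[of _ 0]) simp

lemma multiples_mod_self: "z \<in> multiples_mod z"
  by (rule multiples_modI[of _ 1]) simp

text \<open>Polarization: (x + y)^2 - x^2 - y^2 = 2 x y.\<close>

lemma square_vanishing_imp_product:
  fixes J K :: "'k mpoly set"
  assumes J: "mp.subspace J" and sq: "\<And>x. x \<in> K \<Longrightarrow> x * x \<in> J" and K: "mp.subspace K"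
    and two: "(2 :: 'k) \<noteq> 0" and xy: "x \<in> K" "y \<in> K"
  shows "x * y \<in> J"
proof -
  have "(x + y) * (x + y) - x * x - y * y \<in> J"
    by (intro mp.subspace_diff[OF J] sq mp.subspace_add[OF K] xy)
  also have "(x + y) * (x + y) - x * x - y * y = const_poly (2 :: 'k) * (x * y)"
  proof -
    have "const_poly (2 :: 'k) = 1 + 1"
      using const_poly_add[of "1 :: 'k" 1] by simp
    then show ?thesis
      by (simp add: algebra_simps)
  qed
  finally have "const_poly (inverse 2) * (const_poly 2 * (x * y)) \<in> J"
    by (rule mp.subspace_scale[OF J])
  then show ?thesis
    using two by (simp add: mult.assoc[symmetric] const_poly_mult[symmetric])
qed

end

context graded_quotient_char_0
begin

lemma max_rank_dim_3:
  assumes codim: "has_codimension n I 3"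
    and nondeg: "\<And>p. p \<in> forms n 1 \<Longrightarrow> (\<And>q. q \<in> forms n 1 \<Longrightarrow> q * p \<in> I) \<Longrightarrow> p \<in> I"
  shows "\<exists>L\<in>forms n 1. max_rank L 1"
proof (rule ccontr)
  assume "\<not> ?thesis"
  then have noninj: "\<exists>p\<in>forms n 1. L * p \<in> I \<and> p \<notin> I"
    and nonsurj: "\<not> forms n (Suc 1) \<subseteq> image_mod L 1" if "L \<in> forms n 1" for L
    using that by (auto simp: max_rank_def)
  obtain v where v: "\<And>i. i < 3 \<Longrightarrow> v i \<in> forms n 1" "independent_mod 3 v"
    "\<And>p. p \<in> forms n 1 \<Longrightarrow> \<exists>c. p - comb 3 c v \<in> I"
    using codimensionE[OF codim] by metis
  note V = mp.subspace_add[OF subspace_forms] mp.subspace_diff[OF subspace_forms]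
    mp.subspace_scale[OF subspace_forms]
  have im: "p * q \<in> I" if "p \<in> forms n 1" "q \<in> I" for p q
    by (rule I_mult(1)[OF forms_in_polys[OF that(1)] that(2)])
  have v0: "v 0 \<in> forms n 1" "v 0 \<notin> I"
  proof -
    show "v 0 \<in> forms n 1" by (rule v(1)) simp
    show "v 0 \<notin> I"
    proof
      assume "v 0 \<in> I"
      then have "comb 3 (\<lambda>i. if i = 0 then 1 else 0) v \<in> I"
        using comb_delta[of 0 3 1 v] by simp
      from independent_modD[OF v(2) this, of 0] show False by simp
    qed
  qed
  \<comment> \<open>If all squares vanished, so would all products by polarization, and
    \<open>v 0\<close> would violate \<open>nondeg\<close>.\<close>
  have "\<exists>L\<in>forms n 1. L * L \<notin> I"
  proof (rule ccontr)
    assume "\<not> (\<exists>L\<in>forms n 1. L * L \<notin> I)"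
    then have "q * v 0 \<in> I" if "q \<in> forms n 1" for q
      using square_vanishing_imp_product[OF subspace_I _ subspace_forms, of n 1 q "v 0"] that v0(1) by auto
    with nondeg[OF v0(1)] v0(2) show False by blast
  qed
  then obtain L1 where L1: "L1 \<in> forms n 1" "L1 * L1 \<notin> I" by blast
  have "\<exists>L\<in>forms n 1. L * L \<notin> I \<and> (\<exists>c\<in>forms n 1. L * c \<notin> multiples_mod (L * L))"
  proof (rule ccontr)
    assume "\<not> ?thesis"
    then have mult: "L * c \<in> multiples_mod (L * L)"
      if "L \<in> forms n 1" "L * L \<notin> I" "c \<in> forms n 1" for L c
      using that by blast
    define K where "K = {k \<in> forms n 1. L1 * k \<in> I}"
    have K: "mp.subspace K"
      unfolding K_def mp.subspace_def
      by (auto simp: distrib_left I_add mult.left_commute[of L1] I_scale V mp.subspace_0[OF subspace_forms])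
    \<comment> \<open>For \<open>k\<close> in the kernel of \<open>L1\<close>, (L1 + k)^2 = L1^2 +
      k^2 and (L1 + k) L1 = L1^2. If the square is zero, then k^2 = -L1^2; otherwise L1^2 = c (L1^2
      + k^2) with c \<noteq> 0, which can be solved for k^2.\<close>
    have kk: "k * k \<in> multiples_mod (L1 * L1)" if "k \<in> K" for k
    proof -
      have k: "k \<in> forms n 1" "L1 * k \<in> I"
        using that by (auto simp: K_def)
      define L where "L = L1 + k"
      have L: "L \<in> forms n 1"
        unfolding L_def by (intro V L1 k)
      have LL: "L * L - (L1 * L1 + k * k) \<in> I" "L * L1 - L1 * L1 \<in> I"
        using I_add[OF k(2) k(2)] k(2) by (simp_all add: L_def algebra_simps)
      show ?thesis
      proof (cases "L * L \<in> I")
        case True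
        have "k * k - const_poly (-1) * (L1 * L1) = L * L - (L * L - (L1 * L1 + k * k))"
          by (simp add: const_poly_uminus)
        also have "\<dots> \<in> I"
          by (rule I_diff[OF True LL(1)])
        finally show ?thesis by (rule multiples_modI)
      next
        case False
        then obtain c where c: "L * L1 - const_poly c * (L * L) \<in> I"
          using mult[OF L False L1(1)] by (auto simp: multiples_mod_def)
        have "L1 * L1 - const_poly c * (L1 * L1 + k * k)
            = (L * L1 - const_poly c * (L * L)) - (L * L1 - L1 * L1) + const_poly c * (L * L - (L1 * L1 + k * k))"
          by (simp add: algebra_simps)
        also have "\<dots> \<in> I"
          by (intro I_add I_diff c LL I_scale)
        finally have c': "L1 * L1 - const_poly c * (L1 * L1 + k * k) \<in> I" .
        then have "c \<noteq> 0"
          using L1(2) by auto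
        have "const_poly c * (k * k - const_poly ((1 - c) / c) * (L1 * L1))
            = - (L1 * L1 - const_poly c * (L1 * L1 + k * k))"
          unfolding right_diff_distrib scale_divide[OF \<open>c \<noteq> 0\<close>]
          by (simp add: const_poly_diff algebra_simps)
        also have "\<dots> \<in> I"
          by (rule I_neg[OF c'])
        finally show ?thesis
          unfolding scale_I_iff[OF \<open>c \<noteq> 0\<close>] by (rule multiples_modI)
      qed
    qed
    have KK: "k * l \<in> multiples_mod (L1 * L1)" if "k \<in> K" "l \<in> K" for k l
      using square_vanishing_imp_product[OF subspace_multiples_mod kk K _ that] by simp
    \<comment> \<open>\<open>L1\<close> sends everything to the line of L1^2, so subtracting a
      multiple of \<open>L1\<close> moves \<open>p\<close> into the kernel.\<close>
    have decomp: "\<exists>c. p - const_poly c * L1 \<in> K" if p: "p \<in> forms n 1" for p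
    proof -
      obtain c where c: "L1 * p - const_poly c * (L1 * L1) \<in> I"
        using mult[OF L1 p] by (auto simp: multiples_mod_def)
      have "L1 * (p - const_poly c * L1) = L1 * p - const_poly c * (L1 * L1)"
        by (simp add: algebra_simps)
      then have "p - const_poly c * L1 \<in> K"
        unfolding K_def using c V(2)[OF p V(3)[OF L1(1)]] by simp
      then show ?thesis ..
    qed
    have "multiples_mod (L1 * L1) \<subseteq> image_mod L1 1"
    proof
      fix p assume "p \<in> multiples_mod (L1 * L1)"
      then obtain c where "p - const_poly c * (L1 * L1) \<in> I"
        by (auto simp: multiples_mod_def)
      then have "p - L1 * (const_poly c * L1) \<in> I"
        by (simp add: algebra_simps)
      then show "p \<in> image_mod L1 1"
        by (rule image_modI[rotated]) (intro V L1)
    qed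
    moreover have "forms n (Suc 1) \<subseteq> multiples_mod (L1 * L1)"
    proof (rule forms_Suc_subset[OF subspace_multiples_mod])
      fix i and q :: "'k mpoly" assume i: "i < n" and q: "q \<in> forms n 1"
      obtain c where c: "var i - const_poly c * L1 \<in> K"
        using decomp[OF var_in_forms[OF i]] by blast
      obtain d where d: "q - const_poly d * L1 \<in> K"
        using decomp[OF q] by blast
      let ?k = "var i - const_poly c * L1" and ?l = "q - const_poly d * L1"
      \<comment> \<open>The products of \<open>L1\<close> with the remainders vanish, and the
        product of the remainders is on the line by \<open>KK\<close>.\<close>
      have "var i * q = (const_poly d * (L1 * ?k) + const_poly c * (L1 * ?l)) + (const_poly (c * d) * (L1 * L1) + ?k * ?l)"
        unfolding const_poly_mult by (rule product_remainders)
      also have "\<dots> \<in> multiples_mod (L1 * L1)"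
        using c d
        by (intro mp.subspace_add[OF subspace_multiples_mod] mp.subspace_scale[OF subspace_multiples_mod]
            multiples_mod_self KK I_subset_multiples_mod) (auto simp: K_def)
      finally show "var i * q \<in> multiples_mod (L1 * L1)" .
    qed
    ultimately show False
      using nonsurj[OF L1(1)] by blast
  qed
  then obtain L c where L: "L \<in> forms n 1" "L * L \<notin> I" and c: "c \<in> forms n 1" "L * c \<notin> multiples_mod (L * L)"
    by blast
  obtain a where a: "a \<in> forms n 1" "L * a \<in> I" "a \<notin> I"
    using noninj[OF L(1)] by blast
  have LLc: "\<alpha> = 0 \<and> \<beta> = 0" if "const_poly \<alpha> * (L * L) + const_poly \<beta> * (L * c) \<in> I" for \<alpha> \<beta>
  proof -
    have "\<beta> = 0"
    proof (rule ccontr)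
      assume nz: "\<beta> \<noteq> 0"
      have "const_poly \<beta> * (L * c - const_poly ((- \<alpha>) / \<beta>) * (L * L)) = const_poly \<alpha> * (L * L) + const_poly \<beta> * (L * c)"
        unfolding right_diff_distrib scale_divide[OF nz] by (simp add: const_poly_uminus)
      then have "L * c - const_poly ((- \<alpha>) / \<beta>) * (L * L) \<in> I"
        using that scale_I_iff[OF nz] by metis
      then show False
        using multiples_modI c(2) by blast
    qed
    then show ?thesis
      using that scale_I_iff[of \<alpha> "L * L"] L(2) by auto
  qed
  have "independent_mod 3 (nth [L, a, c])"
  proof (rule independent_mod_3I)
    fix \<alpha> \<beta> \<gamma> assume *: "const_poly \<alpha> * L + const_poly \<beta> * a + const_poly \<gamma> * c \<in> I"
    have "const_poly \<alpha> * (L * L) + const_poly \<gamma> * (L * c)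
        = L * (const_poly \<alpha> * L + const_poly \<beta> * a + const_poly \<gamma> * c) - const_poly \<beta> * (L * a)"
      by (simp add: algebra_simps)
    also have "\<dots> \<in> I"
      by (intro I_diff im L(1) * I_scale a(2))
    finally have "\<alpha> = 0 \<and> \<gamma> = 0"
      by (rule LLc)
    with * a(3) show "\<alpha> = 0 \<and> \<beta> = 0 \<and> \<gamma> = 0"
      using scale_I_iff[of \<beta> a] by auto
  qed
  moreover have w: "[L, a, c] ! i \<in> forms n 1" if "i < 3" for i
    using that L(1) a(1) c(1) by (auto simp: less_Suc_eq numeral_3_eq_3)
  ultimately have span: "\<exists>e. p - comb 3 e (nth [L, a, c]) \<in> I" if "p \<in> forms n 1" for p
    using independent_mod_spans[OF v(1,2,3), of "nth [L, a, c]" p] that by blast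
  \<comment> \<open>A non-zero kernel element of L + s a + u c, written as \<kappa> L + \<mu> a +
    \<nu> c; terms with L a are dropped. The coefficients are chosen before the functional, so
    different functionals give equations for the same three unknowns.\<close>
  have dep: "\<exists>\<kappa> \<mu> \<nu>. (\<kappa> \<noteq> 0 \<or> \<mu> \<noteq> 0 \<or> \<nu> \<noteq> 0) \<and> (\<forall>\<phi>. functional \<phi> \<longrightarrow>
      \<kappa> * (\<phi> (L * L) + u * \<phi> (L * c)) + \<mu> * (s * \<phi> (a * a) + u * \<phi> (a * c))
      + \<nu> * (\<phi> (L * c) + s * \<phi> (a * c) + u * \<phi> (c * c)) = 0)" for s u
  proof -
    let ?L = "L + const_poly s * a + const_poly u * c"
    have L': "?L \<in> forms n 1"
      by (intro V L a c)
    obtain p where p: "p \<in> forms n 1" "?L * p \<in> I" "p \<notin> I"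
      using noninj[OF L'] by blast
    obtain e where e: "p - comb 3 e (nth [L, a, c]) \<in> I"
      using span[OF p(1)] by blast
    let ?q = "const_poly (e 0) * L + const_poly (e 1) * a + const_poly (e 2) * c"
    have pq: "p - ?q \<in> I"
      using e by (simp only: comb_3)
    have nz: "e 0 \<noteq> 0 \<or> e 1 \<noteq> 0 \<or> e 2 \<noteq> 0"
    proof (rule ccontr)
      assume "\<not> ?thesis"
      then show False using pq p(3) by simp
    qed
    have "?L * ?q = ?L * p - ?L * (p - ?q)"
      by (simp add: algebra_simps)
    also have "\<dots> \<in> I"
      by (intro I_diff p(2) im[OF L'] pq)
    finally have Lq: "?L * ?q \<in> I" .
    have "e 0 * (\<phi> (L * L) + u * \<phi> (L * c)) + e 1 * (s * \<phi> (a * a) + u * \<phi> (a * c))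
      + e 2 * (\<phi> (L * c) + s * \<phi> (a * c) + u * \<phi> (c * c)) = 0" if \<phi>: "functional \<phi>" for \<phi>
    proof -
      have "?L * ?q = const_poly (e 0) * (L * L + const_poly s * (L * a) + const_poly u * (L * c))
          + const_poly (e 1) * (L * a + const_poly s * (a * a) + const_poly u * (a * c))
          + const_poly (e 2) * (L * c + const_poly s * (a * c) + const_poly u * (c * c))"
        by (rule product_three_terms)
      then have "0 = \<phi> (const_poly (e 0) * (L * L + const_poly s * (L * a) + const_poly u * (L * c))
          + const_poly (e 1) * (L * a + const_poly s * (a * a) + const_poly u * (a * c))
          + const_poly (e 2) * (L * c + const_poly s * (a * c) + const_poly u * (c * c)))"
        using functional_I[OF \<phi> Lq] by simp
      then show ?thesis
        unfolding functional_add[OF \<phi>] functional_scale[OF \<phi>] functional_I[OF \<phi> a(2)] by simp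
    qed
    with nz show ?thesis by blast
  qed
  \<comment> \<open>The preimage of L A_1, which is spanned by L^2 and L c since L a = 0.\<close>
  define P where "P = {p. \<exists>\<alpha> \<beta>. p - (const_poly \<alpha> * (L * L) + const_poly \<beta> * (L * c)) \<in> I}"
  have ind: "independent_mod 3 (nth [L * L, L * c, x])" if "x \<notin> P" for x
  proof (rule independent_mod_3I)
    fix \<alpha> \<beta> \<gamma> assume *: "const_poly \<alpha> * (L * L) + const_poly \<beta> * (L * c) + const_poly \<gamma> * x \<in> I"
    have "\<gamma> = 0"
    proof (rule ccontr)
      assume nz: "\<gamma> \<noteq> 0"
      have "const_poly \<gamma> * (x - (const_poly ((- \<alpha>) / \<gamma>) * (L * L) + const_poly ((- \<beta>) / \<gamma>) * (L * c)))
          = const_poly \<alpha> * (L * L) + const_poly \<beta> * (L * c) + const_poly \<gamma> * x"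
        unfolding right_diff_distrib distrib_left scale_divide[OF nz] by (simp add: const_poly_uminus)
      then have "x - (const_poly ((- \<alpha>) / \<gamma>) * (L * L) + const_poly ((- \<beta>) / \<gamma>) * (L * c)) \<in> I"
        using * scale_I_iff[OF nz] by metis
      with that show False
        unfolding P_def by blast
    qed
    with * LLc[of \<alpha> \<beta>] show "\<alpha> = 0 \<and> \<beta> = 0 \<and> \<gamma> = 0" by simp
  qed
  \<comment> \<open>Otherwise L^2, L c, a^2 are independent, and in these coordinates multiplication
    by L + s a has determinant s (1 + s \<psi>(a c)) up to sign. It is non-zero for s = 1 or s = -1,
    contradicting \<open>dep\<close>.\<close>
  have aa: "a * a \<in> P"
  proof (rule ccontr)
    assume "a * a \<notin> P"
    from dual_functionals_3[OF ind[OF this]] obtain \<phi> \<psi> \<theta> where \<phi>: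
      "functional \<phi>" "functional \<psi>" "functional \<theta>"
      "\<phi> (L * L) = 1" "\<phi> (L * c) = 0" "\<phi> (a * a) = 0"
      "\<psi> (L * L) = 0" "\<psi> (L * c) = 1" "\<psi> (a * a) = 0"
      "\<theta> (L * L) = 0" "\<theta> (L * c) = 0" "\<theta> (a * a) = 1" .
    obtain s where s: "s \<noteq> 0" "1 + s * \<psi> (a * c) \<noteq> 0"
    proof (cases "\<psi> (a * c) = -1")
      case True
      then show ?thesis using that[of "-1"] by simp
    next
      case False
      then show ?thesis using that[of 1] by (auto simp: add_eq_0_iff)
    qed
    obtain \<kappa> \<mu> \<nu> where *: "\<kappa> \<noteq> 0 \<or> \<mu> \<noteq> 0 \<or> \<nu> \<noteq> 0" "\<forall>\<phi>. functional \<phi> \<longrightarrow>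
      \<kappa> * (\<phi> (L * L) + 0 * \<phi> (L * c)) + \<mu> * (s * \<phi> (a * a) + 0 * \<phi> (a * c))
      + \<nu> * (\<phi> (L * c) + s * \<phi> (a * c) + 0 * \<phi> (c * c)) = 0"
      using dep[of 0 s] by (elim exE conjE) (rule that)
    have "\<nu> = 0"
      using *(2)[rule_format, OF \<phi>(2)] \<phi> s by simp
    moreover have "\<kappa> = 0"
      using *(2)[rule_format, OF \<phi>(1)] \<phi> \<open>\<nu> = 0\<close> by simp
    moreover have "\<mu> = 0"
      using *(2)[rule_format, OF \<phi>(3)] \<phi> s \<open>\<nu> = 0\<close> by simp
    ultimately show False using *(1) by simp
  qed
  \<comment> \<open>The same with L + u c and the coordinates L^2, L c, a c: up to sign the
    determinant is u times the quadratic polynomial \<open>?f u\<close>, whose constant term is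
    1.\<close>
  have ac: "a * c \<in> P"
  proof (rule ccontr)
    assume "a * c \<notin> P"
    from dual_functionals_3[OF ind[OF this]] obtain \<phi> \<psi> \<theta> where \<phi>:
      "functional \<phi>" "functional \<psi>" "functional \<theta>"
      "\<phi> (L * L) = 1" "\<phi> (L * c) = 0" "\<phi> (a * c) = 0"
      "\<psi> (L * L) = 0" "\<psi> (L * c) = 1" "\<psi> (a * c) = 0"
      "\<theta> (L * L) = 0" "\<theta> (L * c) = 0" "\<theta> (a * c) = 1" .
    let ?f = "\<lambda>u. 1 + u * \<psi> (c * c) - u * u * \<phi> (c * c)"
    obtain u where u: "u \<noteq> 0" "?f u \<noteq> 0"
    proof (cases "?f 1 \<noteq> 0 \<or> ?f (-1) \<noteq> 0")
      case True
      then show ?thesis using that[of 1] that[of "-1"] by auto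
    next
      case False
      then have z: "?f 1 = 0" "?f (-1) = 0" by blast+
      \<comment> \<open>Third differences of a quadratic polynomial vanish, and \<open>?f\<close> is
        1 at 0. So \<open>?f\<close> is non-zero at one of 1, -1, 2.\<close>
      have "?f 2 = 3 * ?f 1 + ?f (-1) - 3"
        by (simp add: algebra_simps)
      then have f2: "?f 2 = -3"
        by (simp only: z) simp
      show ?thesis
        by (rule that[of 2]) (simp, simp only: f2, simp)
    qed
    obtain \<kappa> \<mu> \<nu> where *: "\<kappa> \<noteq> 0 \<or> \<mu> \<noteq> 0 \<or> \<nu> \<noteq> 0" "\<forall>\<phi>. functional \<phi> \<longrightarrow>
      \<kappa> * (\<phi> (L * L) + u * \<phi> (L * c)) + \<mu> * (0 * \<phi> (a * a) + u * \<phi> (a * c))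
      + \<nu> * (\<phi> (L * c) + 0 * \<phi> (a * c) + u * \<phi> (c * c)) = 0"
      using dep[of u 0] by (elim exE conjE) (rule that)
    have "\<kappa> + \<nu> * u * \<phi> (c * c) = 0"
      using *(2)[rule_format, OF \<phi>(1)] unfolding \<phi>(4-6) by (simp only: mult_zero_left mult_zero_right add_0_left add_0_right mult_1_right mult.assoc)
    then have \<kappa>: "\<kappa> = - (\<nu> * u * \<phi> (c * c))"
      by (simp only: eq_neg_iff_add_eq_0)
    have "\<kappa> * u + \<nu> * (1 + u * \<psi> (c * c)) = 0"
      using *(2)[rule_format, OF \<phi>(2)] unfolding \<phi>(7-9) by (simp only: mult_zero_left mult_zero_right add_0_left add_0_right mult_1_right add.assoc)
    moreover have "\<nu> * ?f u = \<kappa> * u + \<nu> * (1 + u * \<psi> (c * c))"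
      unfolding \<kappa> by (simp add: algebra_simps)
    ultimately have "\<nu> * ?f u = 0"
      by (simp only:)
    then have "\<nu> = 0"
      using u by simp
    moreover have "\<kappa> = 0"
      using \<kappa> \<open>\<nu> = 0\<close> by simp
    moreover have "\<mu> = 0"
      using *(2)[rule_format, OF \<phi>(3)] u unfolding \<phi>(10-12) \<open>\<nu> = 0\<close> by simp
    ultimately show False using *(1) by simp
  qed
  \<comment> \<open>Otherwise all products of \<open>L\<close>, \<open>a\<close>, \<open>c\<close>
    lie in L A_1, and \<open>L\<close> is surjective.\<close>
  have cc: "c * c \<notin> P"
  proof
    assume cc: "c * c \<in> P"
    have PT: "p \<in> image_mod L 1" if h: "p \<in> P" for p
    proof -
      obtain \<alpha> \<beta> where p: "p - (const_poly \<alpha> * (L * L) + const_poly \<beta> * (L * c)) \<in> I"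
        using h unfolding P_def by blast
      have "const_poly \<alpha> * (L * L) + const_poly \<beta> * (L * c) = L * (const_poly \<alpha> * L + const_poly \<beta> * c)"
        by (simp add: algebra_simps)
      with p have "p - L * (const_poly \<alpha> * L + const_poly \<beta> * c) \<in> I"
        by simp
      then show ?thesis
        by (rule image_modI[rotated]) (intro V L c)
    qed
    have "forms n (Suc 1) \<subseteq> image_mod L 1"
    proof (rule forms_Suc_subset_mod[OF subspace_image_mod I_subset_image_mod span])
      fix k and q :: "'k mpoly" assume k: "k < (3 :: nat)" and q: "q \<in> forms n 1"
      obtain e where e: "q - comb 3 e (nth [L, a, c]) \<in> I"
        using span[OF q] by blast
      have prod: "x * y \<in> image_mod L 1" if "x \<in> {L, a, c}" "y \<in> {L, a, c}" for x y
        using that PT[OF aa] PT[OF ac] PT[OF cc] image_mod_mult[OF L(1), of L] image_mod_mult[OF a(1), of L]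
          image_mod_mult[OF c(1), of L] by (auto simp: mult.commute)
      have wk: "[L, a, c] ! i \<in> {L, a, c}" if "i < 3" for i
        using that by (auto simp: less_Suc_eq numeral_3_eq_3)
      have "[L, a, c] ! k * comb 3 e (nth [L, a, c]) \<in> image_mod L 1"
        unfolding comb_mult by (intro comb_in_subspace[OF subspace_image_mod] prod wk k)
      moreover have "[L, a, c] ! k * q - [L, a, c] ! k * comb 3 e (nth [L, a, c]) \<in> I"
        unfolding right_diff_distrib[symmetric] by (rule im[OF w[OF k] e])
      ultimately show "[L, a, c] ! k * q \<in> image_mod L 1"
        using image_mod_cong by blast
    qed
    with nonsurj[OF L(1)] show False by blast
  qed
  from dual_functionals_3[OF ind[OF cc]] obtain \<phi> \<psi> \<theta> where \<phi>:
    "functional \<phi>" "functional \<psi>" "functional \<theta>"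
    "\<phi> (L * L) = 1" "\<phi> (L * c) = 0" "\<phi> (c * c) = 0"
    "\<psi> (L * L) = 0" "\<psi> (L * c) = 1" "\<psi> (c * c) = 0"
    "\<theta> (L * L) = 0" "\<theta> (L * c) = 0" "\<theta> (c * c) = 1" .
  have coords: "\<theta> x = 0 \<and> (\<phi> x = 0 \<longrightarrow> \<psi> x = 0 \<longrightarrow> x \<in> I)" if h: "x \<in> P" for x
  proof -
    obtain \<alpha> \<beta> where x: "x - (const_poly \<alpha> * (L * L) + const_poly \<beta> * (L * c)) \<in> I"
      using h unfolding P_def by blast
    have "\<phi> x = \<alpha>" "\<psi> x = \<beta>" "\<theta> x = 0"
      using functional_cong[OF \<phi>(1) x] functional_cong[OF \<phi>(2) x] functional_cong[OF \<phi>(3) x]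
      unfolding functional_add[OF \<phi>(1)] functional_add[OF \<phi>(2)] functional_add[OF \<phi>(3)]
        functional_scale[OF \<phi>(1)] functional_scale[OF \<phi>(2)] functional_scale[OF \<phi>(3)]
      using \<phi>(4-12) by simp_all
    then show ?thesis using x by auto
  qed
  \<comment> \<open>Since a^2 and a c have no c^2 coordinate, \<theta> gives \<nu> = 0. The
    remaining relation makes s a^2 + u a c a multiple of L^2 + u L c, so its second coordinate is
    \<open>u\<close> times its first.\<close>
  have key: "s * \<psi> (a * a) + u * \<psi> (a * c) = u * (s * \<phi> (a * a) + u * \<phi> (a * c))"
    if u: "u \<noteq> 0" and s: "s * \<phi> (a * c) = 0" "s * \<psi> (a * c) = 0" for s u
  proof -
    obtain \<kappa> \<mu> \<nu> where *: "\<kappa> \<noteq> 0 \<or> \<mu> \<noteq> 0 \<or> \<nu> \<noteq> 0" "\<forall>\<phi>. functional \<phi> \<longrightarrow>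
      \<kappa> * (\<phi> (L * L) + u * \<phi> (L * c)) + \<mu> * (s * \<phi> (a * a) + u * \<phi> (a * c))
      + \<nu> * (\<phi> (L * c) + s * \<phi> (a * c) + u * \<phi> (c * c)) = 0"
      using dep[of u s] by (elim exE conjE) (rule that)
    have "\<nu> = 0"
      using *(2)[rule_format, OF \<phi>(3)] \<phi> u coords[OF aa] coords[OF ac] by simp
    have "\<kappa> + \<mu> * (s * \<phi> (a * a) + u * \<phi> (a * c)) = 0"
      using *(2)[rule_format, OF \<phi>(1)] unfolding \<phi>(4-6) \<open>\<nu> = 0\<close> by (simp only: mult_zero_left mult_zero_right add_0_left add_0_right mult_1_right)
    then have \<kappa>: "\<kappa> = - (\<mu> * (s * \<phi> (a * a) + u * \<phi> (a * c)))"
      by (simp only: eq_neg_iff_add_eq_0)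
    have "\<kappa> * u + \<mu> * (s * \<psi> (a * a) + u * \<psi> (a * c)) = 0"
      using *(2)[rule_format, OF \<phi>(2)] unfolding \<phi>(7-9) \<open>\<nu> = 0\<close> by (simp only: mult_zero_left mult_zero_right add_0_left add_0_right mult_1_right)
    moreover have "\<mu> * (s * \<psi> (a * a) + u * \<psi> (a * c) - u * (s * \<phi> (a * a) + u * \<phi> (a * c)))
        = \<kappa> * u + \<mu> * (s * \<psi> (a * a) + u * \<psi> (a * c))"
      unfolding \<kappa> by (simp add: algebra_simps)
    ultimately have "\<mu> * (s * \<psi> (a * a) + u * \<psi> (a * c) - u * (s * \<phi> (a * a) + u * \<phi> (a * c))) = 0"
      by (simp only:)
    moreover have "\<mu> \<noteq> 0"
      using *(1) \<kappa> \<open>\<nu> = 0\<close> by auto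
    ultimately show ?thesis
      by (simp only: mult_eq_0_iff simp_thms right_minus_eq)
  qed
  \<comment> \<open>For u = 1 and u = -1 the two coordinates are equal and opposite, hence both zero
    as 2 \<noteq> 0. With a c out of the way, s = 1 gives the same for a^2.\<close>
  have "\<phi> (a * c) = 0" "\<psi> (a * c) = 0"
    using key[of 1 0] key[of "-1" 0] by simp_all
  moreover from this have "\<phi> (a * a) = 0" "\<psi> (a * a) = 0"
    using key[of 1 1] key[of "-1" 1] by simp_all
  ultimately have "a * a \<in> I" "c * a \<in> I"
    using coords[OF aa] coords[OF ac] by (simp_all add: mult.commute)
  then have "q * a \<in> I" if q: "q \<in> forms n 1" for q
  proof -
    obtain e where e: "q - comb 3 e (nth [L, a, c]) \<in> I"
      using span[OF q] by blast
    have "q * a = a * (q - comb 3 e (nth [L, a, c])) + (const_poly (e 0) * (L * a) + const_poly (e 1) * (a * a)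
        + const_poly (e 2) * (c * a))"
      unfolding comb_3 by (simp add: algebra_simps)
    also have "\<dots> \<in> I"
      by (intro I_add I_scale im[OF a(1) e] a(2) \<open>a * a \<in> I\<close> \<open>c * a \<in> I\<close>)
    finally show ?thesis .
  qed
  from nondeg[OF a(1) this] a(3) show False by blast
qed

end

section \<open>Coefficients of multiples of monomials, and a criterion for artinian
  quotients\<close>

lemma lookup_monom_poly_mult:
  fixes p :: "'k::field mpoly"
  shows "Poly_Mapping.lookup (monom_poly k * p) (k + m) = Poly_Mapping.lookup p m"
proof -
  have "monom_poly k * p = (\<Sum>m'\<in>Poly_Mapping.keys p. const_poly (Poly_Mapping.lookup p m') * monom_poly (k + m'))"
    by (subst poly_expansion[of p]) (simp add: sum_distrib_left monom_poly_add mult_ac)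
  then show ?thesis
    by (simp add: lookup_sum lookup_const_poly_mult lookup_monom_poly in_keys_iff if_distrib cong: if_cong)
qed

lemma lookup_monom_poly_mult_eq_0:
  fixes p :: "'k::field mpoly"
  assumes "\<And>m'. m \<noteq> k + m'"
  shows "Poly_Mapping.lookup (monom_poly k * p) m = 0"
proof -
  have "Poly_Mapping.keys (monom_poly k * p) \<subseteq> {a + b |a b. a \<in> {k} \<and> b \<in> Poly_Mapping.keys p}"
    using Poly_Mapping.keys_mult[of "monom_poly k" p] by (simp add: monom_poly_def)
  then have "m \<notin> Poly_Mapping.keys (monom_poly k * p)"
    using assms by blast
  then show ?thesis
    by (simp add: in_keys_iff)
qed

lemma var_mult_eq_0:
  fixes p :: "'k::field mpoly"
  assumes "var i * p = 0"
  shows "p = 0"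
  by (rule poly_mapping_eqI) (metis assms lookup_monom_poly_mult lookup_zero)

lemma form_1_comb:
  fixes p :: "'k::field mpoly"
  assumes "p \<in> forms n 1"
  shows "p = comb n (\<lambda>i. Poly_Mapping.lookup p (Poly_Mapping.single i 1)) var"
proof (rule poly_mapping_eqI)
  fix m
  have l: "Poly_Mapping.lookup (comb n (\<lambda>i. Poly_Mapping.lookup p (Poly_Mapping.single i 1)) var) m
      = (\<Sum>i<n. Poly_Mapping.lookup p m * (if m = Poly_Mapping.single i 1 then 1 else 0))"
    unfolding comb_def lookup_sum
    by (intro sum.cong) (auto simp: lookup_const_poly_mult lookup_monom_poly)
  show "Poly_Mapping.lookup p m
      = Poly_Mapping.lookup (comb n (\<lambda>i. Poly_Mapping.lookup p (Poly_Mapping.single i 1)) var) m"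
  proof (cases "m \<in> Poly_Mapping.keys p")
    case False
    then show ?thesis unfolding l by (simp add: in_keys_iff)
  next
    case True
    then have "mono_degree m = Suc 0" "Poly_Mapping.keys m \<subseteq> {..<n}"
      using assms by (auto simp: forms_def polys_def)
    then obtain k m' where k: "k < n" "m = Poly_Mapping.single k 1 + m'" "mono_degree m' = 0"
      using monom_degree_Suc by metis
    then have m: "m = Poly_Mapping.single k 1" by simp
    have "(\<Sum>i<n. Poly_Mapping.lookup p m * (if m = Poly_Mapping.single i 1 then 1 else 0))
        = (\<Sum>i<n. if i = k then Poly_Mapping.lookup p m else 0)"
      by (intro sum.cong) (auto simp: m dest!: arg_cong[of _ _ Poly_Mapping.keys])
    then show ?thesis
      unfolding l using k(1) by simp
  qed
qed

text \<open>A descending chain of subspaces is stationary on a finite-dimensional one. In the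
  induction, the chain on the larger span is controlled by the chain on span B together with the
  indices at which it still meets the coset b + span B.\<close>

lemma chain_stabilizes:
  fixes J :: "nat \<Rightarrow> 'k::field mpoly set"
  assumes "finite B" and J: "\<And>i. mp.subspace (J i)" "\<And>i. J (Suc i) \<subseteq> J i"
  shows "\<exists>m. \<forall>i\<ge>m. J m \<inter> mp.span B \<subseteq> J i"
  using \<open>finite B\<close>
proof (induction B rule: finite_induct)
  case empty
  show ?case
    using mp.subspace_0[OF J(1)] by auto
next
  case (insert b B)
  have anti: "J j \<subseteq> J i" if "i \<le> j" for i j
    using that by (rule lift_Suc_antimono_le[of J, OF J(2)])
  obtain m1 where m1: "\<And>i. i \<ge> m1 \<Longrightarrow> J m1 \<inter> mp.span B \<subseteq> J i"
    using insert.IH by blast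
  define Q where "Q i \<longleftrightarrow> (\<exists>w\<in>mp.span B. b + w \<in> J i)" for i
  \<comment> \<open>If \<open>Q\<close> fails somewhere, such an index is taken, and the implication
    is vacuous.\<close>
  obtain m2 where m2: "\<And>i. Q m2 \<Longrightarrow> i \<ge> m2 \<Longrightarrow> Q i"
  proof (cases "\<forall>i. Q i")
    case True
    then show ?thesis using that by blast
  next
    case False
    then show ?thesis using that by blast
  qed
  define m where "m = max m1 m2"
  have "J m \<inter> mp.span (insert b B) \<subseteq> J i" if i: "i \<ge> m" for i
  proof
    fix v assume v: "v \<in> J m \<inter> mp.span (insert b B)"
    then obtain k where k: "v - const_poly k * b \<in> mp.span B"
      by (auto simp: mp.span_breakdown_eq)
    have low: "w \<in> J i" if "w \<in> J m" "w \<in> mp.span B" for w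
    proof -
      have "w \<in> J m1"
        using that(1) anti[of m1 m] by (auto simp: m_def)
      then show ?thesis
        using m1[of i] that(2) i by (auto simp: m_def)
    qed
    show "v \<in> J i"
    proof (cases "k = 0")
      case True
      then show ?thesis using low[of v] k v by simp
    next
      case False
      have "const_poly (inverse k) * v = b + const_poly (inverse k) * (v - const_poly k * b)"
        using False by (simp add: right_diff_distrib mult.assoc[symmetric] const_poly_mult[symmetric])
      moreover have "const_poly (inverse k) * v \<in> J m"
        using v mp.subspace_scale[OF J(1)] by blast
      ultimately have "Q m"
        unfolding Q_def using mp.span_scale[OF k] by metis
      then have "Q m2"
        unfolding Q_def using anti[of m2 m] by (auto simp: m_def)
      then have "Q i"
        using m2 i by (simp add: m_def)
      then obtain w where w: "w \<in> mp.span B" "b + w \<in> J i"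
        unfolding Q_def by blast
      \<comment> \<open>Subtracting an element of J_i with the same \<open>b\<close>-coefficient
        moves \<open>v\<close> into span B, where the induction hypothesis applies.\<close>
      have "v - const_poly k * (b + w) \<in> J m"
        using v w(2) anti[OF i] mp.subspace_diff[OF J(1)] mp.subspace_scale[OF J(1)] by blast
      moreover have "v - const_poly k * (b + w) \<in> mp.span B"
        using mp.span_diff[OF k mp.span_scale[OF w(1), of k]] by (simp add: algebra_simps)
      ultimately have "v - const_poly k * (b + w) \<in> J i"
        by (rule low)
      from mp.subspace_add[OF J(1) this mp.subspace_scale[OF J(1) w(2), of k]] show ?thesis
        by simp
    qed
  qed
  then show ?case by blast
qed

context graded_quotient
begin

text \<open>The quotient is spanned by the finitely many spanning forms of degree at most
  \<open>d\<close>, and ideals pull back to subspaces, so \<open>chain_stabilizes\<close>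
  applies.\<close>

lemma artinianI:
  assumes van: "forms n (Suc d) \<subseteq> I"
  shows "artinian_ring A"
  unfolding artinian_ring_def
proof (intro conjI allI impI A.is_cring)
  fix C :: "nat \<Rightarrow> 'k mpoly set set"
  assume C: "(\<forall>i. Ideal.ideal (C i) A) \<and> (\<forall>i. C (Suc i) \<subseteq> C i)"
  have Ci: "Ideal.ideal (C i) A" for i using C by blast
  define J where "J i = {p \<in> polys n. residue p \<in> C i}" for i
  have J: "mp.subspace (J i)" for i
  proof (rule mp.subspaceI)
    interpret Ci: Ideal.ideal "C i" A by (rule Ci)
    show "0 \<in> J i"
      using Ci.zero_closed by (simp add: J_def zero_A)
    show "p + q \<in> J i" if "p \<in> J i" "q \<in> J i" for p q
      using that Ci.a_closed[of "residue p" "residue q"] by (simp add: J_def residue_add polys_closed)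
    show "const_poly c * p \<in> J i" if "p \<in> J i" for c p
      using that Ci.I_l_closed[of "residue p" "residue (const_poly c)"]
      by (simp add: J_def residue_mult polys_closed)
  qed
  have Jmono: "J (Suc i) \<subseteq> J i" for i
    using C by (auto simp: J_def)
  have "\<exists>B :: 'k mpoly set. finite B \<and> forms n e \<subseteq> mp.span B" for e
    using forms_finitely_spanned[of n e] by metis
  then obtain B :: "nat \<Rightarrow> 'k mpoly set" where B: "\<And>e. finite (B e)" "\<And>e. forms n e \<subseteq> mp.span (B e)"
    by metis
  define B' where "B' = (\<Union>e<Suc d. B e)"
  have "finite B'"
    using B(1) by (simp add: B'_def)
  from chain_stabilizes[of B' J, OF this J Jmono]
  obtain m where m: "\<And>i. i \<ge> m \<Longrightarrow> J m \<inter> mp.span B' \<subseteq> J i" by blast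
  have "C i = C m" if i: "i \<ge> m" for i
  proof
    show "C i \<subseteq> C m"
      using lift_Suc_antimono_le[of C m i] C i by blast
    show "C m \<subseteq> C i"
    proof
      fix a assume a: "a \<in> C m"
      then have "a \<in> carrier A"
        using ideal.Icarr[OF Ci] by blast
      then obtain p where p: "p \<in> polys n" "a = residue p"
        by (auto simp: carrier_A)
      \<comment> \<open>Truncation at degree \<open>d\<close> does not change the residue class and
        leads into the finite-dimensional span.\<close>
      define q where "q = (\<Sum>e<Suc d. homogeneous_component e p)"
      have hc: "homogeneous_component e p \<in> forms n e" for e
        by (rule homogeneous_component_in_forms[OF p(1)])
      obtain D where D: "d < D" "p = (\<Sum>e<D. homogeneous_component e p)"
        using homogeneous_expansion by blast
      have "p - q = (\<Sum>e\<in>{Suc d..<D}. homogeneous_component e p)"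
      proof -
        have "q + (\<Sum>e\<in>{Suc d..<D}. homogeneous_component e p) = (\<Sum>e<D. homogeneous_component e p)"
          unfolding q_def lessThan_atLeast0 using D(1) by (intro sum.atLeastLessThan_concat) auto
        with D(2) show ?thesis by (metis add_diff_cancel_left')
      qed
      also have "\<dots> \<in> I"
        using forms_in_I_mono[OF van] hc by (intro mp.subspace_sum[OF subspace_I]) (auto simp: subset_iff)
      finally have pq: "p - q \<in> I" .
      have "q \<in> polys n"
        unfolding q_def using hc forms_in_polys by (intro sum_in_polys) blast
      moreover have "residue q = a"
        using pq p(2) by (simp add: residue_eq_iff[THEN iffD2])
      ultimately have "q \<in> J m"
        using a by (simp add: J_def)
      moreover have "q \<in> mp.span B'"
        unfolding q_def
      proof (rule mp.span_sum)
        fix e assume "e \<in> {..<Suc d}"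
        then have "mp.span (B e) \<subseteq> mp.span B'"
          by (intro mp.span_mono) (auto simp: B'_def)
        then show "homogeneous_component e p \<in> mp.span B'"
          using hc B(2) by blast
      qed
      ultimately have "q \<in> J i"
        using m[OF i] by blast
      then show "a \<in> C i"
        using \<open>residue q = a\<close> by (simp add: J_def)
    qed
  qed
  then show "\<exists>m. \<forall>i\<ge>m. C i = C m" by blast
qed

end

section \<open>Algebras with a single relation degree\<close>

text \<open>The ideal generated by \<open>W\<close> in degree \<open>d\<close> and by all forms of
  higher degree: the quotient agrees with the polynomial ring below \<open>d\<close>, is forms of
  degree \<open>d\<close> modulo \<open>W\<close> in degree \<open>d\<close>, and is zero
  above.\<close>

definition truncated_ideal :: "nat \<Rightarrow> nat \<Rightarrow> 'k::field mpoly set \<Rightarrow> 'k mpoly set" where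
  "truncated_ideal n d W =
     {p \<in> polys n. (\<forall>m\<in>Poly_Mapping.keys p. d \<le> mono_degree m) \<and> homogeneous_component d p \<in> W}"

locale truncated =
  fixes n d :: nat and W :: "'k::field mpoly set"
  assumes W: "mp.subspace W" "W \<subseteq> forms n d"
begin

abbreviation "T \<equiv> truncated_ideal n d W"

lemma homogeneous_component_const_mult:
  "homogeneous_component d (const_poly c * p) = const_poly c * homogeneous_component d p"
  by (rule poly_mapping_eqI) (simp add: lookup_homogeneous_component lookup_const_poly_mult)

lemma subspace_T: "mp.subspace T"
proof (rule mp.subspaceI)
  show "0 \<in> T"
  proof -
    have "homogeneous_component d 0 = (0 :: 'k mpoly)"
      by (rule poly_mapping_eqI) (simp add: lookup_homogeneous_component)
    then show ?thesis
      using mp.subspace_0[OF W(1)] by (simp add: truncated_ideal_def)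
  qed
next
  fix p q assume "p \<in> T" "q \<in> T"
  then show "p + q \<in> T"
    using Poly_Mapping.keys_add[of p q] mp.subspace_add[OF W(1)]
    unfolding truncated_ideal_def by (auto simp: polys_closed homogeneous_component_add)
next
  fix c p assume "p \<in> T"
  then show "const_poly c * p \<in> T"
    using keys_const_poly_mult[of c p] mp.subspace_scale[OF W(1)]
    unfolding truncated_ideal_def by (auto simp: polys_closed homogeneous_component_const_mult)
qed

text \<open>The constant term of \<open>p\<close> only scales \<open>q\<close>, and the rest of
  \<open>p\<close> raises the order beyond \<open>d\<close>, where \<open>W\<close> imposes no
  condition.\<close>

lemma T_mult:
  assumes p: "p \<in> polys n" and q: "q \<in> T"
  shows "p * q \<in> T"
proof -
  define c where "c = Poly_Mapping.lookup p 0"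
  define p' where "p' = p - const_poly c"
  have "m \<noteq> 0" if "m \<in> Poly_Mapping.keys p'" for m
    using that by (auto simp: p'_def c_def in_keys_iff lookup_minus const_poly_def)
  then have p': "1 \<le> mono_degree m" if "m \<in> Poly_Mapping.keys p'" for m
    using that by (metis One_nat_def Suc_leI mono_degree_eq_0_iff not_gr_zero)
  have p'p: "p' \<in> polys n"
    unfolding p'_def using p by (intro diff_in_polys) auto
  have deg: "Suc d \<le> mono_degree m" if h: "m \<in> Poly_Mapping.keys (p' * q)" for m
  proof -
    obtain a b where "m = a + b" "a \<in> Poly_Mapping.keys p'" "b \<in> Poly_Mapping.keys q"
      using h Poly_Mapping.keys_mult[of p' q] by blast
    then show ?thesis
      using p'[of a] q by (fastforce simp: truncated_ideal_def mono_degree_add)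
  qed
  have "homogeneous_component d (p' * q) = 0"
    by (rule poly_mapping_eqI) (use deg in \<open>force simp: lookup_homogeneous_component in_keys_iff\<close>)
  then have "p' * q \<in> T"
    using deg p'p q mp.subspace_0[OF W(1)] by (auto simp: truncated_ideal_def polys_closed dest: Suc_leD)
  from mp.subspace_add[OF subspace_T this mp.subspace_scale[OF subspace_T q, of c]]
  have "p' * q + const_poly c * q \<in> T" .
  then show ?thesis
    by (simp add: p'_def algebra_simps)
qed

lemma homogeneous_ideal_T: "homogeneous_ideal n T"
  unfolding homogeneous_ideal_def
proof
  interpret R: cring "poly_ring n :: 'k mpoly ring"
    by (rule cring_poly_ring)
  have sub: "T \<subseteq> polys n"
    by (auto simp: truncated_ideal_def)
  show "ideal T (poly_ring n)"
  proof (rule idealI)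
    show "ring (poly_ring n :: 'k mpoly ring)" by (rule R.ring_axioms)
    show "subgroup T (add_monoid (poly_ring n))"
    proof (rule R.add.subgroupI)
      show "T \<subseteq> carrier (poly_ring n)"
        using sub by (simp add: poly_ring_def)
      show "T \<noteq> {}"
        using mp.subspace_0[OF subspace_T] by blast
      show "\<ominus>\<^bsub>poly_ring n\<^esub> p \<in> T" if "p \<in> T" for p
      proof -
        have "\<ominus>\<^bsub>poly_ring n\<^esub> p = - p"
          using that sub by (intro R.minus_equality) (auto simp: poly_ring_def)
        then show ?thesis
          using mp.subspace_neg[OF subspace_T that] by simp
      qed
      show "p \<oplus>\<^bsub>poly_ring n\<^esub> q \<in> T" if "p \<in> T" "q \<in> T" for p q
        using mp.subspace_add[OF subspace_T that] by (simp add: poly_ring_def)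
    qed
    show "x \<otimes>\<^bsub>poly_ring n\<^esub> p \<in> T" "p \<otimes>\<^bsub>poly_ring n\<^esub> x \<in> T" if "p \<in> T" "x \<in> carrier (poly_ring n)" for p x
      using T_mult[of x p] that by (simp_all add: poly_ring_def mult.commute)
  qed
  show "\<forall>p\<in>T. \<forall>e. homogeneous_component e p \<in> T"
  proof (intro ballI allI)
    fix p e assume p: "p \<in> T"
    then have f: "homogeneous_component e p \<in> forms n e"
      using sub homogeneous_component_in_forms by blast
    have "homogeneous_component d (homogeneous_component e p) \<in> W"
      using p mp.subspace_0[OF W(1)] unfolding homogeneous_component_form[OF f]
      by (auto simp: truncated_ideal_def)
    moreover have "Poly_Mapping.keys (homogeneous_component e p) \<subseteq> Poly_Mapping.keys p"
      by (auto simp: in_keys_iff lookup_homogeneous_component split: if_splits)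
    ultimately show "homogeneous_component e p \<in> T"
      using p forms_in_polys[OF f] unfolding truncated_ideal_def by blast
  qed
qed

sublocale Q: graded_quotient n T
  by unfold_locales (rule homogeneous_ideal_T)

lemma form_in_T_iff:
  assumes "p \<in> forms n e"
  shows "p \<in> T \<longleftrightarrow> (if e < d then p = 0 else if e = d then p \<in> W else True)"
proof -
  have h: "homogeneous_component d p = (if d = e then p else 0)"
    by (rule homogeneous_component_form[OF assms])
  have z: "p = 0" if "Poly_Mapping.keys p = {}"
    using that by (intro poly_mapping_eqI) (auto simp: in_keys_iff)
  show ?thesis
    using assms mp.subspace_0[OF W(1)] z
    by (auto simp: truncated_ideal_def forms_def h)
qed

lemma T_top: "forms n (Suc d) \<subseteq> T"
  using form_in_T_iff[of _ "Suc d"] by auto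

lemma codimension_T:
  assumes "2 \<le> d"
  shows "has_codimension n T n"
proof (rule Q.codimensionI[of n var])
  show "\<And>i. i < n \<Longrightarrow> (var i :: 'k mpoly) \<in> forms n 1"
    by (rule var_in_forms)
  show "Q.independent_mod n var"
    unfolding Q.independent_mod_def
  proof (intro allI impI)
    fix c :: "nat \<Rightarrow> 'k" and i assume "comb n c var \<in> T" and i: "i < n"
    moreover have "comb n c var \<in> forms n 1"
      by (rule comb_in_subspace[OF subspace_forms var_in_forms])
    ultimately have "comb n c var = (0 :: 'k mpoly)"
      using form_in_T_iff[of "comb n c var" 1] assms by simp
    then have "0 = Poly_Mapping.lookup (comb n c var) (Poly_Mapping.single i 1)"
      by simp
    also have "\<dots> = (\<Sum>j<n. if j = i then c j else 0)"
      unfolding comb_def lookup_sum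
      by (intro sum.cong) (auto simp: lookup_const_poly_mult lookup_monom_poly
          dest!: arg_cong[of _ _ Poly_Mapping.keys])
    also have "\<dots> = c i"
      using i by simp
    finally show "c i = 0" by simp
  qed
  show "\<exists>c. p - comb n c var \<in> T" if "p \<in> forms n 1" for p
    using form_1_comb[OF that] Q.I_zero by (metis diff_self)
qed

text \<open>In degrees below d - 1 products with a variable are computed in the polynomial ring,
  where they do not vanish; only degree d - 1 needs the hypothesis on \<open>W\<close>.\<close>

lemma level_T:
  assumes "0 < n" "W \<noteq> forms n d"
    and nondeg: "\<And>p e. d = Suc e \<Longrightarrow> p \<in> forms n e \<Longrightarrow> (\<And>i. i < n \<Longrightarrow> var i * p \<in> W) \<Longrightarrow> p = 0"
  shows "\<exists>t. level_of_type n T t" "socle_degree n T = d"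
proof -
  have ntop: "\<not> forms n d \<subseteq> T"
  proof
    assume "forms n d \<subseteq> T"
    then have "forms n d \<subseteq> W"
      using form_in_T_iff[of _ d] by auto
    with W(2) assms(2) show False by blast
  qed
  show "socle_degree n T = d"
    by (rule Q.socle_degree_eqI[OF ntop T_top])
  show "\<exists>t. level_of_type n T t"
  proof (rule Q.levelI[OF ntop T_top])
    fix p e assume e: "e < d" and p: "p \<in> forms n e" and vp: "\<And>i. i < n \<Longrightarrow> var i * p \<in> T"
    have f: "var i * p \<in> forms n (Suc e)" if "i < n" for i
      using forms_mult[OF var_in_forms[OF that] p] by simp
    have "p = 0"
    proof (cases "Suc e = d")
      case True
      then show ?thesis
        using nondeg[of e p] p vp f form_in_T_iff[OF f] by auto
    next
      case False
      then have "var 0 * p = 0"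
        using form_in_T_iff[OF f[OF assms(1)]] vp[OF assms(1)] e by simp
      then show ?thesis
        by (rule var_mult_eq_0)
    qed
    then show "p \<in> T" by simp
  qed
qed

lemma not_weak_lefschetz_T:
  assumes "d = Suc e"
    and "\<And>L. L \<in> forms n 1 \<Longrightarrow> \<exists>p\<in>forms n e. p \<noteq> 0 \<and> L * p \<in> W"
    and "\<And>L. L \<in> forms n 1 \<Longrightarrow> \<exists>q\<in>forms n d. \<forall>p\<in>forms n e. q - L * p \<notin> W"
  shows "\<not> weak_lefschetz n T"
proof (rule Q.not_weak_lefschetzI[of e])
  fix L :: "'k mpoly" assume L: "L \<in> forms n 1"
  have Lp: "L * p \<in> forms n d" if "p \<in> forms n e" for p
    using forms_mult[OF L that] assms(1) by simp
  obtain p where p: "p \<in> forms n e" "p \<noteq> 0" "L * p \<in> W"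
    using assms(2)[OF L] by blast
  have "L * p \<in> T" "p \<notin> T"
    using form_in_T_iff[OF Lp[OF p(1)]] form_in_T_iff[OF p(1)] p assms(1) by simp_all
  moreover obtain q where q: "q \<in> forms n d" "\<forall>p\<in>forms n e. q - L * p \<notin> W"
    using assms(3)[OF L] by blast
  have "q - L * p \<notin> T" if "p \<in> forms n e" for p
    using form_in_T_iff[OF mp.subspace_diff[OF subspace_forms q(1) Lp[OF that]]] q(2) that by simp
  ultimately show "(\<exists>p\<in>forms n e. L * p \<in> T \<and> p \<notin> T) \<and>
      (\<exists>q\<in>forms n (Suc e). \<forall>p\<in>forms n e. q - L * p \<notin> T)"
    using p(1) q(1) assms(1) by blast
qed

lemma not_all_level_weak_lefschetz:
  assumes "0 < n" "d = Suc e" "0 < e"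
    and "\<And>p. p \<in> forms n e \<Longrightarrow> (\<And>i. i < n \<Longrightarrow> var i * p \<in> W) \<Longrightarrow> p = 0"
    and "\<And>L. L \<in> forms n 1 \<Longrightarrow> \<exists>p\<in>forms n e. p \<noteq> 0 \<and> L * p \<in> W"
    and "\<And>L. L \<in> forms n 1 \<Longrightarrow> \<exists>q\<in>forms n d. \<forall>p\<in>forms n e. q - L * p \<notin> W"
    and "all_level_weak_lefschetz TYPE('k) n k"
  shows "k \<le> e"
proof (rule ccontr)
  assume k: "\<not> k \<le> e"
  \<comment> \<open>The failure of surjectivity for L = 0 already says this.\<close>
  have "W \<noteq> forms n d"
  proof
    assume W': "W = forms n d"
    obtain q where q: "q \<in> forms n d" "\<forall>p\<in>forms n e. q - 0 * p \<notin> W"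
      using assms(6)[OF mp.subspace_0[OF subspace_forms]] by blast
    with W' mp.subspace_0[OF subspace_forms, of n e] show False by auto
  qed
  note level = level_T[OF assms(1) this]
  have "\<exists>t. level_of_type n T t" "socle_degree n T = d"
    using level assms(2,4) by blast+
  then have "weak_lefschetz n T"
    using assms(7) homogeneous_ideal_T Q.artinianI[OF T_top] codimension_T assms(2,3) k
    unfolding all_level_weak_lefschetz_def by simp
  then show False
    using not_weak_lefschetz_T[OF assms(2,5,6)] by blast
qed

end

section \<open>A level algebra of codimension three and socle degree three\<close>

definition expo :: "nat \<Rightarrow> nat \<Rightarrow> nat \<Rightarrow> nat \<Rightarrow>\<^sub>0 nat" where
  "expo a b c = Poly_Mapping.single 0 a + Poly_Mapping.single 1 b + Poly_Mapping.single 2 c"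

lemma lookup_expo: "Poly_Mapping.lookup (expo a b c) i = (if i = 0 then a else if i = 1 then b else if i = 2 then c else 0)"
  by (simp add: expo_def lookup_add lookup_single when_def)

lemma expo_eq_iff [simp]: "expo a b c = expo a' b' c' \<longleftrightarrow> a = a' \<and> b = b' \<and> c = c'"
proof
  assume eq: "expo a b c = expo a' b' c'"
  show "a = a' \<and> b = b' \<and> c = c'"
    using arg_cong[OF eq, of "\<lambda>m. Poly_Mapping.lookup m 0"] arg_cong[OF eq, of "\<lambda>m. Poly_Mapping.lookup m 1"]
      arg_cong[OF eq, of "\<lambda>m. Poly_Mapping.lookup m 2"] by (simp add: lookup_expo)
qed simp

lemma expo_add [simp]: "expo a b c + expo a' b' c' = expo (a + a') (b + b') (c + c')"
  by (simp add: expo_def single_add algebra_simps)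

lemma mono_degree_expo [simp]: "mono_degree (expo a b c) = a + b + c"
  by (simp add: expo_def mono_degree_add)

lemma keys_expo: "Poly_Mapping.keys (expo a b c) \<subseteq> {..<3}"
  by (auto simp: in_keys_iff lookup_expo split: if_splits)

lemma expo_exhaust:
  assumes "Poly_Mapping.keys m \<subseteq> {..<3}"
  obtains a b c where "m = expo a b c"
proof -
  have "Poly_Mapping.lookup m i = 0" if "i \<noteq> 0" "i \<noteq> 1" "i \<noteq> 2" for i
  proof -
    have "\<not> i < 3" using that by linarith
    then have "i \<notin> Poly_Mapping.keys m" using assms by auto
    then show ?thesis by (simp add: in_keys_iff)
  qed
  then have "m = expo (Poly_Mapping.lookup m 0) (Poly_Mapping.lookup m 1) (Poly_Mapping.lookup m 2)"
    by (intro poly_mapping_eqI) (simp add: lookup_expo)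
  then show ?thesis using that by blast
qed

lemma var_expo: "var 0 = monom_poly (expo 1 0 0)" "var 1 = monom_poly (expo 0 1 0)" "var 2 = monom_poly (expo 0 0 1)"
  by (simp_all add: expo_def)

definition cubic_relations :: "'k::field mpoly set" where
  "cubic_relations = mp.span (monom_poly ` {expo 3 0 0, expo 0 3 0, expo 0 0 3, expo 1 1 1})"

lemma lookup_cubic_relations:
  assumes "p \<in> cubic_relations" "m \<notin> {expo 3 0 0, expo 0 3 0, expo 0 0 3, expo 1 1 1}"
  shows "Poly_Mapping.lookup p m = 0"
proof -
  have "mp.subspace {p :: 'a mpoly. Poly_Mapping.lookup p m = 0}"
    by (simp add: mp.subspace_def lookup_add lookup_const_poly_mult)
  moreover have "monom_poly ` {expo 3 0 0, expo 0 3 0, expo 0 0 3, expo 1 1 1}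
      \<subseteq> {p :: 'a mpoly. Poly_Mapping.lookup p m = 0}"
    using assms(2) by (auto simp: lookup_monom_poly)
  ultimately have "cubic_relations \<subseteq> {p :: 'a mpoly. Poly_Mapping.lookup p m = 0}"
    unfolding cubic_relations_def by (intro mp.span_minimal)
  with assms(1) show ?thesis by blast
qed

text \<open>The identity (u + v + w) (u^2 + v^2 + w^2 - u v - u w - v w) = u^3 + v^3 + w^3 - 3 u v w
  at u = a x, v = b y, w = c z; its right side involves only relation monomials. The 3 is written
  \<open>1 + 1 + 1\<close> so that \<open>const_poly\<close> distributes over it.\<close>

lemma cubic_factorization:
  fixes x y z a b c :: "'a::comm_ring_1"
  shows "(a * x + b * y + c * z)
      * (a * a * (x * x) + b * b * (y * y) + c * c * (z * z) - a * b * (x * y) - a * c * (x * z) - b * c * (y * z))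
    = a * a * a * (x * x * x) + b * b * b * (y * y * y) + c * c * c * (z * z * z) - (1 + 1 + 1) * (a * b * c) * (x * y * z)"
proof -
  have 3: "(u + v + w) * (u * u + v * v + w * w - u * v - u * w - v * w)
      = u * u * u + v * v * v + w * w * w - (1 + 1 + 1) * (u * v * w)" for u v w :: 'a
    by (simp add: algebra_simps)
  have 4: "p * q * (r * s) = (p * r) * (q * s)" "p * q * t * (r * s * e) = (p * r) * (q * s) * (t * e)"
    for p q r s t e :: 'a
    by (simp_all only: ac_simps)
  have "(1 + 1 + 1) * (a * b * c) * (x * y * z) = (1 + 1 + 1) * ((a * x) * (b * y) * (c * z))"
    by (subst mult.assoc, subst 4(2), rule refl)
  then show ?thesis
    using 3[of "a * x" "b * y" "c * z"] by (simp only: 4(1)[of a _ x] 4(1)[of b _ y] 4(1)[of c _ z] 4(2)[of a a _ x x] 4(2)[of b b _ y y] 4(2)[of c c _ z z])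
qed

lemma truncated_cubic: "truncated 3 3 (cubic_relations :: 'k::field mpoly set)"
proof
  show "mp.subspace (cubic_relations :: 'k mpoly set)"
    by (simp add: cubic_relations_def)
  show "cubic_relations \<subseteq> (forms 3 3 :: 'k mpoly set)"
    unfolding cubic_relations_def
    by (intro mp.span_minimal subspace_forms) (auto intro!: monom_poly_in_forms keys_expo)
qed

lemma form_1_expo:
  fixes L :: "'k::field mpoly"
  assumes "L \<in> forms 3 1"
  obtains a b c where "L = const_poly a * monom_poly (expo 1 0 0) + const_poly b * monom_poly (expo 0 1 0)
    + const_poly c * monom_poly (expo 0 0 1)"
  using form_1_comb[OF assms] that by (simp add: numeral_3_eq_3 var_expo[symmetric, unfolded One_nat_def numeral_2_eq_2])

lemma lookup_linear_mult_expo: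
  fixes p :: "'k::field mpoly"
  defines "l i j k \<equiv> Poly_Mapping.lookup p (expo i j k)"
  assumes "L = const_poly a * monom_poly (expo 1 0 0) + const_poly b * monom_poly (expo 0 1 0)
    + const_poly c * monom_poly (expo 0 0 1)"
  shows "Poly_Mapping.lookup (L * p) (expo i j k) =
    (case i of 0 \<Rightarrow> 0 | Suc i' \<Rightarrow> a * l i' j k) + (case j of 0 \<Rightarrow> 0 | Suc j' \<Rightarrow> b * l i j' k)
      + (case k of 0 \<Rightarrow> 0 | Suc k' \<Rightarrow> c * l i j k')"
proof -
  have ne: "expo 0 j k \<noteq> expo 1 0 0 + m'" "expo i 0 k \<noteq> expo 0 1 0 + m'" "expo i j 0 \<noteq> expo 0 0 1 + m'" for i j k m'
  proof -
    show "expo 0 j k \<noteq> expo 1 0 0 + m'"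
      using lookup_expo[of 0 j k 0] by (metis One_nat_def add_eq_0_iff_both_eq_0 lookup_add lookup_expo zero_neq_one)
    show "expo i 0 k \<noteq> expo 0 1 0 + m'"
      by (metis One_nat_def add_eq_0_iff_both_eq_0 lookup_add lookup_expo zero_neq_one)
    show "expo i j 0 \<noteq> expo 0 0 1 + m'"
      by (metis add_eq_0_iff_both_eq_0 lookup_add lookup_expo zero_neq_one zero_neq_numeral one_neq_zero num.distinct(1) numeral_eq_one_iff)
  qed
  have "Poly_Mapping.lookup (monom_poly (expo 1 0 0) * p) (expo i j k) = (case i of 0 \<Rightarrow> 0 | Suc i' \<Rightarrow> l i' j k)"
    using lookup_monom_poly_mult[of "expo 1 0 0" p "expo (i - 1) j k"] lookup_monom_poly_mult_eq_0[OF ne(1)]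
    by (cases i) (simp_all add: l_def)
  moreover have "Poly_Mapping.lookup (monom_poly (expo 0 1 0) * p) (expo i j k) = (case j of 0 \<Rightarrow> 0 | Suc j' \<Rightarrow> l i j' k)"
    using lookup_monom_poly_mult[of "expo 0 1 0" p "expo i (j - 1) k"] lookup_monom_poly_mult_eq_0[OF ne(2)]
    by (cases j) (simp_all add: l_def)
  moreover have "Poly_Mapping.lookup (monom_poly (expo 0 0 1) * p) (expo i j k) = (case k of 0 \<Rightarrow> 0 | Suc k' \<Rightarrow> l i j k')"
    using lookup_monom_poly_mult[of "expo 0 0 1" p "expo i j (k - 1)"] lookup_monom_poly_mult_eq_0[OF ne(3)]
    by (cases k) (simp_all add: l_def)
  ultimately show ?thesis
    unfolding assms(2) distrib_right mult.assoc lookup_add lookup_const_poly_mult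
    by (simp split: nat.split)
qed

text \<open>The relations are spanned by monomials, so coefficients can be tested one at a time:
  each quadratic monomial has a multiple by a variable, such as x^2 y, that is not a
  relation.\<close>

lemma cubic_nondegenerate:
  fixes p :: "'k::field mpoly"
  assumes p: "p \<in> forms 3 2" and vp: "\<And>i. i < 3 \<Longrightarrow> var i * p \<in> cubic_relations"
  shows "p = 0"
proof (rule poly_mapping_eqI, simp, rule ccontr)
  fix m assume m: "Poly_Mapping.lookup p m \<noteq> 0"
  then have "Poly_Mapping.keys m \<subseteq> {..<3}" "mono_degree m = 2"
    using p by (auto simp: forms_def polys_def in_keys_iff)
  then obtain a b c where abc: "m = expo a b c" "a + b + c = 2"
    using expo_exhaust by (metis mono_degree_expo)
  have nz: "e + m \<in> {expo 3 0 0, expo 0 3 0, expo 0 0 3, expo 1 1 1}"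
    if "e \<in> {expo 1 0 0, expo 0 1 0, expo 0 0 1}" for e
  proof (rule ccontr)
    assume "e + m \<notin> {expo 3 0 0, expo 0 3 0, expo 0 0 3, expo 1 1 1}"
    moreover have "monom_poly e * p \<in> cubic_relations"
      using that vp[of 0] vp[of 1] vp[of 2] unfolding var_expo by auto
    ultimately have "Poly_Mapping.lookup (monom_poly e * p) (e + m) = 0"
      using lookup_cubic_relations by blast
    then show False
      using m by (simp add: lookup_monom_poly_mult)
  qed
  show False
    using nz[of "expo 1 0 0"] nz[of "expo 0 1 0"] nz[of "expo 0 0 1"] abc by auto
qed

lemma cubic_not_injective:
  fixes L :: "'k::field mpoly"
  assumes L: "L \<in> forms 3 1"
  shows "\<exists>p\<in>forms 3 2. p \<noteq> 0 \<and> L * p \<in> cubic_relations"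
proof -
  let ?x = "monom_poly (expo 1 0 0) :: 'k mpoly" and ?y = "monom_poly (expo 0 1 0) :: 'k mpoly"
    and ?z = "monom_poly (expo 0 0 1) :: 'k mpoly"
  obtain a b c where Leq: "L = const_poly a * ?x + const_poly b * ?y + const_poly c * ?z"
    by (rule form_1_expo[OF L])
  have xx: "?x * ?x = monom_poly (expo 2 0 0)" "?y * ?y = monom_poly (expo 0 2 0)" "?z * ?z = monom_poly (expo 0 0 2)"
    "?x * ?y = monom_poly (expo 1 1 0)" "?x * ?z = monom_poly (expo 1 0 1)" "?y * ?z = monom_poly (expo 0 1 1)"
    by (simp_all add: monom_poly_add[symmetric] numeral_2_eq_2)
  have mf: "monom_poly (expo i j k) \<in> (forms 3 2 :: 'k mpoly set)" if "i + j + k = 2" for i j k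
    using that by (intro monom_poly_in_forms keys_expo) simp
  show ?thesis
  \<comment> \<open>For L = 0 the cofactor \<open>q\<close> below would vanish too, so another
    kernel element is needed.\<close>
  proof (cases "a = 0 \<and> b = 0 \<and> c = 0")
    case True
    then have "L * (?x * ?x) \<in> cubic_relations"
      using mp.subspace_0[OF truncated.W(1)[OF truncated_cubic]] by (simp add: Leq)
    moreover have "?x * ?x \<noteq> 0"
    proof
      assume "?x * ?x = 0"
      then have "Poly_Mapping.lookup (monom_poly (expo 2 0 0) :: 'k mpoly) (expo 2 0 0) = 0"
        unfolding xx by simp
      then show False by (simp add: lookup_monom_poly)
    qed
    ultimately show ?thesis
      using mf[of 2 0 0] unfolding xx by (intro bexI[of _ "monom_poly (expo 2 0 0)"]) auto
  next
    case False
    define q where "q = const_poly (a * a) * (?x * ?x) + const_poly (b * b) * (?y * ?y) + const_poly (c * c) * (?z * ?z)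
      - const_poly (a * b) * (?x * ?y) - const_poly (a * c) * (?x * ?z) - const_poly (b * c) * (?y * ?z)"
    have "q \<in> forms 3 2"
      unfolding q_def xx
      by (intro mp.subspace_diff[OF subspace_forms] mp.subspace_add[OF subspace_forms]
          mp.subspace_scale[OF subspace_forms] mf) simp_all
    moreover have "q \<noteq> 0"
    proof
      \<comment> \<open>The coefficients of the squares are a^2, b^2, c^2, not all zero.\<close>
      assume "q = 0"
      then have "Poly_Mapping.lookup q m = 0" for m by simp
      from this[of "expo 2 0 0"] this[of "expo 0 2 0"] this[of "expo 0 0 2"] show False
        using False unfolding q_def xx
        by (simp add: lookup_add lookup_minus lookup_const_poly_mult lookup_monom_poly)
    qed
    moreover have "L * q \<in> cubic_relations"
    proof -
      have "L * q = const_poly (a * a * a) * (?x * ?x * ?x) + const_poly (b * b * b) * (?y * ?y * ?y)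
          + const_poly (c * c * c) * (?z * ?z * ?z) - const_poly ((1 + 1 + 1) * (a * b * c)) * (?x * ?y * ?z)"
        unfolding Leq q_def const_poly_mult const_poly_add const_poly_1 by (rule cubic_factorization)
      also have "?x * ?x * ?x = monom_poly (expo 3 0 0)"
        by (simp add: monom_poly_add[symmetric] numeral_3_eq_3)
      also have "?y * ?y * ?y = monom_poly (expo 0 3 0)"
        by (simp add: monom_poly_add[symmetric] numeral_3_eq_3)
      also have "?z * ?z * ?z = monom_poly (expo 0 0 3)"
        by (simp add: monom_poly_add[symmetric] numeral_3_eq_3)
      also have "?x * ?y * ?z = monom_poly (expo 1 1 1)"
        by (simp add: monom_poly_add[symmetric])
      also have "const_poly (a * a * a) * monom_poly (expo 3 0 0) + const_poly (b * b * b) * monom_poly (expo 0 3 0)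
          + const_poly (c * c * c) * monom_poly (expo 0 0 3)
          - const_poly ((1 + 1 + 1) * (a * b * c)) * monom_poly (expo 1 1 1) \<in> cubic_relations"
        unfolding cubic_relations_def
        by (intro mp.span_diff mp.span_add mp.span_scale mp.span_base) auto
      finally show ?thesis .
    qed
    ultimately show ?thesis by blast
  qed
qed

lemma cubic_not_surjective:
  fixes L :: "'k::field mpoly"
  assumes L: "L \<in> forms 3 1"
  shows "\<exists>q\<in>forms 3 3. \<forall>p\<in>forms 3 2. q - L * p \<notin> cubic_relations"
proof (rule ccontr)
  assume neg: "\<not> ?thesis"
  obtain a b c where Leq: "L = const_poly a * monom_poly (expo 1 0 0) + const_poly b * monom_poly (expo 0 1 0)
      + const_poly c * monom_poly (expo 0 0 1)"
    by (rule form_1_expo[OF L])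
  note lookup_Lp = lookup_linear_mult_expo[OF Leq]
  \<comment> \<open>Surjectivity in coordinates: the coefficients away from the four relation
    monomials can be prescribed to be those of any single cubic monomial.\<close>
  have sol: "\<exists>p. \<forall>m. m \<notin> {expo 3 0 0, expo 0 3 0, expo 0 0 3, expo 1 1 1} \<longrightarrow>
      Poly_Mapping.lookup (L * p) m = (if m = expo i j k then 1 else 0)" if "i + j + k = 3" for i j k
  proof -
    have "monom_poly (expo i j k) \<in> (forms 3 3 :: 'k mpoly set)"
      using that by (intro monom_poly_in_forms keys_expo) simp
    then obtain p where "monom_poly (expo i j k) - L * p \<in> cubic_relations"
      using neg by blast
    then have "Poly_Mapping.lookup (monom_poly (expo i j k) - L * p) m = 0"
      if "m \<notin> {expo 3 0 0, expo 0 3 0, expo 0 0 3, expo 1 1 1}" for m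
      using lookup_cubic_relations that by blast
    then show ?thesis
      unfolding lookup_minus lookup_monom_poly right_minus_eq by metis
  qed
  \<comment> \<open>Generates the functionals on \<open>A_3 / L A_2\<close> for general \<open>L\<close>; it is zero if two of \<open>a, b, c\<close> vanish,
    whence the case distinction at the end.\<close>
  define g where "g q = b * c * c * Poly_Mapping.lookup q (expo 2 1 0) - b * b * c * Poly_Mapping.lookup q (expo 2 0 1)
      - a * c * c * Poly_Mapping.lookup q (expo 1 2 0) + a * a * c * Poly_Mapping.lookup q (expo 0 2 1)
      + a * b * b * Poly_Mapping.lookup q (expo 1 0 2) - a * a * b * Poly_Mapping.lookup q (expo 0 1 2)" for q
  have g0: "g (L * p) = 0" for p
    unfolding g_def lookup_Lp by (simp add: numeral_2_eq_2 algebra_simps)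
  \<comment> \<open>\<open>g\<close> vanishes on multiples of \<open>L\<close>, but its coefficients
    at x^2 y, x y^2 and x z^2 are b c^2, a c^2 and a b^2 up to sign.\<close>
  obtain p where p: "\<And>m. m \<notin> {expo 3 0 0, expo 0 3 0, expo 0 0 3, expo 1 1 1} \<Longrightarrow>
      Poly_Mapping.lookup (L * p) m = (if m = expo 2 1 0 then 1 else 0)"
    using sol[of 2 1 0] by auto
  have "b * c = 0"
    using g0[of p] by (simp add: g_def p)
  obtain p where p: "\<And>m. m \<notin> {expo 3 0 0, expo 0 3 0, expo 0 0 3, expo 1 1 1} \<Longrightarrow>
      Poly_Mapping.lookup (L * p) m = (if m = expo 1 2 0 then 1 else 0)"
    using sol[of 1 2 0] by auto
  have "a * c = 0"
    using g0[of p] by (simp add: g_def p)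
  obtain p where p: "\<And>m. m \<notin> {expo 3 0 0, expo 0 3 0, expo 0 0 3, expo 1 1 1} \<Longrightarrow>
      Poly_Mapping.lookup (L * p) m = (if m = expo 1 0 2 then 1 else 0)"
    using sol[of 1 0 2] by auto
  have "a * b = 0"
    using g0[of p] by (simp add: g_def p)
  \<comment> \<open>Now \<open>L\<close> is a multiple of one variable, and a monomial in the other
    two cannot be attained.\<close>
  consider "b = 0" "c = 0" | "a = 0" "c = 0" | "a = 0" "b = 0"
    using \<open>b * c = 0\<close> \<open>a * c = 0\<close> \<open>a * b = 0\<close> by auto
  then show False
  proof cases
    case 1
    obtain p where p: "\<And>m. m \<notin> {expo 3 0 0, expo 0 3 0, expo 0 0 3, expo 1 1 1} \<Longrightarrow>
        Poly_Mapping.lookup (L * p) m = (if m = expo 0 2 1 then 1 else 0)"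
      using sol[of 0 2 1] by auto
    show False
      using p[of "expo 0 2 1"] unfolding lookup_Lp by (simp add: 1 numeral_2_eq_2)
  next
    case 2
    obtain p where p: "\<And>m. m \<notin> {expo 3 0 0, expo 0 3 0, expo 0 0 3, expo 1 1 1} \<Longrightarrow>
        Poly_Mapping.lookup (L * p) m = (if m = expo 2 0 1 then 1 else 0)"
      using sol[of 2 0 1] by auto
    show False
      using p[of "expo 2 0 1"] unfolding lookup_Lp by (simp add: 2 numeral_2_eq_2)
  next
    case 3
    obtain p where p: "\<And>m. m \<notin> {expo 3 0 0, expo 0 3 0, expo 0 0 3, expo 1 1 1} \<Longrightarrow>
        Poly_Mapping.lookup (L * p) m = (if m = expo 2 1 0 then 1 else 0)"
      using sol[of 2 1 0] by auto
    show False
      using p[of "expo 2 1 0"] unfolding lookup_Lp by (simp add: 3 numeral_2_eq_2)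
  qed
qed

lemma codim_3_bound:
  assumes "all_level_weak_lefschetz TYPE('k::field) 3 e"
  shows "e \<le> 2"
  by (rule truncated.not_all_level_weak_lefschetz[OF truncated_cubic _ _ _ cubic_nondegenerate
        cubic_not_injective cubic_not_surjective assms]) simp_all

section \<open>Level algebras of codimension at least four and socle degree two\<close>

definition pair_expo :: "nat \<Rightarrow> nat \<Rightarrow> nat \<Rightarrow>\<^sub>0 nat" where
  "pair_expo i j = Poly_Mapping.single i 1 + Poly_Mapping.single j 1"

lemma pair_expo_commute: "pair_expo i j = pair_expo j i"
  by (simp add: pair_expo_def add.commute)

text \<open>Given by equations rather than generators: the equations are the coordinates of A_2. The
  last one identifies x_0 x_2 with x_1 x_3.\<close>

definition quadric_relations :: "nat \<Rightarrow> 'k::field mpoly set" where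
  "quadric_relations r = {q \<in> forms r 2.
     (\<forall>i<r. \<forall>j<r. i \<notin> {2, 3} \<longrightarrow> j \<notin> {2, 3} \<longrightarrow> Poly_Mapping.lookup q (pair_expo i j) = 0) \<and>
     Poly_Mapping.lookup q (pair_expo 0 2) + Poly_Mapping.lookup q (pair_expo 1 3) = 0}"

lemma lookup_var_mult_pair:
  fixes p :: "'k::field mpoly"
  shows "Poly_Mapping.lookup (var k * p) (pair_expo i j) =
    (if k = i then Poly_Mapping.lookup p (Poly_Mapping.single j 1)
     else if k = j then Poly_Mapping.lookup p (Poly_Mapping.single i 1) else 0)"
proof -
  have 1: "Poly_Mapping.lookup (var i * p) (pair_expo i j) = Poly_Mapping.lookup p (Poly_Mapping.single j 1)" for i j
    unfolding pair_expo_def by (rule lookup_monom_poly_mult)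
  have "Poly_Mapping.lookup (var k * p) (pair_expo i j) = 0" if "k \<noteq> i" "k \<noteq> j"
  proof (rule lookup_monom_poly_mult_eq_0)
    fix m' show "pair_expo i j \<noteq> Poly_Mapping.single k 1 + m'"
    proof
      assume eq: "pair_expo i j = Poly_Mapping.single k 1 + m'"
      have "Poly_Mapping.lookup (pair_expo i j) k = 0"
        using that by (simp add: pair_expo_def lookup_add lookup_single)
      moreover have "Poly_Mapping.lookup (Poly_Mapping.single k 1 + m') k = 1 + Poly_Mapping.lookup m' k"
        by (simp add: lookup_add)
      ultimately show False
        unfolding eq by linarith
    qed
  qed
  then show ?thesis
    using 1[of i j] 1[of j i, unfolded pair_expo_commute[of j i]] by (cases "k = i"; cases "k = j") simp_all
qed

lemma truncated_quadric: "truncated r 2 (quadric_relations r :: 'k::field mpoly set)"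
proof
  show "mp.subspace (quadric_relations r :: 'k mpoly set)"
  proof (rule mp.subspaceI)
    show "0 \<in> (quadric_relations r :: 'k mpoly set)"
      using mp.subspace_0[OF subspace_forms] by (simp add: quadric_relations_def)
  next
    fix p q :: "'k mpoly" assume pq: "p \<in> quadric_relations r" "q \<in> quadric_relations r"
    then have "Poly_Mapping.lookup p (pair_expo 0 2) + Poly_Mapping.lookup q (pair_expo 0 2)
        + (Poly_Mapping.lookup p (pair_expo 1 3) + Poly_Mapping.lookup q (pair_expo 1 3)) =
        (Poly_Mapping.lookup p (pair_expo 0 2) + Poly_Mapping.lookup p (pair_expo 1 3))
        + (Poly_Mapping.lookup q (pair_expo 0 2) + Poly_Mapping.lookup q (pair_expo 1 3))"
      by (simp only: ac_simps)
    also have "\<dots> = 0"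
      using pq by (simp add: quadric_relations_def)
    finally show "p + q \<in> quadric_relations r"
      using pq mp.subspace_add[OF subspace_forms, of p r 2 q] by (simp add: quadric_relations_def lookup_add)
  next
    fix c and p :: "'k mpoly" assume "p \<in> quadric_relations r"
    then show "const_poly c * p \<in> quadric_relations r"
      using mp.subspace_scale[OF subspace_forms, of p r 2 c]
      by (simp add: quadric_relations_def lookup_const_poly_mult distrib_left[symmetric])
  qed
  show "quadric_relations r \<subseteq> (forms r 2 :: 'k mpoly set)"
    by (auto simp: quadric_relations_def)
qed

text \<open>The coefficient of x_2 is detected by multiplying with x_0, that of x_3 with x_1, and
  any other by its own variable, whose square is non-zero in A_2.\<close>

lemma quadric_nondegenerate:
  fixes p :: "'k::field mpoly"
  assumes r: "4 \<le> r" and p: "p \<in> forms r 1" and vp: "\<And>i. i < r \<Longrightarrow> var i * p \<in> quadric_relations r"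
  shows "p = 0"
proof -
  have "Poly_Mapping.lookup p (Poly_Mapping.single k 1) = 0" if "k < r" for k
  proof -
    consider "k = 2" | "k = 3" | "k \<notin> {2, 3}" by blast
    then show ?thesis
    proof cases
      case 1
      have "Poly_Mapping.lookup (var 0 * p) (pair_expo 0 2) + Poly_Mapping.lookup (var 0 * p) (pair_expo 1 3) = 0"
        using vp[of 0] r by (simp add: quadric_relations_def)
      then show ?thesis
        unfolding lookup_var_mult_pair 1 by simp
    next
      case 2
      have "Poly_Mapping.lookup (var 1 * p) (pair_expo 0 2) + Poly_Mapping.lookup (var 1 * p) (pair_expo 1 3) = 0"
        using vp[of 1] r by (simp add: quadric_relations_def)
      then show ?thesis
        unfolding lookup_var_mult_pair 2 by simp
    next
      case 3
      have "Poly_Mapping.lookup (var k * p) (pair_expo k k) = 0"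
        using vp[OF that] 3 that unfolding quadric_relations_def by blast
      then show ?thesis
        unfolding lookup_var_mult_pair by simp
    qed
  qed
  then have "comb r (\<lambda>i. Poly_Mapping.lookup p (Poly_Mapping.single i 1)) var = comb r (\<lambda>_. 0) (var :: nat \<Rightarrow> 'k mpoly)"
    by (intro comb_cong) auto
  with form_1_comb[OF p] show ?thesis by simp
qed

lemma lookup_linear_mult_pair:
  fixes L p :: "'k::field mpoly"
  assumes p: "p \<in> forms r 1" and ij: "i < r" "j < r"
  shows "Poly_Mapping.lookup (L * p) (pair_expo i j) =
    (if i = j then Poly_Mapping.lookup p (Poly_Mapping.single i 1) * Poly_Mapping.lookup L (Poly_Mapping.single i 1)
     else Poly_Mapping.lookup p (Poly_Mapping.single i 1) * Poly_Mapping.lookup L (Poly_Mapping.single j 1)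
       + Poly_Mapping.lookup p (Poly_Mapping.single j 1) * Poly_Mapping.lookup L (Poly_Mapping.single i 1))"
proof -
  let ?p = "\<lambda>k. Poly_Mapping.lookup p (Poly_Mapping.single k 1)"
    and ?L = "\<lambda>k. Poly_Mapping.lookup L (Poly_Mapping.single k 1)"
  have "L * p = comb r ?p (\<lambda>k. var k * L)"
    by (subst form_1_comb[OF p]) (simp add: comb_mult mult.commute)
  then have "Poly_Mapping.lookup (L * p) (pair_expo i j)
      = (\<Sum>k<r. ?p k * (if k = i then ?L j else if k = j then ?L i else 0))"
    by (simp add: comb_def lookup_sum lookup_const_poly_mult lookup_var_mult_pair del: One_nat_def)
  also have "\<dots> = (\<Sum>k\<in>{i, j}. ?p k * (if k = i then ?L j else if k = j then ?L i else 0))"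
    using ij by (intro sum.mono_neutral_right) auto
  finally show ?thesis
    by auto
qed

lemma codim_ge_4_bound:
  assumes r: "4 \<le> r" and all: "all_level_weak_lefschetz TYPE('k::field) r e"
  shows "e \<le> 1"
proof (rule truncated.not_all_level_weak_lefschetz[OF truncated_quadric, of r 1 e])
  show "0 < r" "2 = Suc 1" "(0::nat) < 1" "all_level_weak_lefschetz TYPE('k) r e"
    using r all by simp_all
  show "p = 0" if "p \<in> forms r 1" "\<And>i. i < r \<Longrightarrow> var i * p \<in> quadric_relations r" for p :: "'k mpoly"
    by (rule quadric_nondegenerate[OF r that])
next
  fix L :: "'k mpoly" assume L: "L \<in> forms r 1"
  let ?L = "\<lambda>k. Poly_Mapping.lookup L (Poly_Mapping.single k 1)"
  \<comment> \<open>A zero \<open>(c, d)\<close> of \<open>L\<close> restricted to the first two variables: \<open>L\<close> kills \<open>c x_2 + d x_3\<close>, and the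
    value at \<open>(c, d)\<close> of the part of a quadric in \<open>x_0, x_1\<close> vanishes on all multiples of \<open>L\<close>.\<close>
  obtain c d where cd: "c * ?L 0 + d * ?L 1 = 0" "c \<noteq> 0 \<or> d \<noteq> 0"
  proof (cases "?L 0 = 0 \<and> ?L 1 = 0")
    case True
    then show ?thesis using that[of 1 0] by simp
  next
    case False
    then show ?thesis using that[of "?L 1" "- ?L 0"] by (auto simp: mult.commute)
  qed
  define y where "y = const_poly c * var 2 + const_poly d * (var 3 :: 'k mpoly)"
  have y: "y \<in> forms r 1"
    unfolding y_def using r var_in_forms[of 2 r] var_in_forms[of 3 r]
    by (intro mp.subspace_add[OF subspace_forms] mp.subspace_scale[OF subspace_forms]) auto
  have ly: "Poly_Mapping.lookup y (Poly_Mapping.single k 1) = (if k = 2 then c else if k = 3 then d else 0)" for k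
    by (auto simp: y_def lookup_add lookup_const_poly_mult lookup_monom_poly dest!: arg_cong[of _ _ Poly_Mapping.keys])
  have "y \<noteq> 0"
    using ly[of 2] ly[of 3] cd(2) by auto
  moreover have "L * y \<in> quadric_relations r"
    unfolding quadric_relations_def
  proof (intro CollectI conjI allI impI)
    show "L * y \<in> forms r 2"
      using forms_mult[OF L y] by (simp add: numeral_2_eq_2)
    show "Poly_Mapping.lookup (L * y) (pair_expo i j) = 0"
      if "i < r" "j < r" "i \<notin> {2, 3}" "j \<notin> {2, 3}" for i j
      unfolding lookup_linear_mult_pair[OF y that(1,2)] ly using that by simp
    have "Poly_Mapping.lookup (L * y) (pair_expo 0 2) = c * ?L 0"
      using lookup_linear_mult_pair[OF y, of 0 2 L] r unfolding ly by simp
    moreover have "Poly_Mapping.lookup (L * y) (pair_expo 1 3) = d * ?L 1"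
      using lookup_linear_mult_pair[OF y, of 1 3 L] r unfolding ly by simp
    ultimately show "Poly_Mapping.lookup (L * y) (pair_expo 0 2) + Poly_Mapping.lookup (L * y) (pair_expo 1 3) = 0"
      using cd(1) by simp
  qed
  ultimately show "\<exists>p\<in>forms r 1. p \<noteq> 0 \<and> L * p \<in> quadric_relations r"
    using y by blast
  show "\<exists>q\<in>forms r 2. \<forall>p\<in>forms r 1. q - L * p \<notin> quadric_relations r"
  proof -
    define g where "g q = c * c * Poly_Mapping.lookup q (pair_expo 0 0) + c * d * Poly_Mapping.lookup q (pair_expo 0 1)
        + d * d * Poly_Mapping.lookup q (pair_expo 1 1)" for q
    have g_rel: "g q = 0" if "q \<in> quadric_relations r" for q
      using that r by (simp add: g_def quadric_relations_def)
    have g_mult: "g (L * p) = 0" if p: "p \<in> forms r 1" for p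
    proof -
      \<comment> \<open>Evaluation at (c, d) is multiplicative.\<close>
      have "g (L * p) = (c * Poly_Mapping.lookup p (Poly_Mapping.single 0 1) + d * Poly_Mapping.lookup p (Poly_Mapping.single 1 1))
          * (c * ?L 0 + d * ?L 1)"
      proof -
        have "0 < r" "1 < r" using r by auto
        note l = lookup_linear_mult_pair[OF p this(1) this(1), of L] lookup_linear_mult_pair[OF p this, of L]
          lookup_linear_mult_pair[OF p this(2) this(2), of L]
        show ?thesis
          unfolding g_def l by (simp add: algebra_simps)
      qed
      then show ?thesis
        using cd(1) by simp
    qed
    have ne: "pair_expo 0 0 \<noteq> pair_expo 0 1" "pair_expo 0 0 \<noteq> pair_expo 1 1" "pair_expo 1 1 \<noteq> pair_expo 0 1"
      by (auto simp: pair_expo_def lookup_add lookup_single when_def dest!: arg_cong[of _ _ "\<lambda>m. Poly_Mapping.lookup m 0"])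
    \<comment> \<open>On the squares of x_0 and x_1, \<open>g\<close> takes the values c^2 and
      d^2.\<close>
    obtain i where i: "i < r" "g (monom_poly (pair_expo i i)) \<noteq> 0"
    proof (cases "c = 0")
      case True
      then show ?thesis
        using that[of 1] cd(2) r ne by (simp add: g_def lookup_monom_poly)
    next
      case False
      then show ?thesis
        using that[of 0] r ne by (simp add: g_def lookup_monom_poly)
    qed
    have "monom_poly (pair_expo i i) \<in> (forms r 2 :: 'k mpoly set)"
      using i(1) Poly_Mapping.keys_add[of "Poly_Mapping.single i 1" "Poly_Mapping.single i (1 :: nat)"]
      by (intro monom_poly_in_forms) (auto simp: pair_expo_def mono_degree_add)
    moreover have "monom_poly (pair_expo i i) - L * p \<notin> quadric_relations r" if "p \<in> forms r 1" for p
    proof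
      assume "monom_poly (pair_expo i i) - L * p \<in> quadric_relations r"
      from g_rel[OF this] have "g (monom_poly (pair_expo i i)) = g (L * p)"
        by (simp add: g_def lookup_minus algebra_simps)
      with g_mult[OF that] i(2) show False by simp
    qed
    ultimately show ?thesis by blast
  qed
qed

section \<open>The positive results for small socle degree, and the value of the bound\<close>

context graded_quotient
begin

lemma degree_0_injective:
  assumes "L \<notin> I"
  shows "\<forall>p\<in>forms n 0. L * p \<in> I \<longrightarrow> p \<in> I"
proof (intro ballI impI)
  fix p :: "'k mpoly" assume p: "p \<in> forms n 0" and Lp: "L * p \<in> I"
  obtain c where c: "p = const_poly c"
    using forms_0[OF p] by blast
  have "const_poly c * L \<in> I"
    using Lp by (simp add: c mult.commute)
  then have "c = 0"
    using scale_I_iff[of c L] assms by blast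
  then show "p \<in> I"
    by (simp add: c)
qed

lemma vanishing_surjective:
  assumes "forms n d \<subseteq> I" "d \<le> Suc i"
  shows "\<forall>q\<in>forms n (Suc i). \<exists>p\<in>forms n i. q - L * p \<in> I"
  using forms_in_I_mono[OF assms] mp.subspace_0[OF subspace_forms, of n i]
  by (metis diff_zero mult_zero_right subsetD)

text \<open>Targets beyond degree one vanish, and in degree zero any \<open>L\<close> outside
  \<open>I\<close> is injective.\<close>

lemma weak_lefschetz_socle_degree_1:
  assumes codim: "has_codimension n I r" and r: "1 \<le> r" and van: "forms n 2 \<subseteq> I"
  shows "weak_lefschetz n I"
proof -
  obtain v where v: "\<And>i. i < r \<Longrightarrow> v i \<in> forms n 1" "independent_mod r v"
    using codimensionE[OF codim] by metis
  obtain \<phi> where \<phi>: "functional \<phi>" "\<phi> (v 0) = 1"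
    using dual_functional_exists[OF v(2), of 0] r by auto
  have v0: "v 0 \<in> forms n 1"
    using v(1) r by auto
  show ?thesis
  proof (rule weak_lefschetzI[OF polynomial_functions_functional[OF \<phi>(1)] v0])
    show "\<phi> (degree_one_rep (residue (v 0))) \<noteq> 0"
      using \<phi>(2) functional_degree_one_rep[OF \<phi>(1) v0] by simp
  next
    fix L i assume L: "L \<in> forms n 1" and nz: "\<phi> (degree_one_rep (residue L)) \<noteq> 0"
    have "\<phi> L \<noteq> 0"
      using nz functional_degree_one_rep[OF \<phi>(1) L] by simp
    then have LI: "L \<notin> I"
      using functional_I[OF \<phi>(1)] by blast
    show "(\<forall>p\<in>forms n i. L * p \<in> I \<longrightarrow> p \<in> I) \<or> (\<forall>q\<in>forms n (Suc i). \<exists>p\<in>forms n i. q - L * p \<in> I)"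
    proof (cases "i = 0")
      case True
      then show ?thesis
        using degree_0_injective[OF LI] by blast
    next
      case False
      then show ?thesis
        using vanishing_surjective[OF van, of i L] by simp
    qed
  qed
qed

end

context graded_quotient_char_0
begin

lemma weak_lefschetz_codim_3:
  assumes codim: "has_codimension n I 3" and van: "forms n 3 \<subseteq> I"
    and nondeg: "\<And>p. p \<in> forms n 1 \<Longrightarrow> (\<And>q. q \<in> forms n 1 \<Longrightarrow> q * p \<in> I) \<Longrightarrow> p \<in> I"
  shows "weak_lefschetz n I"
proof -
  obtain L0 where L0: "L0 \<in> forms n 1" "max_rank L0 1"
    using max_rank_dim_3[OF codim nondeg] by blast
  obtain F where F: "F \<in> polynomial_functions n I" "F (residue L0) \<noteq> 0"
    "\<And>L. L \<in> forms n 1 \<Longrightarrow> F (residue L) \<noteq> 0 \<Longrightarrow> max_rank L 1"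
    using max_rank_open[OF L0] by metis
  obtain v where v: "\<And>i. i < 3 \<Longrightarrow> v i \<in> forms n 1" "independent_mod 3 v"
    using codimensionE[OF codim] by metis
  have v0: "v 0 \<in> forms n 1" "v 0 \<notin> I"
    using v(1)[of 0] dual_functional_exists[OF v(2), of 0] functional_I by fastforce+
  show ?thesis
  proof (rule weak_lefschetzI[OF F(1) L0(1) F(2)])
    fix L and i :: nat assume L: "L \<in> forms n 1" "F (residue L) \<noteq> 0"
    \<comment> \<open>Degree zero requires \<open>L\<close> to be non-zero in A_1. Otherwise
      multiplication by \<open>L\<close> is the zero map, so maximal rank in degree one would give
      A_1 = 0 or A_2 = 0, and either contradicts \<open>v0\<close>.\<close>
    have LI: "L \<notin> I"
    proof
      assume "L \<in> I"
      then have Lp: "L * p \<in> I" if "p \<in> forms n d" for p d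
        using I_mult(2)[OF forms_in_polys[OF that]] by blast
      from F(3)[OF L] show False
        unfolding max_rank_def
      proof
        assume "\<forall>p\<in>forms n 1. L * p \<in> I \<longrightarrow> p \<in> I"
        then show False using v0 Lp by blast
      next
        assume surj: "forms n (Suc 1) \<subseteq> image_mod L 1"
        have "q * v 0 \<in> I" if q: "q \<in> forms n 1" for q
        proof -
          have "q * v 0 \<in> image_mod L 1"
            using forms_mult[OF q v0(1)] surj by auto
          then obtain p where "p \<in> forms n 1" "q * v 0 - L * p \<in> I"
            by (auto simp: image_mod_def)
          then show ?thesis
            using I_add[OF _ Lp, of "q * v 0 - L * p" p 1] by simp
        qed
        then show False
          using nondeg[OF v0(1)] v0(2) by blast
      qed
    qed
    consider "i = 0" | "i = 1" | "2 \<le> i" by linarith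
    then show "(\<forall>p\<in>forms n i. L * p \<in> I \<longrightarrow> p \<in> I) \<or> (\<forall>q\<in>forms n (Suc i). \<exists>p\<in>forms n i. q - L * p \<in> I)"
    proof cases
      case 1
      then show ?thesis
        using degree_0_injective[OF LI] by blast
    next
      case 2
      then show ?thesis
        using F(3)[OF L] unfolding max_rank_def surjective_iff by blast
    next
      case 3
      then show ?thesis
        using vanishing_surjective[OF van, of i L] by simp
    qed
  qed
qed

end

lemma all_level_weak_lefschetz_codim_le_2:
  assumes "1 \<le> r" "r \<le> 2"
  shows "all_level_weak_lefschetz TYPE('k::field_char_0) r e"
  unfolding all_level_weak_lefschetz_def
proof (intro allI impI)
  fix n and I :: "'k mpoly set"
  assume I: "homogeneous_ideal n I" and codim: "has_codimension n I r"
  interpret graded_quotient_char_0 n I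
    by unfold_locales (rule I)
  consider "r = 1" | "r = 2" using assms by linarith
  then show "weak_lefschetz n I"
    using weak_lefschetz_codim_1 weak_lefschetz_codim_2 codim by cases auto
qed

lemma all_level_weak_lefschetz_1:
  assumes "1 \<le> r"
  shows "all_level_weak_lefschetz TYPE('k::field) r 1"
  unfolding all_level_weak_lefschetz_def
proof (intro allI impI)
  fix n and I :: "'k mpoly set"
  assume I: "homogeneous_ideal n I" and art: "artinian_ring (quotient_algebra n I)"
    and codim: "has_codimension n I r" and sd: "socle_degree n I \<le> 1"
  interpret graded_quotient n I
    by unfold_locales (rule I)
  show "weak_lefschetz n I"
    using weak_lefschetz_socle_degree_1[OF codim assms] vanishing_above_socle_degree[OF art sd, of 2] by simp
qed

lemma all_level_weak_lefschetz_codim_3: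
  "all_level_weak_lefschetz TYPE('k::field_char_0) 3 2"
  unfolding all_level_weak_lefschetz_def
proof (intro allI impI)
  fix n and I :: "'k mpoly set"
  assume I: "homogeneous_ideal n I" and art: "artinian_ring (quotient_algebra n I)"
    and codim: "has_codimension n I 3" and level: "\<exists>t. level_of_type n I t" and sd: "socle_degree n I \<le> 2"
  interpret graded_quotient_char_0 n I
    by unfold_locales (rule I)
  show "weak_lefschetz n I"
  \<comment> \<open>If A_2 = 0, then all of A_1 is killed by the variables and the non-degeneracy
    required below fails, so this case is separate.\<close>
  proof (cases "forms n 2 \<subseteq> I")
    case True
    then show ?thesis
      by (rule weak_lefschetz_socle_degree_1[OF codim, rotated]) simp
  next
    case False
    have van: "forms n 3 \<subseteq> I"
      using vanishing_above_socle_degree[OF art sd, of 3] by simp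
    then have sd2: "socle_degree n I = 2"
      using socle_degree_eqI[OF False] by (simp add: numeral_3_eq_3 numeral_2_eq_2)
    obtain t where t: "level_of_type n I t"
      using level by blast
    show ?thesis
    proof (rule weak_lefschetz_codim_3[OF codim van])
      fix p :: "'k mpoly" assume p: "p \<in> forms n 1" and *: "\<And>q. q \<in> forms n 1 \<Longrightarrow> q * p \<in> I"
      show "p \<in> I"
        by (rule level_nondegenerate[OF t _ p *[OF var_in_forms]]) (simp_all add: sd2)
    qed
  qed
qed

lemma lefschetz_boundI:
  assumes "all_level_weak_lefschetz k r e" "\<And>e'. all_level_weak_lefschetz k r e' \<Longrightarrow> e' \<le> e"
  shows "lefschetz_bound k r = enat e"
proof -
  have "(GREATEST e. all_level_weak_lefschetz k r e) = e"
    using assms by (intro Greatest_equality)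
  then show ?thesis
    using assms unfolding lefschetz_bound_def by auto
qed

theorem theorem4p4:
  fixes r :: nat
  assumes "r \<ge> 1"
  shows "lefschetz_bound TYPE('k::field_char_0) r =
    (if r \<le> 2 then \<infinity> else if r = 3 then 2 else 1)"
proof -
  consider "r \<le> 2" | "r = 3" | "4 \<le> r" by linarith
  then show ?thesis
  proof cases
    case 1
    then have "all_level_weak_lefschetz TYPE('k) r e" for e
      using all_level_weak_lefschetz_codim_le_2[OF assms] by blast
    then have "\<not> (\<forall>e'. all_level_weak_lefschetz TYPE('k) r e' \<longrightarrow> e' \<le> e)" for e
      using Suc_n_not_le_n by blast
    then show ?thesis
      using 1 by (simp add: lefschetz_bound_def)
  next
    case 2
    have "lefschetz_bound TYPE('k) 3 = enat 2"
      by (rule lefschetz_boundI[OF all_level_weak_lefschetz_codim_3 codim_3_bound])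
    then show ?thesis
      using 2 by (simp add: numeral_eq_enat)
  next
    case 3
    have "lefschetz_bound TYPE('k) r = enat 1"
      by (rule lefschetz_boundI[OF all_level_weak_lefschetz_1[OF assms] codim_ge_4_bound[OF 3]])
    then show ?thesis
      using 3 by (simp add: one_enat_def)
  qed
qed

end
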